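(* Let $\mathbb{L}\subset\mathbb{Z}^N$ be an oriented rank $2$ subgroup which is not contained in any of the standard coordinate hyperplanes of $\mathbb{Z}^N$ and is perpendicular to $(1,\ldots,1)$, and let $\mathcal{S}$ be a perfect surface for $\mathbb{L}$. Let $\mathcal{M}$ be the surface obtained from the tiling of $\mathcal{S}/\mathbb{L}$ by the untwisting construction described in the context. Then $\mathcal{M}$ is tiled with squares so that the black-white diagonals form a bipartite graph isomorphic to the bipartite graph $\Gamma^{\bullet\circ}$ of $\mathcal{S}$, while the red-red diagonals form a graph isomorphic to the quiver $\mathsf{Q}$, the Plücker quiver of $\mathbb{L}$.
   Context: Notation: $\mathbf{e}_1,\ldots,\mathbf{e}_N$ is the standard basis of $\mathbb{Z}^N$; "perpendicular to $(1,\ldots,1)$" means all elements of $\mathbb{L}$ have coordinate sum $0$. Let $B$ be a $2\times N$-matrix whose rows form an oriented $\mathbb{Z}$-basis of $\mathbb{L}$, with columns $\mathbf{b}_1,\ldots,\mathbf{b}_N$. A quiver is a finite directed graph. The Plücker quiver $\mathsf{Q}$ of $\mathbb{L}$ has node set $\{1,\ldots,N\}$ and, whenever $\det(\mathbf{b}_i,\mathbf{b}_j)>0$, exactly $\det(\mathbf{b}_i,\mathbf{b}_j)$ arrows from node $i$ to node $j$, and no other arrows. Surfaces: let $\mathbb{L}_{\mathbb{R}}\subset\mathbb{R}^N$ be the real plane spanned by $\mathbb{L}$. For $\lambda\in\mathbb{R}^N$ the grid lines in $\lambda+\mathbb{L}_{\mathbb{R}}$ are $\mathcal{L}^\lambda_{i,k}=\{z\in\lambda+\mathbb{L}_{\mathbb{R}}\,|\,z_i=k\}$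 ($1\leq i\leq N$, $k\in\mathbb{Z}$); $\lambda$ is non-resonant if no three grid lines pass through one point. Let $F(z_1,\ldots,z_N)=(\lfloor z_1\rfloor,\ldots,\lfloor z_N\rfloor)$. For non-resonant $\lambda$ put $\mathcal{S}^0=F(\lambda+\mathbb{L}_{\mathbb{R}})$ and let $\mathcal{S}$ be the union of all unit squares in $\mathbb{R}^N$ with vertices in $\mathcal{S}^0$, i.e. the squares $\mathbf{p}+\mathrm{conv}(0,\mathbf{e}_i,\mathbf{e}_j,\mathbf{e}_i+\mathbf{e}_j)$, $i\neq j$, all of whose vertices lie in $\mathcal{S}^0$ (such a square has type $(i,j)$). The group $\mathbb{L}$ acts by translations on $\mathcal{S}^0$ and $\mathcal{S}$. An elementary transformation of $\mathcal{S}$: given $\mathbf{p}_0\in\mathcal{S}^0$ with exactly three points $\mathbf{p}_1,\mathbf{p}_2,\mathbf{p}_3\in\mathcal{S}^0$ at distance $1$ and such that $\mathbf{p}_1+\mathbf{p}_2-\mathbf{p}_0$, $\mathbf{p}_1+\mathbf{p}_3-\mathbf{p}_0$, $\mathbf{p}_2+\mathbf{p}_3-\mathbf{p}_0$ also lie in $\mathcal{S}^0$, replace, for all $\ell\in\mathbb{L}$ simultaneously, $\mathbf{p}_0+\ell$ by $\mathbf{p}_1+\mathbf{p}_2+\mathbf{p}_3-2\mathbf{p}_0+\ell$; this gives a new set $\mathcal{S}'^0$, and $\mathcal{S}'$ is the union of all unit squares with vertices in $\mathcal{S}'^0$ (three squares around $\mathbf{p}_0+\ell$ are replaced by three squares around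 the new point). A surface $\mathcal{S}$ obtained from some non-resonant $\lambda$ by finitely many (possibly zero) elementary transformations is perfect if $\mathbf{s}(z)=z_1+\ldots+z_N$ takes only three values on $\mathcal{S}^0$; these are consecutive integers $a-1,a,a+1$. Vertices with $\mathbf{s}=a+1$ are black, those with $\mathbf{s}=a-1$ are white, those with $\mathbf{s}=a$ are grey. Each unit square of a perfect surface has one black, one white and two grey vertices. Tiles and graph: for a perfect $\mathcal{S}$, $E$ is the set of $\mathbb{L}$-orbits of unit squares in $\mathcal{S}$; it is in bijection with the set of arrows of $\mathsf{Q}$. For $e\in E$, $\mathbf{b}(e)$ and $\mathbf{w}(e)$ denote the $\mathbb{L}$-orbits of its black and white vertex, and $\{\mathbf{r}(e),\mathbf{r}'(e)\}=\{i,j\}$ if the square has type $(i,j)$. The bipartite graph $\Gamma^{\bullet\circ}$ has as nodes the $\mathbb{L}$-orbits of black and of white vertices and one edge for each $e\in E$, connecting $\mathbf{b}(e)$ and $\mathbf{w}(e)$. Untwisting construction: for every $e\in E$ take a unit square $\square_e$ and attach to its four vertices the labels $\mathbf{b}(e)$ (colored black), $\mathbf{w}(e)$ (white), $\mathbf{r}(e)$ (red), $\mathbf{r}'(e)$ (red), such that the vertices labeled $\mathbf{b}(e)$ and $\mathbf{w}(e)$ are not adjacent. Whenever two such squares $\square_e$, $\square_{e'}$ have equal labels on two adjacent vertices, glue them along the corresponding sides (respecting labels). The result is a surface $\widetilde{\mathcal{M}}$ tiled with squares. Finally, $\mathcal{M}$ is obtained from $\widetilde{\mathcal{M}}$ by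 identifying, for every $i\in\{1,\ldots,N\}$, all red points with label $i$. The red-red diagonal of a square $\square_e$ with $\{\mathbf{r}(e),\mathbf{r}'(e)\}=\{i,j\}$ and $\det(\mathbf{b}_i,\mathbf{b}_j)>0$ is directed from the vertex labeled $i$ to the vertex labeled $j$. *)

theory Defs
  imports "HOL-Analysis.Analysis" "Graph_Theory.Graph_Theory"
begin

section \<open>The lattice and its Pluecker quiver\<close>

text \<open>
  The orientation of the lattice enters only through the basis: every basis is an oriented
  basis for exactly one of the two orientations.
\<close>

definition is_Z_basis :: "(int ^ 'n) set \<Rightarrow> int ^ 'n ^ 2 \<Rightarrow> bool" where
  "is_Z_basis L B \<longleftrightarrow>
     L = {m *s row 1 B + n *s row 2 B | m n. True} \<and>
     (\<forall>m n. m *s row 1 B + n *s row 2 B = 0 \<longrightarrow> m = 0 \<and> n = 0)"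

definition col_det :: "int ^ 'n ^ 2 \<Rightarrow> 'n \<Rightarrow> 'n \<Rightarrow> int" where
  "col_det B i j = det (transpose (vector [column i B, column j B] :: int ^ 2 ^ 2))"

definition pluecker_quiver :: "int ^ 'n ^ 2 \<Rightarrow> ('n, 'n \<times> 'n \<times> nat) pre_digraph" where
  "pluecker_quiver B =
     \<lparr> verts = UNIV,
       arcs = {(i, j, k). int k < col_det B i j},
       tail = (\<lambda>(i, j, k). i),
       head = (\<lambda>(i, j, k). j) \<rparr>"


section \<open>Surfaces\<close>

definition real_vec :: "int ^ 'n \<Rightarrow> real ^ 'n" where
  "real_vec p = (\<chi> i. real_of_int (p $ i))"

definition affine_plane :: "(int ^ 'n) set \<Rightarrow> real ^ 'n \<Rightarrow> (real ^ 'n) set" where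
  "affine_plane L lam = (\<lambda>x. lam + x) ` span (real_vec ` L)"

definition grid_line :: "(int ^ 'n) set \<Rightarrow> real ^ 'n \<Rightarrow> 'n \<Rightarrow> int \<Rightarrow> (real ^ 'n) set" where
  "grid_line L lam i k = {z \<in> affine_plane L lam. z $ i = real_of_int k}"

text \<open>
  Grid lines are counted with their index: two coinciding lines with different indices
  count as two lines.
\<close>

definition non_resonant :: "(int ^ 'n) set \<Rightarrow> real ^ 'n \<Rightarrow> bool" where
  "non_resonant L lam \<longleftrightarrow>
     \<not> (\<exists>z i1 k1 i2 k2 i3 k3. distinct [(i1, k1), (i2, k2), (i3, k3)] \<and>
          z \<in> grid_line L lam i1 k1 \<and> z \<in> grid_line L lam i2 k2 \<and> z \<in> grid_line L lam i3 k3)"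

definition floor_vec :: "real ^ 'n \<Rightarrow> int ^ 'n" where
  "floor_vec z = (\<chi> i. \<lfloor>z $ i\<rfloor>)"

text \<open>
  A surface is represented by its set of lattice points, which determines it; a unit square
  is represented by the set of its four vertices.
\<close>

definition initial_surface :: "(int ^ 'n) set \<Rightarrow> real ^ 'n \<Rightarrow> (int ^ 'n) set" where
  "initial_surface L lam = floor_vec ` affine_plane L lam"

definition elementary_transformation ::
  "(int ^ 'n) set \<Rightarrow> (int ^ 'n) set \<Rightarrow> (int ^ 'n) set \<Rightarrow> bool" where
  "elementary_transformation L S S' \<longleftrightarrow>
     (\<exists>p0 p1 p2 p3. p0 \<in> S \<and> distinct [p1, p2, p3] \<and>
        {q \<in> S. dist (real_vec p0) (real_vec q) = 1} = {p1, p2, p3} \<and>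
        p1 + p2 - p0 \<in> S \<and> p1 + p3 - p0 \<in> S \<and> p2 + p3 - p0 \<in> S \<and>
        S' = (S - (\<lambda>l. p0 + l) ` L) \<union> (\<lambda>l. p1 + p2 + p3 - 2 *s p0 + l) ` L)"

definition is_surface :: "(int ^ 'n) set \<Rightarrow> (int ^ 'n) set \<Rightarrow> bool" where
  "is_surface L S \<longleftrightarrow>
     (\<exists>lam. non_resonant L lam \<and> rtranclp (elementary_transformation L) (initial_surface L lam) S)"

definition coord_sum :: "int ^ 'n \<Rightarrow> int" where
  "coord_sum z = (\<Sum>i\<in>UNIV. z $ i)"

definition perfect_surface :: "(int ^ 'n) set \<Rightarrow> (int ^ 'n) set \<Rightarrow> bool" where
  "perfect_surface L S \<longleftrightarrow> is_surface L S \<and> card (coord_sum ` S) = 3"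

definition grey_level :: "(int ^ 'n) set \<Rightarrow> int" where
  "grey_level S = Min (coord_sum ` S) + 1"

definition black_vertices :: "(int ^ 'n) set \<Rightarrow> (int ^ 'n) set" where
  "black_vertices S = {v \<in> S. coord_sum v = grey_level S + 1}"

definition white_vertices :: "(int ^ 'n) set \<Rightarrow> (int ^ 'n) set" where
  "white_vertices S = {v \<in> S. coord_sum v = grey_level S - 1}"

definition unit_square :: "int ^ 'n \<Rightarrow> 'n \<Rightarrow> 'n \<Rightarrow> (int ^ 'n) set" where
  "unit_square p i j = {p, p + axis i 1, p + axis j 1, p + axis i 1 + axis j 1}"

definition unit_squares :: "(int ^ 'n) set \<Rightarrow> (int ^ 'n) set set" where
  "unit_squares S = {unit_square p i j | p i j. i \<noteq> j \<and> unit_square p i j \<subseteq> S}"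


section \<open>Tiles and the bipartite graph\<close>

definition orbit :: "(int ^ 'n) set \<Rightarrow> int ^ 'n \<Rightarrow> (int ^ 'n) set" where
  "orbit L v = (\<lambda>l. l + v) ` L"

definition square_orbit :: "(int ^ 'n) set \<Rightarrow> (int ^ 'n) set \<Rightarrow> (int ^ 'n) set set" where
  "square_orbit L Q = (\<lambda>l. (\<lambda>v. l + v) ` Q) ` L"

definition tiles :: "(int ^ 'n) set \<Rightarrow> (int ^ 'n) set \<Rightarrow> (int ^ 'n) set set set" where
  "tiles L S = square_orbit L ` unit_squares S"

definition tile_black ::
  "(int ^ 'n) set \<Rightarrow> (int ^ 'n) set \<Rightarrow> (int ^ 'n) set set \<Rightarrow> (int ^ 'n) set" where
  "tile_black L S e = (THE b. \<exists>Q\<in>e. \<exists>v\<in>Q. v \<in> black_vertices S \<and> b = orbit L v)"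

definition tile_white ::
  "(int ^ 'n) set \<Rightarrow> (int ^ 'n) set \<Rightarrow> (int ^ 'n) set set \<Rightarrow> (int ^ 'n) set" where
  "tile_white L S e = (THE w. \<exists>Q\<in>e. \<exists>v\<in>Q. v \<in> white_vertices S \<and> w = orbit L v)"

text \<open>
  The two directions of a tile, ordered such that the determinant is positive; this is also
  the direction of the red-red diagonal.
\<close>

definition tile_type :: "int ^ 'n ^ 2 \<Rightarrow> (int ^ 'n) set set \<Rightarrow> 'n \<times> 'n" where
  "tile_type B e = (THE (i, j). (\<exists>p. unit_square p i j \<in> e) \<and> col_det B i j > 0)"

text \<open>Bipartite graphs may have multiple edges. Isomorphisms preserve the colours.\<close>

record ('v, 'e) bipartite_graph =
  black_nodes :: "'v set"
  white_nodes :: "'v set"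
  edges :: "'e set"
  black_end :: "'e \<Rightarrow> 'v"
  white_end :: "'e \<Rightarrow> 'v"

definition wf_bipartite :: "('v, 'e) bipartite_graph \<Rightarrow> bool" where
  "wf_bipartite G \<longleftrightarrow> black_nodes G \<inter> white_nodes G = {} \<and>
     black_end G ` edges G \<subseteq> black_nodes G \<and> white_end G ` edges G \<subseteq> white_nodes G"

definition bipartite_iso :: "('v, 'e) bipartite_graph \<Rightarrow> ('w, 'f) bipartite_graph \<Rightarrow> bool" where
  "bipartite_iso G H \<longleftrightarrow> wf_bipartite G \<and> wf_bipartite H \<and>
     (\<exists>f g. bij_betw f (black_nodes G) (black_nodes H) \<and>
            bij_betw f (white_nodes G) (white_nodes H) \<and>
            bij_betw g (edges G) (edges H) \<and>
            (\<forall>e\<in>edges G. black_end H (g e) = f (black_end G e) \<and>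
                         white_end H (g e) = f (white_end G e)))"

definition surface_graph ::
  "(int ^ 'n) set \<Rightarrow> (int ^ 'n) set \<Rightarrow> ((int ^ 'n) set, (int ^ 'n) set set) bipartite_graph" where
  "surface_graph L S =
     \<lparr> black_nodes = orbit L ` black_vertices S,
       white_nodes = orbit L ` white_vertices S,
       edges = tiles L S,
       black_end = tile_black L S,
       white_end = tile_white L S \<rparr>"


section \<open>Quotient spaces\<close>

text \<open>The quotient of a space by the equivalence relation generated by a given relation.\<close>

definition generated_equiv :: "'a set \<Rightarrow> ('a \<times> 'a) set \<Rightarrow> ('a \<times> 'a) set" where
  "generated_equiv A r = Restr ((Restr (r \<union> r\<inverse>) A)\<^sup>*) A"

definition quotient_point :: "'a topology \<Rightarrow> ('a \<times> 'a) set \<Rightarrow> 'a \<Rightarrow> 'a set" where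
  "quotient_point X r x = generated_equiv (topspace X) r `` {x}"

definition quotient_space :: "'a topology \<Rightarrow> ('a \<times> 'a) set \<Rightarrow> 'a set topology" where
  "quotient_space X r =
     topology (\<lambda>U. U \<subseteq> topspace X // generated_equiv (topspace X) r \<and> openin X (\<Union>U))"

lemma equiv_generated_equiv: "equiv A (generated_equiv A r)"
proof -
  have "sym (Restr (r \<union> r\<inverse>) A)"
    by (auto simp: sym_def)
  then have "sym ((Restr (r \<union> r\<inverse>) A)\<^sup>*)"
    by (rule sym_rtrancl)
  then show ?thesis
    unfolding generated_equiv_def equiv_def refl_on_def sym_def trans_def
    by (blast intro: rtrancl_trans)
qed

lemma openin_quotient_space:
  "openin (quotient_space X r) U \<longleftrightarrow>
     U \<subseteq> topspace X // generated_equiv (topspace X) r \<and> openin X (\<Union>U)"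
proof -
  let ?Q = "topspace X // generated_equiv (topspace X) r"
  have Int: "\<Union>(U \<inter> V) = \<Union>U \<inter> \<Union>V" if "U \<subseteq> ?Q" "V \<subseteq> ?Q" for U V
    using that quotient_disj[OF equiv_generated_equiv[of "topspace X" r]] by blast
  have Un: "\<Union>(\<Union>K) = \<Union>(Union ` K)" for K :: "'a set set set"
    by blast
  have "istopology (\<lambda>U. U \<subseteq> ?Q \<and> openin X (\<Union>U))"
    unfolding istopology_def
  proof (intro conjI allI impI)
    fix U V assume "U \<subseteq> ?Q \<and> openin X (\<Union>U)" "V \<subseteq> ?Q \<and> openin X (\<Union>V)"
    then show "U \<inter> V \<subseteq> ?Q" "openin X (\<Union>(U \<inter> V))"
      using Int[of U V] by auto
  next
    fix K assume "\<forall>U\<in>K. U \<subseteq> ?Q \<and> openin X (\<Union>U)"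
    then show "\<Union>K \<subseteq> ?Q" "openin X (\<Union>(\<Union>K))"
      unfolding Un by auto
  qed
  then show ?thesis
    by (simp add: quotient_space_def)
qed

lemma topspace_quotient_space:
  "topspace (quotient_space X r) = topspace X // generated_equiv (topspace X) r"
proof -
  have "openin (quotient_space X r) (topspace X // generated_equiv (topspace X) r)"
    by (simp add: openin_quotient_space Union_quotient[OF equiv_generated_equiv])
  then show ?thesis
    by (meson openin_quotient_space openin_subset openin_topspace subset_antisym)
qed

lemma quotient_map_quotient_point: "quotient_map X (quotient_space X r) (quotient_point X r)"
  unfolding quotient_map_def topspace_quotient_space
proof (intro conjI allI impI)
  let ?R = "generated_equiv (topspace X) r"
  show "quotient_point X r ` topspace X = topspace X // ?R"
    by (auto simp: quotient_point_def quotient_def)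
  fix U assume U: "U \<subseteq> topspace X // ?R"
  have "{x \<in> topspace X. quotient_point X r x \<in> U} = \<Union>U"
  proof (intro set_eqI iffI)
    fix x assume "x \<in> {x \<in> topspace X. quotient_point X r x \<in> U}"
    then show "x \<in> \<Union>U"
      using equiv_class_self[OF equiv_generated_equiv, of x "topspace X" r]
      by (auto simp: quotient_point_def)
  next
    fix x assume "x \<in> \<Union>U"
    then obtain C where C: "C \<in> U" "x \<in> C"
      by blast
    then obtain y where "y \<in> topspace X" "C = ?R `` {y}"
      using U by (auto elim: quotientE)
    then have "(y, x) \<in> ?R"
      using C by simp
    then have "?R `` {x} = C" "x \<in> topspace X"
      using equiv_class_eq[OF equiv_generated_equiv] \<open>C = _\<close>
      by (fastforce, auto simp: generated_equiv_def)
    then show "x \<in> {x \<in> topspace X. quotient_point X r x \<in> U}"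
      using C by (simp add: quotient_point_def)
  qed
  then show "openin X {x \<in> topspace X. quotient_point X r x \<in> U} = openin (quotient_space X r) U"
    using U by (simp add: openin_quotient_space)
qed


section \<open>The untwisting construction\<close>

definition std_square :: "(real \<times> real) set" where
  "std_square = {0..1} \<times> {0..1}"

definition corners :: "(real \<times> real) set" where
  "corners = {0, 1} \<times> {0, 1}"

definition adjacent :: "real \<times> real \<Rightarrow> real \<times> real \<Rightarrow> bool" where
  "adjacent c d \<longleftrightarrow> c \<in> corners \<and> d \<in> corners \<and> dist c d = 1"

definition sides :: "(real \<times> real) set set" where
  "sides = {closed_segment c d | c d. adjacent c d}"

datatype ('v, 'i) label = Black 'v | White 'v | Red 'i

text \<open>
  The black corner is \<open>(0, 0)\<close> and the white corner \<open>(1, 1)\<close>. The red-red diagonal runs from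
  \<open>(1, 0)\<close> to \<open>(0, 1)\<close>.
\<close>

definition corner_label ::
  "(int ^ 'n) set \<Rightarrow> int ^ 'n ^ 2 \<Rightarrow> (int ^ 'n) set \<Rightarrow> (int ^ 'n) set set \<Rightarrow> real \<times> real \<Rightarrow>
     ((int ^ 'n) set, 'n) label" where
  "corner_label L B S e c =
     (if c = (0, 0) then Black (tile_black L S e)
      else if c = (1, 1) then White (tile_white L S e)
      else if c = (1, 0) then Red (fst (tile_type B e))
      else Red (snd (tile_type B e)))"

definition disjoint_squares :: "'e set \<Rightarrow> ('e \<times> real \<times> real) topology" where
  "disjoint_squares E = prod_topology (discrete_topology E) (top_of_set std_square)"

definition side_gluing ::
  "'e set \<Rightarrow> ('e \<Rightarrow> real \<times> real \<Rightarrow> 'l) \<Rightarrow> (('e \<times> real \<times> real) \<times> ('e \<times> real \<times> real)) set" where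
  "side_gluing E lab =
     {((e, (1 - t) *\<^sub>R c + t *\<^sub>R d), (e', (1 - t) *\<^sub>R c' + t *\<^sub>R d')) | e e' c d c' d' t.
        e \<in> E \<and> e' \<in> E \<and> adjacent c d \<and> adjacent c' d' \<and>
        lab e c = lab e' c' \<and> lab e d = lab e' d' \<and> 0 \<le> t \<and> t \<le> 1}"

definition M_tilde ::
  "(int ^ 'n) set \<Rightarrow> int ^ 'n ^ 2 \<Rightarrow> (int ^ 'n) set \<Rightarrow>
     ((int ^ 'n) set set \<times> real \<times> real) set topology" where
  "M_tilde L B S =
     quotient_space (disjoint_squares (tiles L S)) (side_gluing (tiles L S) (corner_label L B S))"

definition M_tilde_tile ::
  "(int ^ 'n) set \<Rightarrow> int ^ 'n ^ 2 \<Rightarrow> (int ^ 'n) set \<Rightarrow> (int ^ 'n) set set \<Rightarrow> real \<times> real \<Rightarrow>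
     ((int ^ 'n) set set \<times> real \<times> real) set" where
  "M_tilde_tile L B S e x =
     quotient_point (disjoint_squares (tiles L S))
       (side_gluing (tiles L S) (corner_label L B S)) (e, x)"

definition red_points ::
  "(int ^ 'n) set \<Rightarrow> int ^ 'n ^ 2 \<Rightarrow> (int ^ 'n) set \<Rightarrow> 'n \<Rightarrow>
     ((int ^ 'n) set set \<times> real \<times> real) set set" where
  "red_points L B S i =
     {M_tilde_tile L B S e c | e c. e \<in> tiles L S \<and> c \<in> corners \<and> corner_label L B S e c = Red i}"

definition M_space ::
  "(int ^ 'n) set \<Rightarrow> int ^ 'n ^ 2 \<Rightarrow> (int ^ 'n) set \<Rightarrow>
     ((int ^ 'n) set set \<times> real \<times> real) set set topology" where
  "M_space L B S =
     quotient_space (M_tilde L B S) (\<Union>i. red_points L B S i \<times> red_points L B S i)"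

definition M_tile ::
  "(int ^ 'n) set \<Rightarrow> int ^ 'n ^ 2 \<Rightarrow> (int ^ 'n) set \<Rightarrow> (int ^ 'n) set set \<Rightarrow> real \<times> real \<Rightarrow>
     ((int ^ 'n) set set \<times> real \<times> real) set set" where
  "M_tile L B S e x =
     quotient_point (M_tilde L B S) (\<Union>i. red_points L B S i \<times> red_points L B S i)
       (M_tilde_tile L B S e x)"


section \<open>Tilings with squares and the graphs formed by the diagonals\<close>

definition faces :: "(real \<times> real \<Rightarrow> 'a) \<Rightarrow> 'a set set" where
  "faces \<phi> = {\<phi> ` {c} | c. c \<in> corners} \<union> {\<phi> ` \<sigma> | \<sigma>. \<sigma> \<in> sides}"

text \<open>
  Finitely many embedded squares cover the space, two of them meet only in common sides and
  common corners, and every side belongs to exactly two squares. Several corners of the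
  squares at a point may be pinched together: the space need not be locally Euclidean at
  the vertices.
\<close>

definition square_tiling :: "'a topology \<Rightarrow> 'e set \<Rightarrow> ('e \<Rightarrow> real \<times> real \<Rightarrow> 'a) \<Rightarrow> bool" where
  "square_tiling X E \<phi> \<longleftrightarrow>
     Hausdorff_space X \<and> finite E \<and>
     (\<forall>e\<in>E. embedding_map (top_of_set std_square) X (\<phi> e)) \<and>
     topspace X = (\<Union>e\<in>E. \<phi> e ` std_square) \<and>
     (\<forall>e\<in>E. \<forall>e'\<in>E. e \<noteq> e' \<longrightarrow>
        \<phi> e ` std_square \<inter> \<phi> e' ` std_square = \<Union>(faces (\<phi> e) \<inter> faces (\<phi> e'))) \<and>
     (\<forall>e\<in>E. \<forall>\<sigma>\<in>sides. card {e' \<in> E. \<exists>\<sigma>'\<in>sides. \<phi> e ` \<sigma> = \<phi> e' ` \<sigma>'} = 2)"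

definition bw_diagonal :: "('e \<Rightarrow> real \<times> real \<Rightarrow> 'a) \<Rightarrow> 'e \<Rightarrow> 'a set" where
  "bw_diagonal \<phi> e = \<phi> e ` closed_segment (0, 0) (1, 1)"

definition rr_diagonal :: "('e \<Rightarrow> real \<times> real \<Rightarrow> 'a) \<Rightarrow> 'e \<Rightarrow> 'a set" where
  "rr_diagonal \<phi> e = \<phi> e ` closed_segment (1, 0) (0, 1)"

text \<open>
  The edges are the diagonals as subsets of the space; for a tiling, the tile is determined
  by its diagonal, so that the inverses below make sense.
\<close>

definition bw_diagonal_graph ::
  "'e set \<Rightarrow> ('e \<Rightarrow> real \<times> real \<Rightarrow> 'a) \<Rightarrow> ('a, 'a set) bipartite_graph" where
  "bw_diagonal_graph E \<phi> =
     \<lparr> black_nodes = (\<lambda>e. \<phi> e (0, 0)) ` E,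
       white_nodes = (\<lambda>e. \<phi> e (1, 1)) ` E,
       edges = bw_diagonal \<phi> ` E,
       black_end = (\<lambda>D. \<phi> (the_inv_into E (bw_diagonal \<phi>) D) (0, 0)),
       white_end = (\<lambda>D. \<phi> (the_inv_into E (bw_diagonal \<phi>) D) (1, 1)) \<rparr>"

definition rr_diagonal_graph ::
  "'e set \<Rightarrow> ('e \<Rightarrow> real \<times> real \<Rightarrow> 'a) \<Rightarrow> ('a, 'a set) pre_digraph" where
  "rr_diagonal_graph E \<phi> =
     \<lparr> verts = (\<lambda>e. \<phi> e (1, 0)) ` E \<union> (\<lambda>e. \<phi> e (0, 1)) ` E,
       arcs = rr_diagonal \<phi> ` E,
       tail = (\<lambda>D. \<phi> (the_inv_into E (rr_diagonal \<phi>) D) (1, 0)),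
       head = (\<lambda>D. \<phi> (the_inv_into E (rr_diagonal \<phi>) D) (0, 1)) \<rparr>"

end

theory Submission
  imports Defs
begin

text \<open>
  Write \<open>b i\<close> for column \<open>i\<close> of \<open>B\<close>. In the plane
  \<open>lam + span L\<close> the grid lines with index \<open>i\<close> are the parallel lines
  normal to \<open>b i\<close>, the points of the initial surface are the chambers of the
  arrangement of all grid lines, and its unit squares of type \<open>(i, j)\<close> are the
  crossings of a line of index \<open>i\<close> with a line of index \<open>j\<close>. An
  elementary transformation pushes a line across the crossing of two others, so the later
  surfaces are chambers of arrangements of curves.

  All that is used about a surface is collected in the locale \<open>grid_surface\<close>: it is
  periodic; for \<open>p\<close>, \<open>q\<close> in it the sign vector of \<open>q - p\<close>
  is compatible with an open half plane, in the sense that the columns with these signs have no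
  nonnegative dependency (\<open>realizable\<close>); lines of two transversal indices cross in
  a square; every vertex lies on a square. For line arrangements this is immediate
  (\<open>initial_grid_surface\<close>), and it survives elementary transformations
  (\<open>grid_surface_flipped\<close>). By the sign condition, the edges across one grid line
  form a chain that is monotone in every coordinate (\<open>edge_chain\<close>). Hence two lines
  cross at most once (\<open>square_unique\<close>) and, as transversal lines do cross, every
  edge has exactly one square on either side (\<open>edge_successor\<close>,
  \<open>edge_successor_unique\<close>).

  So the squares of type \<open>(i, j)\<close> correspond to \<open>\<int> \<times>
  \<int>\<close> through their coordinates \<open>i\<close> and \<open>j\<close>, and their
  orbits to the cosets of a lattice of index \<open>col_det B i j\<close>
  (\<open>card_tiles_of_type\<close>): as many as there are arrows from \<open>i\<close> to
  \<open>j\<close>. On a perfect surface the lowest corner of a square is white and the highest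
  is black, so at a white or black vertex all edges point in one direction. There each edge lies
  on exactly two squares, and the squares form a single cycle, because by the sign condition the
  next edge of the cycle is the next one in angular order (\<open>link_connected\<close>). These
  two facts say that every side of the untwisted surface belongs to two tiles, and that all
  black (white) corners with the same label are glued to one point.

  It remains to recognise the glued space. The bilinear weights of the labels, together with one
  bump function in the interior of each tile, are constant on the identified points and separate
  all others (\<open>tile_eq_iff\<close>). They map the space continuously and injectively to a
  product of lines, so it is a Hausdorff space in which compact tiles are embedded, and the
  meeting of tiles and diagonals can be read off from the labels of corners.
\<close>

section \<open>Sign vectors\<close>

lemma col_det_eq: "col_det B i j = B$1$i * B$2$j - B$1$j * B$2$i"
  by (simp add: col_det_def det_2 transpose_def column_def)

lemma col_det_swap: "col_det B j i = - col_det B i j"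
  by (simp add: col_det_eq)

lemma col_det_same [simp]: "col_det B i i = 0"
  by (simp add: col_det_eq)

lemma axis_component: "axis i c $ j = (if j = i then c else 0)"
  by (simp add: axis_def)

text \<open>
  By Caratheodory's theorem in the plane, dependencies with at most three terms suffice to
  express that some open half plane contains all columns, taken with the signs of
  \<open>d\<close>. This form, rather than the existence of the half plane, makes it possible to
  compare two difference vectors that agree on three coordinates only.
\<close>

definition realizable :: "int ^ 'n ^ 2 \<Rightarrow> int ^ 'n \<Rightarrow> bool" where
  "realizable B d \<longleftrightarrow>
     (\<forall>i j k a b c. d$i \<noteq> 0 \<longrightarrow> d$j \<noteq> 0 \<longrightarrow> d$k \<noteq> 0 \<longrightarrow> 0 \<le> a \<longrightarrow> 0 \<le> b \<longrightarrow> 0 \<le> c \<longrightarrow>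
        (\<forall>r. a * (sgn (d$i) * B$r$i) + b * (sgn (d$j) * B$r$j) + c * (sgn (d$k) * B$r$k) = 0) \<longrightarrow>
        a = 0 \<and> b = 0 \<and> c = 0)"

lemma realizableD:
  assumes "realizable B d" "d$i \<noteq> 0" "d$j \<noteq> 0" "d$k \<noteq> 0" "0 \<le> a" "0 \<le> b" "0 \<le> c"
    and "\<And>r. a * (sgn (d$i) * B$r$i) + b * (sgn (d$j) * B$r$j) + c * (sgn (d$k) * B$r$k) = 0"
  shows "a = 0" "b = 0" "c = 0"
  using assms unfolding realizable_def by blast+

lemma realizable_minus:
  assumes "realizable B d"
  shows "realizable B (- d)"
  unfolding realizable_def
proof (intro allI impI)
  fix i j k a b c
  assume *: "(- d)$i \<noteq> 0" "(- d)$j \<noteq> 0" "(- d)$k \<noteq> 0" "0 \<le> a" "0 \<le> b" "0 \<le> (c::int)"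
    "\<forall>r. a * (sgn ((- d)$i) * B$r$i) + b * (sgn ((- d)$j) * B$r$j) + c * (sgn ((- d)$k) * B$r$k) = 0"
  have "a * (sgn (d$i) * B$r$i) + b * (sgn (d$j) * B$r$j) + c * (sgn (d$k) * B$r$k) = 0" for r
    using *(7)[rule_format, of r] by (simp add: sgn_minus)
  then show "a = 0 \<and> b = 0 \<and> c = 0"
    using realizableD[OF assms, of i j k a b c] * by simp
qed

lemma realizable_halfplane:
  fixes x y :: "'a :: linordered_idom"
  assumes "\<And>i. d$i \<noteq> 0 \<Longrightarrow> 0 < of_int (sgn (d$i)) * (of_int (B$1$i) * x + of_int (B$2$i) * y)"
  shows "realizable B d"
  unfolding realizable_def
proof (intro allI impI)
  fix i j k and a b c :: int
  assume nz: "d$i \<noteq> 0" "d$j \<noteq> 0" "d$k \<noteq> 0" and nn: "0 \<le> a" "0 \<le> b" "0 \<le> c"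
    and eq: "\<forall>r. a * (sgn (d$i) * B$r$i) + b * (sgn (d$j) * B$r$j) + c * (sgn (d$k) * B$r$k) = 0"
  define v where "v m = of_int (sgn (d$m)) * (of_int (B$1$m) * x + of_int (B$2$m) * y)" for m
  have pos: "0 < v i" "0 < v j" "0 < v k"
    using assms nz by (auto simp: v_def)
  have "of_int a * v i + of_int b * v j + of_int c * v k =
     of_int (a * (sgn (d$i) * B$1$i) + b * (sgn (d$j) * B$1$j) + c * (sgn (d$k) * B$1$k)) * x +
     of_int (a * (sgn (d$i) * B$2$i) + b * (sgn (d$j) * B$2$j) + c * (sgn (d$k) * B$2$k)) * y"
    by (simp add: v_def algebra_simps)
  then have "of_int a * v i + of_int b * v j + of_int c * v k = 0"
    using eq by simp
  moreover have "0 \<le> of_int a * v i" "0 \<le> of_int b * v j" "0 \<le> of_int c * v k"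
    using pos nn by simp_all
  ultimately have "of_int a * v i = 0" "of_int b * v j = 0" "of_int c * v k = 0"
    by linarith+
  then show "a = 0 \<and> b = 0 \<and> c = 0"
    using pos by simp
qed

lemma unit_square_mem:
  "p \<in> unit_square p i j" "p + axis i 1 \<in> unit_square p i j" "p + axis j 1 \<in> unit_square p i j"
  "p + axis i 1 + axis j 1 \<in> unit_square p i j"
  by (auto simp: unit_square_def)

section \<open>Grid surfaces\<close>

locale plane_lattice =
  fixes L :: "(int ^ 'n) set" and B :: "int ^ 'n ^ 2"
  assumes basis: "is_Z_basis L B"
    and essential: "\<forall>i. \<not> L \<subseteq> {l. l $ i = 0}"
begin

lemma mem_L: "l \<in> L \<longleftrightarrow> (\<exists>x y. \<forall>i. l$i = B$1$i * x + B$2$i * y)"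
proof -
  have "l \<in> L \<longleftrightarrow> (\<exists>x y. l = x *s row 1 B + y *s row 2 B)"
    using basis by (auto simp: is_Z_basis_def)
  then show ?thesis
    by (simp add: vec_eq_iff row_def mult.commute)
qed

lemma L_zero: "0 \<in> L"
  unfolding mem_L by (rule exI[of _ 0], rule exI[of _ 0]) simp

lemma L_minus: assumes "l \<in> L" shows "- l \<in> L"
proof -
  obtain x y where "\<forall>i. l$i = B$1$i * x + B$2$i * y"
    using assms mem_L by blast
  then show ?thesis
    unfolding mem_L by (intro exI[of _ "-x"] exI[of _ "-y"]) (simp add: algebra_simps)
qed

lemma L_add: assumes "l \<in> L" "l' \<in> L" shows "l + l' \<in> L"
proof -
  obtain x y where "\<forall>i. l$i = B$1$i * x + B$2$i * y"
    using assms mem_L by blast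
  moreover obtain x' y' where "\<forall>i. l'$i = B$1$i * x' + B$2$i * y'"
    using assms mem_L by blast
  ultimately show ?thesis
    unfolding mem_L by (intro exI[of _ "x + x'"] exI[of _ "y + y'"]) (simp add: algebra_simps)
qed

lemma L_diff: "l \<in> L \<Longrightarrow> l' \<in> L \<Longrightarrow> l - l' \<in> L"
  using L_add[of l "- l'"] L_minus by simp

lemma column_nonzero: "B$1$i \<noteq> 0 \<or> B$2$i \<noteq> 0"
  using essential[rule_format, of i] mem_L by fastforce

lemma column_norm_pos: "0 < B$1$i * B$1$i + B$2$i * B$2$i"
  using column_nonzero[of i] by (simp add: sum_squares_gt_zero_iff)

lemma ex_transversal: "\<exists>j. col_det B i j \<noteq> 0"
proof (rule ccontr)
  assume "\<not> ?thesis"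
  then have "B$2$i *s row 1 B + (- B$1$i) *s row 2 B = 0"
    by (simp add: vec_eq_iff row_def col_det_eq algebra_simps)
  then show False
    using basis column_nonzero[of i] unfolding is_Z_basis_def by (metis neg_equal_0_iff_equal)
qed

lemma realizable_L: assumes "l \<in> L" shows "realizable B l"
proof -
  obtain x y where "\<And>i. l$i = B$1$i * x + B$2$i * y"
    using assms mem_L by blast
  then show ?thesis
    by (intro realizable_halfplane[where x = x and y = y]) (auto simp: sgn_if split: if_splits)
qed

end

text \<open>
  A square of type \<open>(i, j)\<close> with lowest corner \<open>p\<close> is the crossing of
  the grid line between the levels \<open>p$i\<close> and \<open>p$i + 1\<close> with the one
  between \<open>p$j\<close> and \<open>p$j + 1\<close>.
\<close>

locale grid_surface = plane_lattice L B for L :: "(int ^ 'n) set" and B +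
  fixes S :: "(int ^ 'n) set"
  assumes translate: "l \<in> L \<Longrightarrow> v \<in> S \<Longrightarrow> l + v \<in> S"
    and realizable: "p \<in> S \<Longrightarrow> q \<in> S \<Longrightarrow> realizable B (q - p)"
    and crossing: "col_det B i j \<noteq> 0 \<Longrightarrow> \<exists>p. p$i = k \<and> p$j = m \<and> unit_square p i j \<subseteq> S"
    and vertex: "v \<in> S \<Longrightarrow> \<exists>p i j. i \<noteq> j \<and> unit_square p i j \<subseteq> S \<and> v \<in> unit_square p i j"
begin

definition edge :: "'n \<Rightarrow> int ^ 'n \<Rightarrow> bool" where
  "edge m p \<longleftrightarrow> p \<in> S \<and> p + axis m 1 \<in> S"

text \<open>
  If a parallel line separated two edges across the same grid line, the differences taken with
  either end of one of them would contain opposite multiples of the same direction.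
\<close>

lemma edge_parallel:
  assumes "edge m p" "edge m q" "p$m = q$m" "col_det B m j = 0"
  shows "q$j = p$j"
proof (rule ccontr)
  assume ne: "q$j \<noteq> p$j"
  let ?s = "sgn (q$j - p$j)"
  let ?N = "B$1$m * B$1$m + B$2$m * B$2$m"
  let ?t = "B$1$m * B$1$j + B$2$m * B$2$j"
  have jm: "j \<noteq> m" using ne assms by auto
  have par: "?N * B$r$j = ?t * B$r$m" for r
  proof -
    have "(x * x + y * y) * v = (x * v + y * w) * x" "(x * x + y * y) * w = (x * v + y * w) * y"
      if "x * w = v * y" for x y v w :: int
      using that by algebra+
    note this[OF assms(4)[unfolded col_det_eq right_minus_eq]]
    then show ?thesis
      using exhaust_2[of r] by (elim disjE) simp_all
  qed
  have real: "realizable B (q + axis m 1 - p)" "realizable B (q - (p + axis m 1))"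
    using assms realizable by (auto simp: edge_def)
  show False
  proof (cases "0 \<le> - ?s * ?t")
    case True
    have eq: "?N * (?s * B$r$j) + (- ?s * ?t) * B$r$m = 0" for r
      using par[of r] by algebra
    show False
      using realizableD(1)[OF real(1), of j m m ?N "- ?s * ?t" 0] column_norm_pos[of m] eq jm ne True assms(3)
      by (simp add: axis_component)
  next
    case False
    have eq: "?N * (?s * B$r$j) + (?s * ?t) * (- B$r$m) = 0" for r
      using par[of r] by algebra
    show False
      using realizableD(1)[OF real(2), of j m m ?N "?s * ?t" 0] column_norm_pos[of m] eq jm ne False assms(3)
      by (simp add: axis_component)
  qed
qed

text \<open>
  Suppose coordinates \<open>j\<close> and \<open>l\<close> violate monotonicity. A positive
  combination of the two signed columns is then a multiple \<open>- t\<close> of the column of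
  \<open>m\<close>. As the coordinate \<open>m\<close> of the difference can be made
  \<open>1\<close> or \<open>-1\<close> by the choice of ends of the two edges, one of the two
  choices contradicts the sign condition.
\<close>

lemma edge_chain:
  assumes "edge m p" "edge m q" "p$m = q$m"
  shows "(\<forall>j. 0 \<le> col_det B m j * (q$j - p$j)) \<or> (\<forall>j. col_det B m j * (q$j - p$j) \<le> 0)"
proof (rule ccontr)
  assume "\<not> ?thesis"
  then obtain j l where j: "col_det B m j * (q$j - p$j) > 0" and l: "col_det B m l * (q$l - p$l) < 0"
    by (auto simp: not_le)
  let ?sj = "sgn (q$j - p$j)" and ?sl = "sgn (q$l - p$l)"
  let ?a = "- col_det B m l * ?sl" and ?b = "col_det B m j * ?sj"
  let ?t = "?sj * ?sl * col_det B j l"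
  have nz: "q$j \<noteq> p$j" "q$l \<noteq> p$l" "j \<noteq> m" "l \<noteq> m"
    using j l by auto
  have pos: "0 < ?a" "0 < ?b"
    using j l by (auto simp: sgn_if zero_less_mult_iff mult_less_0_iff)
  have eq: "?a * (?sj * B$r$j) + ?b * (?sl * B$r$l) + ?t * B$r$m = 0" for r
    using exhaust_2[of r] by (auto simp: col_det_eq algebra_simps)
  have real: "realizable B (q + axis m 1 - p)" "realizable B (q - (p + axis m 1))"
    using assms realizable by (auto simp: edge_def)
  show False
  proof (cases "0 \<le> ?t")
    case True
    have "?a = 0"
    proof (rule realizableD(1)[OF real(1), of j l m ?a ?b ?t])
      show "?a * (sgn ((q + axis m 1 - p) $ j) * B$r$j) + ?b * (sgn ((q + axis m 1 - p) $ l) * B$r$l) +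
          ?t * (sgn ((q + axis m 1 - p) $ m) * B$r$m) = 0" for r
        using eq[of r] nz assms(3) by (simp add: axis_component)
    qed (use nz assms(3) pos True in \<open>auto simp: axis_component\<close>)
    then show False using pos(1) by (metis less_irrefl)
  next
    case False
    have eq': "?a * (?sj * B$r$j) + ?b * (?sl * B$r$l) + (- ?t) * (- B$r$m) = 0" for r
      using eq[of r] by simp
    have "?a = 0"
    proof (rule realizableD(1)[OF real(2), of j l m ?a ?b "- ?t"])
      show "?a * (sgn ((q - (p + axis m 1)) $ j) * B$r$j) + ?b * (sgn ((q - (p + axis m 1)) $ l) * B$r$l) +
          - ?t * (sgn ((q - (p + axis m 1)) $ m) * B$r$m) = 0" for r
        using eq'[of r] nz assms(3) by (simp add: axis_component)
    qed (use nz assms(3) pos False in \<open>auto simp: axis_component\<close>)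
    then show False using pos(1) by (metis less_irrefl)
  qed
qed

lemma edge_chain_sgn:
  assumes "edge m p" "edge m q" "p$m = q$m" "s \<in> {1, - 1}"
    and "0 < s * col_det B m j * (q$j - p$j)"
  shows "0 \<le> s * col_det B m k * (q$k - p$k)"
proof -
  have sign: "0 \<le> s * y" if "(0 \<le> x \<and> 0 \<le> y) \<or> (x \<le> 0 \<and> y \<le> 0)" "0 < s * x" for x y :: int
    using that assms(4) by auto
  let ?D = "\<lambda>j. col_det B m j * (q$j - p$j)"
  have "(0 \<le> ?D j \<and> 0 \<le> ?D k) \<or> (?D j \<le> 0 \<and> ?D k \<le> 0)"
    using edge_chain[OF assms(1-3)] by blast
  moreover have "0 < s * ?D j"
    using assms(5) by (simp only: mult.assoc)
  ultimately have "0 \<le> s * ?D k"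
    by (rule sign)
  then show ?thesis
    by (simp only: mult.assoc)
qed

lemma square_edges:
  assumes "unit_square p i j \<subseteq> S"
  shows "edge i p" "edge i (p + axis j 1)" "edge j p" "edge j (p + axis i 1)"
  using assms by (auto simp: edge_def unit_square_def algebra_simps)

lemma square_det_nonzero:
  assumes "i \<noteq> j" "unit_square p i j \<subseteq> S"
  shows "col_det B i j \<noteq> 0"
  using edge_parallel[OF square_edges(1,2)[OF assms(2)], of j] assms(1)
  by (auto simp: axis_component)

text \<open>
  Each of the two squares has its far edge beyond the near edge of the other along the grid line
  of index \<open>i\<close>; both inequalities together force equality.
\<close>

lemma square_unique:
  assumes "i \<noteq> j" "unit_square p i j \<subseteq> S" "unit_square q i j \<subseteq> S" "p$i = q$i" "p$j = q$j"
  shows "p = q"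
proof -
  note ep = square_edges[OF assms(2)] and eq = square_edges[OF assms(3)]
  have d: "col_det B i j \<noteq> 0" using square_det_nonzero assms by blast
  define s where "s = sgn (col_det B i j)"
  have s: "s \<in> {1, -1}" "0 < s * col_det B i j" "0 < s * s"
    using d by (auto simp: s_def sgn_if)
  have "p$k = q$k" for k
  proof (cases "k = j \<or> col_det B i k = 0")
    case True
    then show ?thesis using assms edge_parallel[OF ep(1) eq(1), of k] by auto
  next
    case False
    have "0 \<le> s * col_det B i k * ((q + axis j 1)$k - p$k)"
      by (rule edge_chain_sgn[OF ep(1) eq(2) _ s(1), of j])
         (use assms s in \<open>auto simp: axis_component\<close>)
    moreover have "0 \<le> s * col_det B i k * ((p + axis j 1)$k - q$k)"
      by (rule edge_chain_sgn[OF eq(1) ep(2) _ s(1), of j])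
         (use assms s in \<open>auto simp: axis_component\<close>)
    ultimately have "s * col_det B i k * (q$k - p$k) = 0"
      using False by (simp add: axis_component algebra_simps)
    then show ?thesis
      using False s by auto
  qed
  then show ?thesis by (simp add: vec_eq_iff)
qed

text \<open>
  Among the edges across the line beyond \<open>p\<close> take one nearest to \<open>p\<close>,
  and let \<open>j\<close> be a coordinate in which it differs from \<open>p\<close>. The
  crossing with the line of index \<open>j\<close> that is next to the level of \<open>p\<close>
  lies between the two, so it starts at \<open>p\<close>.
\<close>

lemma edge_successor:
  assumes "edge m p" "s \<in> {1, - 1}"
  shows "\<exists>j. col_det B m j \<noteq> 0 \<and> edge m (p + axis j (s * sgn (col_det B m j)))"
proof -
  \<comment> \<open>Edges across the same line, strictly beyond \<open>p\<close> in the direction \<open>s\<close>.\<close>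
  define A where "A = {q. edge m q \<and> q$m = p$m \<and> q \<noteq> p \<and> (\<forall>j. 0 \<le> s * col_det B m j * (q$j - p$j))}"
  define \<mu> where "\<mu> q = nat (\<Sum>j\<in>UNIV. \<bar>q$j - p$j\<bar>)" for q
  have cross: "\<exists>u. edge m u \<and> edge m (u + axis j \<tau>) \<and> u$m = k \<and> u$j = r"
    if d: "col_det B m j \<noteq> 0" and t: "\<tau> \<in> {1, - 1}" for j \<tau> k r
  proof (cases "\<tau> = 1")
    case True
    then show ?thesis
      using crossing[OF d] square_edges by blast
  next
    case False
    then have "\<tau> = -1" using t by auto
    obtain u where u: "u$m = k" "u$j = r - 1" "unit_square u m j \<subseteq> S"
      using crossing[OF d] by blast
    have "m \<noteq> j" using d by auto
    have ret: "u + axis j 1 + axis j \<tau> = u"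
      using \<open>\<tau> = -1\<close> by (simp add: vec_eq_iff axis_component)
    have "edge m (u + axis j 1 + axis j \<tau>)"
      unfolding ret by (rule square_edges(1)[OF u(3)])
    then show ?thesis
      using square_edges(2)[OF u(3)] u(1,2) \<open>m \<noteq> j\<close>
      by (intro exI[of _ "u + axis j 1"]) (simp add: axis_component)
  qed
  obtain j0 where j0: "col_det B m j0 \<noteq> 0" using ex_transversal by blast
  have sg: "s * sgn (col_det B m j) \<in> {1, -1}" "0 < s * col_det B m j * (s * sgn (col_det B m j))"
    if "col_det B m j \<noteq> 0" for j
    using that assms(2) by (auto simp: sgn_if)
  have "A \<noteq> {}"
  proof -
    obtain u where u: "edge m u" "u$m = p$m" "u$j0 = p$j0 + s * sgn (col_det B m j0)"
      using cross[OF j0 sg(1)[OF j0]] by metis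
    have pos: "0 < s * col_det B m j0 * (u$j0 - p$j0)"
      using sg(2)[OF j0] u by simp
    then have "u \<in> A"
      using edge_chain_sgn[OF assms(1) u(1) u(2)[symmetric] assms(2) pos] u by (auto simp: A_def)
    then show ?thesis by blast
  qed
  then obtain q where q: "q \<in> A" "\<And>q'. q' \<in> A \<Longrightarrow> \<mu> q \<le> \<mu> q'"
    using ex_has_least_nat[of "\<lambda>q. q \<in> A"] by (metis ex_in_conv)
  then have qe: "edge m q" "q$m = p$m" and qn: "q \<noteq> p" and qge: "\<And>j. 0 \<le> s * col_det B m j * (q$j - p$j)"
    by (auto simp: A_def)
  obtain j where j: "q$j \<noteq> p$j"
    using qn by (auto simp: vec_eq_iff)
  have dj: "col_det B m j \<noteq> 0"
    using edge_parallel[OF assms(1) qe(1)] qe j by auto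
  define \<tau> where "\<tau> = s * sgn (col_det B m j)"
  have \<tau>: "\<tau> \<in> {1, - 1}" using sg(1)[OF dj] by (simp add: \<tau>_def)
  have sgj: "0 < s * col_det B m j * \<tau>"
    using sg(2)[OF dj] by (simp add: \<tau>_def)
  have qj: "0 < s * col_det B m j * (q$j - p$j)"
    using qge[of j] j dj assms(2) by (metis eq_iff_diff_eq_0 insertE less_le mult_eq_0_iff singletonD zero_neq_neg_one zero_neq_one)
  obtain u where u: "edge m u" "edge m (u + axis j \<tau>)" "u$m = p$m" "u$j = p$j"
    using cross[OF dj \<tau>] by metis
  have mj: "m \<noteq> j" using dj by auto
  have "u = p"
  proof (rule ccontr)
    assume "u \<noteq> p"
    consider "\<forall>k. 0 \<le> s * col_det B m k * (u$k - p$k)" | "\<forall>k. s * col_det B m k * (u$k - p$k) \<le> 0"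
    proof -
      have "(\<forall>k. 0 \<le> s * f k) \<or> (\<forall>k. s * f k \<le> 0)" if "(\<forall>k. 0 \<le> f k) \<or> (\<forall>k. f k \<le> 0)" for f :: "'n \<Rightarrow> int"
        using that assms(2) by auto
      from this[OF edge_chain[OF assms(1) u(1) u(3)[symmetric]]] show thesis
        using that by (auto simp only: mult.assoc)
    qed
    then show False
    proof cases
      case 1
      then have uA: "u \<in> A" using u \<open>u \<noteq> p\<close> by (simp add: A_def)
      have uq: "0 \<le> s * col_det B m k * (q$k - u$k)" for k
        by (rule edge_chain_sgn[OF u(1) qe(1) _ assms(2), of j]) (use u qe qj in auto)
      have le: "\<bar>u$k - p$k\<bar> \<le> \<bar>q$k - p$k\<bar>" for k
      proof (cases "col_det B m k = 0")
        case True
        then show ?thesis using edge_parallel[OF assms(1) u(1)] u by simp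
      next
        case False
        have mono: "\<bar>x\<bar> \<le> \<bar>x + y\<bar>" if "c \<noteq> 0" "0 \<le> c * x" "0 \<le> c * y" for c x y :: int
          using that by (auto simp: zero_le_mult_iff)
        show ?thesis
          using mono[OF _ 1[rule_format, of k] uq[of k]] False assms(2) by auto
      qed
      have "(\<Sum>k\<in>UNIV. \<bar>u$k - p$k\<bar>) < (\<Sum>k\<in>UNIV. \<bar>q$k - p$k\<bar>)"
        by (rule sum_strict_mono_ex1) (use le u j in \<open>auto intro!: exI[of _ j]\<close>)
      moreover have "0 \<le> (\<Sum>k\<in>UNIV. \<bar>u$k - p$k\<bar>)"
        by (simp add: sum_nonneg)
      ultimately have "\<mu> u < \<mu> q"
        unfolding \<mu>_def by (simp only: nat_less_eq_zless)
      then show False using q(2)[OF uA] by simp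
    next
      case 2
      have "p$k = u$k" for k
      proof (cases "k = j \<or> col_det B m k = 0")
        case True
        then show ?thesis using edge_parallel[OF assms(1) u(1), of k] u by auto
      next
        case False
        have "0 \<le> s * col_det B m k * ((u + axis j \<tau>)$k - p$k)"
          by (rule edge_chain_sgn[OF assms(1) u(2) _ assms(2), of j])
             (use u sgj mj in \<open>auto simp: axis_component\<close>)
        then have "s * col_det B m k * (u$k - p$k) = 0"
          using 2[rule_format, of k] False by (simp add: axis_component)
        then show ?thesis using False assms(2) by auto
      qed
      then show False using \<open>u \<noteq> p\<close> by (simp add: vec_eq_iff)
    qed
  qed
  then show ?thesis
    using u dj by (auto simp: \<tau>_def)
qed

text \<open>
  Two different successors would differ from each other in opposite directions along the chain.
\<close>

lemma edge_successor_unique: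
  assumes "edge m (p + axis j (s * sgn (col_det B m j)))" "edge m (p + axis k (s * sgn (col_det B m k)))"
    and "s \<in> {1, - 1}" "col_det B m j \<noteq> 0" "col_det B m k \<noteq> 0"
  shows "j = k"
proof (rule ccontr)
  assume ne: "j \<noteq> k"
  have m: "m \<noteq> j" "m \<noteq> k" using assms by auto
  let ?q = "p + axis k (s * sgn (col_det B m k))"
  let ?p = "p + axis j (s * sgn (col_det B m j))"
  have "0 \<le> s * col_det B m j * (?q$j - ?p$j)"
  proof (rule edge_chain_sgn[OF assms(1,2) _ assms(3), of k])
    have "s * col_det B m k * (s * sgn (col_det B m k)) = \<bar>col_det B m k\<bar>"
      using assms(3) by (auto simp: sgn_if)
    then show "0 < s * col_det B m k * (?q$k - ?p$k)"
      using ne assms(5) by (simp add: axis_component)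
  qed (use m in \<open>simp add: axis_component\<close>)
  then have "s * col_det B m j * (s * sgn (col_det B m j)) \<le> 0"
    using ne by (simp add: axis_component)
  moreover have "s * col_det B m j * (s * sgn (col_det B m j)) = \<bar>col_det B m j\<bar>"
    using assms(3) by (auto simp: sgn_if)
  ultimately show False using assms(4) by linarith
qed

lemma square_on_side:
  assumes "p \<in> S" "p + axis i \<tau> \<in> S" "\<tau> \<in> {1, - 1}" "s \<in> {1, - 1}"
  shows "\<exists>x. col_det B i x \<noteq> 0 \<and> p + axis x (s * sgn (col_det B i x)) \<in> S \<and>
    p + axis i \<tau> + axis x (s * sgn (col_det B i x)) \<in> S"
proof -
  define b where "b = p + axis i (min 0 \<tau>)"
  have b_cases: "(b = p \<and> b + axis i 1 = p + axis i \<tau>) \<or> (b = p + axis i \<tau> \<and> b + axis i 1 = p)"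
    using assms(3) by (auto simp: b_def vec_eq_iff axis_component)
  then have "edge i b"
    using assms(1,2) unfolding edge_def by metis
  then obtain x where x: "col_det B i x \<noteq> 0" "edge i (b + axis x (s * sgn (col_det B i x)))"
    using edge_successor assms(4) by blast
  have "b + axis x (s * sgn (col_det B i x)) \<in> S" "b + axis i 1 + axis x (s * sgn (col_det B i x)) \<in> S"
    using x(2) by (simp_all add: edge_def ac_simps)
  then show ?thesis
    using x(1) b_cases by metis
qed

end

section \<open>Elementary transformations\<close>

text \<open>
  An elementary transformation happens inside a unit cube; its corners are indexed by sets of
  directions, with signs \<open>\<epsilon>\<close>.
\<close>

definition cube_corner :: "int ^ 'n \<Rightarrow> ('n \<Rightarrow> int) \<Rightarrow> 'n set \<Rightarrow> int ^ 'n" where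
  "cube_corner p \<epsilon> X = (\<chi> i. p$i + (if i \<in> X then \<epsilon> i else 0))"

lemma cube_corner_component [simp]: "cube_corner p \<epsilon> X $ i = p$i + (if i \<in> X then \<epsilon> i else 0)"
  by (simp add: cube_corner_def)

lemma cube_corner_empty [simp]: "cube_corner p \<epsilon> {} = p"
  by (simp add: vec_eq_iff)

lemma unit_square_translate: "(\<lambda>v. l + v) ` unit_square p i j = unit_square (l + p) i j"
  by (auto simp: unit_square_def algebra_simps)

lemma unit_square_cube_corner:
  assumes "\<epsilon> i \<in> {1, -1}" "\<epsilon> j \<in> {1, -1}" "i \<noteq> j" "i \<notin> X" "j \<notin> X"
  shows "unit_square (cube_corner p \<epsilon> X + axis i (min 0 (\<epsilon> i)) + axis j (min 0 (\<epsilon> j))) i j =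
    {cube_corner p \<epsilon> X, cube_corner p \<epsilon> (insert i X), cube_corner p \<epsilon> (insert j X),
     cube_corner p \<epsilon> (insert i (insert j X))}"
proof -
  define a b c d where "a = cube_corner p \<epsilon> X" and "b = cube_corner p \<epsilon> (insert i X)"
    and "c = cube_corner p \<epsilon> (insert j X)" and "d = cube_corner p \<epsilon> (insert i (insert j X))"
  have ax: "b = a + axis i (\<epsilon> i)" "c = a + axis j (\<epsilon> j)" "d = a + axis i (\<epsilon> i) + axis j (\<epsilon> j)"
    using assms by (auto simp: a_def b_def c_def d_def vec_eq_iff axis_component)
  have neg: "axis k (- 1 :: int) = - axis k 1" "axis k (0 :: int) = 0" for k :: "'a :: finite"
    by (simp_all add: vec_eq_iff axis_component)
  consider "\<epsilon> i = 1" "\<epsilon> j = 1" | "\<epsilon> i = 1" "\<epsilon> j = -1" | "\<epsilon> i = -1" "\<epsilon> j = 1" | "\<epsilon> i = -1" "\<epsilon> j = -1"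
    using assms by auto
  then have "unit_square (a + axis i (min 0 (\<epsilon> i)) + axis j (min 0 (\<epsilon> j))) i j = {a, b, c, d}"
    by cases (auto simp: unit_square_def ax neg algebra_simps)
  then show ?thesis
    by (simp only: a_def b_def c_def d_def)
qed

lemma unit_square_corner:
  assumes "v \<in> unit_square p i j" "i \<noteq> j"
  obtains \<sigma> \<tau> where "\<sigma> \<in> {1, -1}" "\<tau> \<in> {1, -1}"
    "unit_square p i j = {v, v + axis i \<sigma>, v + axis j \<tau>, v + axis i \<sigma> + axis j \<tau>}"
proof -
  have neg: "axis k (- 1 :: int) = - axis k 1" "axis k (0 :: int) = 0" for k :: "'a :: finite"
    by (simp_all add: vec_eq_iff axis_component)
  consider "v = p" | "v = p + axis i 1" | "v = p + axis j 1" | "v = p + axis i 1 + axis j 1"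
    using assms by (auto simp: unit_square_def)
  then show thesis
  proof cases
    case 1 then show thesis by (intro that[of 1 1]) (auto simp: unit_square_def)
  next
    case 2 then show thesis by (intro that[of "-1" 1]) (auto simp: unit_square_def neg algebra_simps)
  next
    case 3 then show thesis by (intro that[of 1 "-1"]) (auto simp: unit_square_def neg algebra_simps)
  next
    case 4 then show thesis by (intro that[of "-1" "-1"]) (auto simp: unit_square_def neg algebra_simps)
  qed
qed

lemma unit_square_ge: "v \<in> unit_square p i j \<Longrightarrow> p$m \<le> v$m"
  by (auto simp: unit_square_def axis_component)

lemma unit_square_base:
  assumes "unit_square p i j = unit_square q i j"
  shows "p = q"
  using unit_square_ge[of p q i j] unit_square_ge[of q p i j] unit_square_mem(1)[of p i j]
    unit_square_mem(1)[of q i j] assms by (auto simp: vec_eq_iff intro: antisym)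

text \<open>
  The vertex to be moved is \<open>p0\<close>. Seven corners of a unit cube belong to the
  surface, and \<open>p0\<close> has no other neighbours than the three in the cube: in an
  arrangement, \<open>p0\<close> is a triangle.
\<close>

locale hexagon_flip = grid_surface L B S for L :: "(int ^ 'n) set" and B S +
  fixes p0 :: "int ^ 'n" and D :: "'n set" and \<epsilon> :: "'n \<Rightarrow> int"
  assumes card_D: "card D = 3"
    and sign: "\<epsilon> i \<in> {1, -1}"
    and hexagon: "X \<subset> D \<Longrightarrow> cube_corner p0 \<epsilon> X \<in> S"
    and neighbours: "\<tau> \<in> {1, -1} \<Longrightarrow> p0 + axis m \<tau> \<in> S \<Longrightarrow> m \<in> D \<and> \<tau> = \<epsilon> m"
begin

text \<open>
  The determinant of the outward normals \<open>\<epsilon> i * b i\<close> and \<open>\<epsilon>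
  j * b j\<close> of the triangle.
\<close>

definition wdet :: "'n \<Rightarrow> 'n \<Rightarrow> int" where
  "wdet i j = \<epsilon> i * \<epsilon> j * col_det B i j"

abbreviation corner :: "'n set \<Rightarrow> int ^ 'n" where
  "corner \<equiv> cube_corner p0 \<epsilon>"

lemma sign_cases: "\<epsilon> i = 1 \<or> \<epsilon> i = -1"
  using sign[of i] by simp

lemma sign_square: "\<epsilon> i * \<epsilon> i = 1"
  using sign_cases[of i] by auto

lemma p0_mem: "p0 \<in> S"
proof -
  have "{} \<subset> D" using card_D by auto
  then show ?thesis using hexagon[of "{}"] by simp
qed

lemma neighbour_mem: "i \<in> D \<Longrightarrow> p0 + axis i (\<epsilon> i) \<in> S"
proof -
  assume "i \<in> D"
  moreover have "card {i} \<noteq> card D" using card_D by simp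
  ultimately have "{i} \<subset> D" by auto
  then have "corner {i} \<in> S" by (rule hexagon)
  moreover have "corner {i} = p0 + axis i (\<epsilon> i)"
    by (simp add: vec_eq_iff axis_component)
  ultimately show ?thesis by simp
qed

text \<open>
  The edge from \<open>p0\<close> in direction \<open>i\<close> has a square on each side, and
  only the directions \<open>j\<close> and \<open>k\<close> are available for them.
\<close>

lemma wdet_opposite:
  assumes "D = {i, j, k}" "i \<noteq> j" "i \<noteq> k" "j \<noteq> k"
  shows "wdet i j * wdet i k < 0"
proof -
  have succ: "\<exists>x\<in>{j, k}. col_det B i x \<noteq> 0 \<and> s * sgn (col_det B i x) = \<epsilon> x" if s: "s \<in> {1, -1}" for s
  proof -
    have "i \<in> D" using assms by simp
    then obtain x where x: "col_det B i x \<noteq> 0" "p0 + axis x (s * sgn (col_det B i x)) \<in> S"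
      using square_on_side[OF p0_mem neighbour_mem sign s] by blast
    have t: "s * sgn (col_det B i x) \<in> {1, -1}" using s x by (auto simp: sgn_if)
    from neighbours[OF t x(2)] x assms show ?thesis by auto
  qed
  obtain x where x: "x \<in> {j, k}" "col_det B i x \<noteq> 0" "sgn (col_det B i x) = \<epsilon> x"
    using succ[of 1] by auto
  obtain y where y: "y \<in> {j, k}" "col_det B i y \<noteq> 0" "- sgn (col_det B i y) = \<epsilon> y"
    using succ[of "-1"] by auto
  have sx: "sgn (wdet i x) = \<epsilon> i" and sy: "sgn (wdet i y) = - \<epsilon> i"
    using x(3) y(3) sign_cases[of i] sign_cases[of x] sign_cases[of y] by (auto simp: wdet_def sgn_mult)
  then have "x \<noteq> y" using sign_cases[of i] by auto
  then have "sgn (wdet i j * wdet i k) = - (\<epsilon> i * \<epsilon> i)"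
    using sx sy x(1) y(1) by (auto simp: sgn_mult)
  then have "sgn (wdet i j * wdet i k) = -1"
    by (simp add: sign_square)
  then show ?thesis
    by (metis sgn_less zero_less_one neg_less_0_iff_less)
qed

lemma wdet_swap: "wdet j i = - wdet i j"
  by (simp add: wdet_def col_det_swap[of B j i])

lemma orientation:
  obtains i j k where "D = {i, j, k}" "i \<noteq> j" "i \<noteq> k" "j \<noteq> k"
    "0 < wdet i j" "0 < wdet j k" "0 < wdet k i"
proof -
  obtain i j k where D: "D = {i, j, k}" and ne: "i \<noteq> j" "j \<noteq> k" "i \<noteq> k"
    using card_D by (auto simp: card_3_iff)
  have neg: "wdet i j * wdet i k < 0" "wdet j i * wdet j k < 0" "wdet k i * wdet k j < 0"
    using wdet_opposite[of i j k] wdet_opposite[of j i k] wdet_opposite[of k i j] D ne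
    by (auto simp: insert_commute)
  show thesis
  proof (cases "0 < wdet i j")
    case True
    then show thesis
      using that[of i j k] D ne neg wdet_swap[of i j] wdet_swap[of i k] wdet_swap[of j k]
      by (auto simp: mult_less_0_iff)
  next
    case False
    then show thesis
      using that[of i k j] D ne neg wdet_swap[of i j] wdet_swap[of i k] wdet_swap[of j k]
      by (auto simp: mult_less_0_iff insert_commute)
  qed
qed

text \<open>
  With the labels of \<open>orientation\<close> the coefficients are positive, so the three
  outward normals positively span the plane.
\<close>

lemma cramer: "wdet j k * (\<epsilon> i * B$r$i) + wdet k i * (\<epsilon> j * B$r$j) + wdet i j * (\<epsilon> k * B$r$k) = 0"
  using exhaust_2[of r] by (auto simp: wdet_def col_det_eq algebra_simps)

lemma opposite_notin: "corner D \<notin> S"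
proof
  assume "corner D \<in> S"
  then have real: "realizable B (corner D - p0)"
    by (rule realizable[OF p0_mem])
  obtain i j k where D: "D = {i, j, k}" "i \<noteq> j" "i \<noteq> k" "j \<noteq> k"
    and pos: "0 < wdet i j" "0 < wdet j k" "0 < wdet k i"
    by (rule orientation)
  have sgn_eps: "sgn (\<epsilon> x) = \<epsilon> x" "\<epsilon> x \<noteq> 0" for x
    using sign_cases[of x] by auto
  have "wdet j k = 0"
  proof (rule realizableD(1)[OF real, of i j k "wdet j k" "wdet k i" "wdet i j"])
    show "wdet j k * (sgn ((corner D - p0)$i) * B$r$i) + wdet k i * (sgn ((corner D - p0)$j) * B$r$j) +
        wdet i j * (sgn ((corner D - p0)$k) * B$r$k) = 0" for r
      using cramer[of j k i r] D by (simp add: sgn_eps)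
  qed (use D pos sgn_eps in auto)
  then show False using pos by simp
qed

text \<open>
  If some line of index \<open>m\<close> separated \<open>q\<close> from \<open>p0\<close>, its
  normal, directed towards \<open>q\<close>, would lie in the cone of two of the outward
  normals. The step to \<open>q\<close> from the chamber \<open>corner {x, y}\<close>, opposite
  to \<open>p0\<close> at the crossing of these two lines, crosses both lines against their
  normals and the line of index \<open>m\<close> along its normal, which is impossible.
\<close>

lemma triangle_unique:
  assumes q: "q \<in> S" and qD: "\<And>x. x \<in> D \<Longrightarrow> q$x = p0$x"
  shows "q = p0"
proof (rule ccontr)
  assume "q \<noteq> p0"
  then obtain m where m: "q$m \<noteq> p0$m"
    by (auto simp: vec_eq_iff)
  define \<delta> where "\<delta> = sgn (q$m - p0$m)"
  define f where "f x = \<epsilon> x * \<delta> * col_det B x m" for x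
  obtain i j k where D: "D = {i, j, k}" "i \<noteq> j" "i \<noteq> k" "j \<noteq> k"
    and pos: "0 < wdet i j" "0 < wdet j k" "0 < wdet k i"
    by (rule orientation)
  have sector: False if xy: "x \<in> D" "y \<in> D" "x \<noteq> y" "0 < wdet x y" and f: "0 \<le> f x" "f y \<le> 0" for x y
  proof -
    have "card {x, y} \<noteq> card D" using card_D xy by simp
    then have "{x, y} \<subset> D" using xy by auto
    then have real: "realizable B (q - corner {x, y})"
      using q by (intro realizable hexagon)
    have mD: "m \<notin> D" using m qD by blast
    have sgns: "sgn ((q - corner {x, y})$x) = - \<epsilon> x" "sgn ((q - corner {x, y})$y) = - \<epsilon> y"
      "sgn ((q - corner {x, y})$m) = \<delta>"
      using qD[OF xy(1)] qD[OF xy(2)] sign_cases[of x] sign_cases[of y] mD xy by (auto simp: \<delta>_def)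
    have "wdet x y = 0"
    proof (rule realizableD(3)[OF real, of x y m "- f y" "f x" "wdet x y"])
      show "(- f y) * (sgn ((q - corner {x, y})$x) * B$r$x) + f x * (sgn ((q - corner {x, y})$y) * B$r$y) +
          wdet x y * (sgn ((q - corner {x, y})$m) * B$r$m) = 0" for r
        unfolding sgns using exhaust_2[of r] by (auto simp: f_def wdet_def col_det_eq algebra_simps)
    qed (use sgns sign_cases[of x] sign_cases[of y] m xy f mD in \<open>auto simp: \<delta>_def\<close>)
    then show False using xy by simp
  qed
  have sum0: "wdet j k * f i + wdet k i * f j + wdet i j * f k = 0"
    by (simp add: f_def wdet_def col_det_eq algebra_simps)
  have next_pos: "0 \<le> f i \<Longrightarrow> 0 < f j" "0 \<le> f j \<Longrightarrow> 0 < f k" "0 \<le> f k \<Longrightarrow> 0 < f i"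
    using sector[of i j] sector[of j k] sector[of k i] D pos by force+
  show False
  proof (cases "0 \<le> f i")
    case True
    then have "0 < f i" "0 < f j" "0 < f k" using next_pos by auto
    then have "0 < wdet j k * f i" "0 < wdet k i * f j" "0 < wdet i j * f k"
      using pos by auto
    then show False using sum0 by linarith
  next
    case False
    then have "f i < 0" "f j < 0" "f k < 0" using next_pos by (auto simp: not_le[symmetric])
    then have "wdet j k * f i < 0" "wdet k i * f j < 0" "wdet i j * f k < 0"
      using pos by (auto simp: mult_pos_neg)
    then show False using sum0 by linarith
  qed
qed

text \<open>
  A dependency that misses one of the three directions of the cube is already visible from a
  corner of the cube in \<open>S\<close>. Otherwise it involves exactly these directions, and
  since the only dependency of the normals is positive, \<open>q\<close> lies either on the
  outer side of all three lines as seen from \<open>corner D\<close>, hence also from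
  \<open>p0\<close>, or on the inner side of all three. In the latter case another corner of the
  cube sees it in the same way, unless \<open>q\<close> lies in the triangle.
\<close>

lemma realizable_opposite:
  assumes q: "q \<in> S" "q \<noteq> p0"
  shows "realizable B (q - corner D)"
  unfolding realizable_def
proof (intro allI impI)
  fix i j k a b c
  let ?d = "q - corner D"
  assume nz: "?d$i \<noteq> 0" "?d$j \<noteq> 0" "?d$k \<noteq> 0" and nn: "0 \<le> a" "0 \<le> b" "0 \<le> (c::int)"
    and eq: "\<forall>r. a * (sgn (?d$i) * B$r$i) + b * (sgn (?d$j) * B$r$j) + c * (sgn (?d$k) * B$r$k) = 0"
  have transfer: "a = 0 \<and> b = 0 \<and> c = 0"
    if X: "X \<subset> D" and same: "\<And>x. x \<in> {i, j, k} \<Longrightarrow> sgn ((q - corner X)$x) = sgn (?d$x)" for X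
  proof -
    have real: "realizable B (q - corner X)"
      using hexagon[OF X] q by (intro realizable)
    have s: "sgn ((q - corner X)$i) = sgn (?d$i)" "sgn ((q - corner X)$j) = sgn (?d$j)"
      "sgn ((q - corner X)$k) = sgn (?d$k)"
      by (rule same, blast)+
    have nz': "(q - corner X)$i \<noteq> 0" "(q - corner X)$j \<noteq> 0" "(q - corner X)$k \<noteq> 0"
      using s nz by (metis sgn_0_0)+
    show ?thesis
      using realizableD[OF real nz' nn, unfolded s] eq by blast
  qed
  have sgn_eps: "sgn (\<epsilon> x) = \<epsilon> x" "\<epsilon> x \<noteq> 0" for x
    using sign_cases[of x] by auto
  show "a = 0 \<and> b = 0 \<and> c = 0"
  proof (cases "D \<subseteq> {i, j, k}")
    case False
    then obtain x where x: "x \<in> D" "x \<notin> {i, j, k}" by blast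
    show ?thesis
      by (rule transfer[of "D - {x}"]) (use x in auto)
  next
    case True
    have "card {i, j, k} \<le> 3"
      by (simp add: card_insert_if)
    then have D: "D = {i, j, k}"
      using card_seteq[OF _ True] card_D by simp
    then have ne: "i \<noteq> j" "i \<noteq> k" "j \<noteq> k"
      using card_D by (auto simp: card_insert_if split: if_splits)
    \<comment> \<open>\<open>\<eta> x\<close> is \<open>1\<close> or \<open>-1\<close> as \<open>q\<close> lies further out or further in than \<open>corner D\<close> in direction \<open>x\<close>.\<close>
    define \<eta> where "\<eta> x = \<epsilon> x * sgn (?d$x)" for x
    have \<eta>: "sgn (?d$x) = \<eta> x * \<epsilon> x" for x
      using sign_square[of x] by (simp add: \<eta>_def)
    have \<eta>1: "\<eta> x = 1 \<or> \<eta> x = -1" if "x \<in> {i, j, k}" for x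
    proof -
      have "?d$x \<noteq> 0" using that nz by blast
      then have "sgn (?d$x) = 1 \<or> sgn (?d$x) = -1" by (metis sgn_if)
      then show ?thesis
        unfolding \<eta>_def using sign_cases[of x] by (metis mult_1 mult_minus1 minus_minus)
    qed
    have pair: "a * \<eta> i * wdet i k + b * \<eta> j * wdet j k = 0" "a * \<eta> i * wdet i j + c * \<eta> k * wdet k j = 0"
    proof -
      have e: "a * (\<eta> i * \<epsilon> i * B$r$i) + b * (\<eta> j * \<epsilon> j * B$r$j) + c * (\<eta> k * \<epsilon> k * B$r$k) = 0" for r
        using eq unfolding \<eta> by blast
      show "a * \<eta> i * wdet i k + b * \<eta> j * wdet j k = 0"
        using e[of 1] e[of 2] unfolding wdet_def col_det_eq by algebra
      show "a * \<eta> i * wdet i j + c * \<eta> k * wdet k j = 0"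
        using e[of 1] e[of 2] unfolding wdet_def col_det_eq by algebra
    qed
    have signs: "wdet i j * wdet i k < 0" "wdet j i * wdet j k < 0" "wdet k i * wdet k j < 0"
      using wdet_opposite[of i j k] wdet_opposite[of j i k] wdet_opposite[of k i j] D ne
      by (auto simp: insert_commute)
    show ?thesis
    proof (cases "\<eta> i = \<eta> j \<and> \<eta> i = \<eta> k")
      case False
      have zero: "x = 0 \<and> y = 0" if e: "x * h * u + y * h' * v = 0" and h: "h = 1 \<or> h = -1" "h' = - h"
        and uv: "u * v < 0" and "0 \<le> x" "0 \<le> y" for x y h h' u v :: int
      proof -
        have "x * u = y * v" using e h by auto
        then have eq: "x * (u * u) = y * (u * v)" by algebra
        moreover have "0 \<le> x * (u * u)" using that by simp
        moreover have "y * (u * v) \<le> 0" using that by (simp add: mult_nonneg_nonpos)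
        ultimately have "x * (u * u) = 0" "y * (u * v) = 0" by linarith+
        then show ?thesis using uv by auto
      qed
      have uv: "wdet i k * wdet j k < 0" "wdet i j * wdet k j < 0"
        using signs wdet_swap[of i k] wdet_swap[of j k] wdet_swap[of i j] by auto
      show ?thesis
      proof (cases "\<eta> i = \<eta> j")
        case True
        then have "\<eta> k = - \<eta> i" using False \<eta>1[of i] \<eta>1[of k] by auto
        then have "a = 0 \<and> c = 0"
          by (intro zero[OF pair(2) _ _ uv(2) nn(1,3)]) (use \<eta>1[of i] in auto)
        then show ?thesis using pair(1) uv \<eta>1[of j] by auto
      next
        case False
        then have "\<eta> j = - \<eta> i" using \<eta>1[of i] \<eta>1[of j] by auto
        then have "a = 0 \<and> b = 0"
          by (intro zero[OF pair(1) _ _ uv(1) nn(1,2)]) (use \<eta>1[of i] in auto)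
        then show ?thesis using pair(2) uv \<eta>1[of k] by auto
      qed
    next
      case True
      then have same: "sgn (?d$x) = \<eta> i * \<epsilon> x" if "x \<in> D" for x
      proof -
        have "\<eta> x = \<eta> i" using that True unfolding D by auto
        then show ?thesis using \<eta>[of x] by (simp only:)
      qed
      have d: "?d$x = q$x - p0$x - \<epsilon> x" if "x \<in> D" for x
        using that by simp
      show ?thesis
      proof (cases "\<eta> i = 1")
        case True
        show ?thesis
        proof (rule transfer[of "{}"])
          fix x assume "x \<in> {i, j, k}"
          then have "x \<in> D" using D by simp
          then show "sgn ((q - corner {})$x) = sgn (?d$x)"
            using same[of x] d[of x] True sign_cases[of x] by (auto simp: sgn_if split: if_splits)
        qed (use card_D in auto)
      next
        case False
        then have "\<eta> i = -1" using \<eta>1[of i] by simp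
        then have neg: "sgn (?d$x) = - \<epsilon> x" if "x \<in> D" for x
          using same[OF that] by simp
        define A where "A = {x \<in> D. q$x = p0$x}"
        show ?thesis
        proof (cases "A = D")
          case False
          show ?thesis
          proof (rule transfer[of A])
            show "A \<subset> D" using False by (auto simp: A_def)
            fix x assume "x \<in> {i, j, k}"
            then have "x \<in> D" using D by simp
            then show "sgn ((q - corner A)$x) = sgn (?d$x)"
              using neg[of x] d[of x] sign_cases[of x] by (auto simp: A_def sgn_if split: if_splits)
          qed
        next
          case True
          then have qD: "q$x = p0$x" if "x \<in> D" for x
            using that by (auto simp: A_def)
          have False
            using triangle_unique[OF q(1) qD] q(2) by blast
          then show ?thesis ..
        qed
      qed
    qed
  qed
qed

lemma opposite_translate: "corner X = p0 + l \<Longrightarrow> X \<subseteq> D \<Longrightarrow> corner D = l + corner (D - X)"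
proof -
  assume *: "corner X = p0 + l" "X \<subseteq> D"
  have "l = corner X - p0" using * by simp
  then show ?thesis using *(2) by (auto simp: vec_eq_iff)
qed

definition flipped :: "(int ^ 'n) set" where
  "flipped = (S - (\<lambda>l. p0 + l) ` L) \<union> (\<lambda>l. corner D + l) ` L"

lemma corner_flipped:
  assumes "X \<subseteq> D" "X \<noteq> {}"
  shows "corner X \<in> flipped"
proof (cases "X = D")
  case True
  then show ?thesis
    using L_zero by (force simp: flipped_def)
next
  case False
  then have "corner X \<in> S" using hexagon assms by blast
  moreover have "corner X \<noteq> p0 + l" if "l \<in> L" for l
  proof
    assume "corner X = p0 + l"
    then have "corner D = l + corner (D - X)"
      using opposite_translate assms by blast
    moreover have "corner (D - X) \<in> S"
      using assms by (intro hexagon) auto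
    ultimately show False
      using opposite_notin translate[OF that] by metis
  qed
  ultimately show ?thesis by (auto simp: flipped_def)
qed

lemma flipped_translate:
  assumes "l \<in> L" "v \<in> flipped"
  shows "l + v \<in> flipped"
proof -
  consider "v \<in> S" "v \<notin> (\<lambda>l. p0 + l) ` L" | l' where "l' \<in> L" "v = corner D + l'"
    using assms by (auto simp: flipped_def)
  then show ?thesis
  proof cases
    case 1
    have "l + v \<notin> (\<lambda>l. p0 + l) ` L"
    proof
      assume "l + v \<in> (\<lambda>l. p0 + l) ` L"
      then obtain l' where "l' \<in> L" "l + v = p0 + l'" by blast
      then have "v = p0 + (l' - l)" "l' - l \<in> L"
        using L_diff assms(1) by (auto simp: algebra_simps)
      then show False using 1 by blast
    qed
    then show ?thesis using 1 translate[OF assms(1)] by (simp add: flipped_def)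
  next
    case 2
    then have "l + v = corner D + (l + l')" "l + l' \<in> L"
      using L_add assms(1) by (auto simp: algebra_simps)
    then show ?thesis by (auto simp: flipped_def)
  qed
qed

lemma new_square:
  assumes "D = {i, j, k}" "i \<noteq> j" "i \<noteq> k" "j \<noteq> k"
  defines "p \<equiv> corner {k} + axis i (min 0 (\<epsilon> i)) + axis j (min 0 (\<epsilon> j))"
  shows "unit_square p i j = {corner {k}, corner {i, k}, corner {j, k}, corner D}"
    and "unit_square p i j \<subseteq> flipped"
proof -
  show eq: "unit_square p i j = {corner {k}, corner {i, k}, corner {j, k}, corner D}"
    unfolding p_def assms(1)
    by (subst unit_square_cube_corner) (use assms sign in auto)
  show "unit_square p i j \<subseteq> flipped"
    unfolding eq using corner_flipped assms(1) by auto
qed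

lemma old_square:
  assumes "i \<noteq> j" "unit_square p i j \<subseteq> S" "\<not> unit_square p i j \<subseteq> flipped"
  obtains l k where "l \<in> L" "D = {i, j, k}" "i \<noteq> k" "j \<noteq> k"
    "p = l + (p0 + axis i (min 0 (\<epsilon> i)) + axis j (min 0 (\<epsilon> j)))"
    "unit_square p i j = (\<lambda>v. l + v) ` {p0, corner {i}, corner {j}, corner {i, j}}"
proof -
  obtain v l where v: "v \<in> unit_square p i j" "l \<in> L" "v = p0 + l"
    using assms by (auto simp: flipped_def)
  have shift: "unit_square (- l + p) i j = (\<lambda>v. - l + v) ` unit_square p i j"
    by (rule unit_square_translate[symmetric])
  have "p0 \<in> unit_square (- l + p) i j"
    unfolding shift using v by force
  then obtain \<sigma> \<tau> where st: "\<sigma> \<in> {1, -1}" "\<tau> \<in> {1, -1}"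
    and sq: "unit_square (- l + p) i j = {p0, p0 + axis i \<sigma>, p0 + axis j \<tau>, p0 + axis i \<sigma> + axis j \<tau>}"
    using unit_square_corner assms(1) by blast
  have "unit_square (- l + p) i j \<subseteq> S"
    unfolding shift using assms(2) translate[OF L_minus[OF v(2)]] by blast
  then have "p0 + axis i \<sigma> \<in> S" "p0 + axis j \<tau> \<in> S"
    using sq by auto
  then have ij: "i \<in> D" "\<sigma> = \<epsilon> i" "j \<in> D" "\<tau> = \<epsilon> j"
    using neighbours st by blast+
  have "card (D - {i, j}) = 1"
    using ij assms(1) card_D by (simp add: card_Diff_subset)
  then obtain k where k: "D - {i, j} = {k}"
    by (auto simp: card_1_singleton_iff)
  have sq2: "unit_square (p0 + axis i (min 0 (\<epsilon> i)) + axis j (min 0 (\<epsilon> j))) i j =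
      {p0, corner {i}, corner {j}, corner {i, j}}"
    using unit_square_cube_corner[of \<epsilon> i j "{}" p0] sign assms(1) by simp
  have "{p0, p0 + axis i \<sigma>, p0 + axis j \<tau>, p0 + axis i \<sigma> + axis j \<tau>} = {p0, corner {i}, corner {j}, corner {i, j}}"
  proof -
    have "corner {i} = p0 + axis i \<sigma>" "corner {j} = p0 + axis j \<tau>" "corner {i, j} = p0 + axis i \<sigma> + axis j \<tau>"
      using ij assms(1) by (auto simp: vec_eq_iff axis_component)
    then show ?thesis by simp
  qed
  then have eq: "unit_square (- l + p) i j = unit_square (p0 + axis i (min 0 (\<epsilon> i)) + axis j (min 0 (\<epsilon> j))) i j"
    using sq sq2 by simp
  then have "- l + p = p0 + axis i (min 0 (\<epsilon> i)) + axis j (min 0 (\<epsilon> j))"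
    by (rule unit_square_base)
  then have p: "p = l + (p0 + axis i (min 0 (\<epsilon> i)) + axis j (min 0 (\<epsilon> j)))"
    by (simp add: algebra_simps)
  show thesis
  proof (rule that[OF v(2) _ _ _ p])
    show "D = {i, j, k}" "i \<noteq> k" "j \<noteq> k" using k ij by auto
    show "unit_square p i j = (\<lambda>v. l + v) ` {p0, corner {i}, corner {j}, corner {i, j}}"
      unfolding p unit_square_translate[of l, symmetric] sq2 by simp
  qed
qed

lemma realizable_opposite_translate:
  assumes "q \<in> S" "q \<notin> (\<lambda>l. p0 + l) ` L" "l \<in> L"
  shows "realizable B (q - (corner D + l))"
proof -
  have "- l + q \<in> S"
    using assms translate L_minus by blast
  moreover have "- l + q \<noteq> p0"
    using assms by (auto simp: image_iff algebra_simps)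
  ultimately have "realizable B (- l + q - corner D)"
    by (rule realizable_opposite)
  moreover have "- l + q - corner D = q - (corner D + l)"
    by (simp add: vec_eq_iff)
  ultimately show ?thesis by (simp only:)
qed

text \<open>
  The three squares at \<open>p0\<close> are replaced by parallel ones
  (\<open>old_square\<close>, \<open>new_square\<close>), which are crossings of the same grid
  lines; the sign condition is \<open>realizable_opposite\<close>.
\<close>

lemma grid_surface_flipped: "grid_surface L B flipped"
proof
  show "l + v \<in> flipped" if "l \<in> L" "v \<in> flipped" for l v
    using that by (rule flipped_translate)
next
  fix p q assume p: "p \<in> flipped" and q: "q \<in> flipped"
  consider "p \<in> S" "p \<notin> (\<lambda>l. p0 + l) ` L" "q \<in> S"
    | l where "p \<in> S" "p \<notin> (\<lambda>l. p0 + l) ` L" "l \<in> L" "q = corner D + l"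
    | l where "q \<in> S" "q \<notin> (\<lambda>l. p0 + l) ` L" "l \<in> L" "p = corner D + l"
    | l l' where "l \<in> L" "p = corner D + l" "l' \<in> L" "q = corner D + l'"
    using p q by (auto simp: flipped_def)
  then show "realizable B (q - p)"
  proof cases
    case 1 then show ?thesis using realizable by blast
  next
    case 2
    then show ?thesis
      using realizable_minus[OF realizable_opposite_translate[of p l]] by (simp add: algebra_simps)
  next
    case 3
    then show ?thesis using realizable_opposite_translate by simp
  next
    case 4
    then show ?thesis using realizable_L[OF L_diff[of l' l]] by simp
  qed
next
  fix i j r m assume det: "col_det B i j \<noteq> 0"
  then obtain p where p: "p$i = r" "p$j = m" "unit_square p i j \<subseteq> S"
    using crossing by blast
  have ij: "i \<noteq> j" using det by auto
  show "\<exists>p. p$i = r \<and> p$j = m \<and> unit_square p i j \<subseteq> flipped"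
  proof (cases "unit_square p i j \<subseteq> flipped")
    case True
    then show ?thesis using p by blast
  next
    case False
    then obtain l k where l: "l \<in> L" and D: "D = {i, j, k}" "i \<noteq> k" "j \<noteq> k"
      and peq: "p = l + (p0 + axis i (min 0 (\<epsilon> i)) + axis j (min 0 (\<epsilon> j)))"
      using old_square[OF ij p(3)] by metis
    let ?p = "corner {k} + axis i (min 0 (\<epsilon> i)) + axis j (min 0 (\<epsilon> j))"
    have "unit_square ?p i j \<subseteq> flipped"
      using new_square(2)[OF D(1) ij D(2,3)] .
    then have "unit_square (l + ?p) i j \<subseteq> flipped"
      unfolding unit_square_translate[of l ?p, symmetric] using flipped_translate[OF l] by blast
    moreover have "(l + ?p)$i = r" "(l + ?p)$j = m"
      using p D peq by auto
    ultimately show ?thesis by blast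
  qed
next
  fix v assume v: "v \<in> flipped"
  show "\<exists>p i j. i \<noteq> j \<and> unit_square p i j \<subseteq> flipped \<and> v \<in> unit_square p i j"
  proof -
    have new: ?thesis if X: "X \<subseteq> D" "X \<noteq> {}" "l \<in> L" and vX: "v = l + corner X" for X l
    proof -
      obtain k where k: "k \<in> X" using X by blast
      then have kD: "k \<in> D" using X by blast
      then have "card (D - {k}) = 2" using card_D by simp
      then obtain i j where ij: "D - {k} = {i, j}" "i \<noteq> j"
        by (auto simp: card_2_iff)
      then have D: "D = {i, j, k}" "i \<noteq> k" "j \<noteq> k" using kD by auto
      let ?p = "corner {k} + axis i (min 0 (\<epsilon> i)) + axis j (min 0 (\<epsilon> j))"
      note sq = new_square[OF D(1) ij(2) D(2,3)]
      have "X \<in> {{k}, {i, k}, {j, k}, D}"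
        using X(1) k unfolding D(1) by blast
      then have "corner X \<in> unit_square ?p i j"
        unfolding sq(1) by auto
      then have "v \<in> unit_square (l + ?p) i j"
        unfolding unit_square_translate[of l ?p, symmetric] vX by blast
      moreover have "unit_square (l + ?p) i j \<subseteq> flipped"
        unfolding unit_square_translate[of l ?p, symmetric] using flipped_translate[OF X(3)] sq(2) by blast
      ultimately show ?thesis using ij by blast
    qed
    consider "v \<in> S" "v \<notin> (\<lambda>l. p0 + l) ` L" | l where "l \<in> L" "v = corner D + l"
      using v by (auto simp: flipped_def)
    then show ?thesis
    proof cases
      case 1
      then obtain p i j where p: "i \<noteq> j" "unit_square p i j \<subseteq> S" "v \<in> unit_square p i j"
        using vertex by blast
      show ?thesis
      proof (cases "unit_square p i j \<subseteq> flipped")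
        case True
        then show ?thesis using p by blast
      next
        case False
        then obtain l k where l: "l \<in> L" and D: "D = {i, j, k}" 
          and sq: "unit_square p i j = (\<lambda>v. l + v) ` {p0, corner {i}, corner {j}, corner {i, j}}"
          using old_square[OF p(1,2)] by metis
        have "v \<noteq> l + p0" using 1 l by (auto simp: image_iff algebra_simps)
        then obtain X where "X \<in> {{i}, {j}, {i, j}}" "v = l + corner X"
          using p(3) unfolding sq by blast
        then show ?thesis using new[of X l] D l by auto
      qed
    next
      case 2
      have "D \<noteq> {}" using card_D by auto
      then show ?thesis using new[of D l] 2 by (simp add: add.commute)
    qed
  qed
qed

end

lemma dist_real_vec_eq_1:
  assumes "dist (real_vec p) (real_vec q) = 1"
  obtains i \<tau> where "\<tau> \<in> {1, -1}" "q = p + axis i \<tau>"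
proof -
  have "(\<Sum>i\<in>UNIV. (real_of_int (p$i) - real_of_int (q$i))^2) = 1"
    using assms by (simp add: dist_vec_def L2_set_def real_vec_def dist_real_def)
  then have "real_of_int (\<Sum>i\<in>UNIV. (q$i - p$i)^2) = 1"
    by (simp add: power2_commute)
  then have sum1: "(\<Sum>i\<in>UNIV. (q$i - p$i)^2) = 1"
    by linarith
  then obtain i where i: "q$i - p$i \<noteq> 0"
    by (metis (no_types, lifting) sum.neutral zero_neq_one zero_power2)
  have split: "(q$i - p$i)^2 + (\<Sum>j\<in>UNIV - {i}. (q$j - p$j)^2) = 1"
    using sum1 by (simp add: sum.remove[of UNIV i])
  have ge: "1 \<le> (q$i - p$i)^2" using i by (simp add: int_one_le_iff_zero_less)
  have nn: "0 \<le> (\<Sum>j\<in>UNIV - {i}. (q$j - p$j)^2)" by (simp add: sum_nonneg)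
  have "(q$i - p$i)^2 = 1" "(\<Sum>j\<in>UNIV - {i}. (q$j - p$j)^2) = 0"
    using split ge nn by linarith+
  then have "q$i - p$i \<in> {1, -1}" "\<And>j. j \<noteq> i \<Longrightarrow> q$j - p$j = 0"
    by (auto simp: power2_eq_1_iff sum_nonneg_eq_0_iff)
  then show thesis
    by (intro that[of "q$i - p$i" i]) (auto simp: vec_eq_iff axis_component)
qed

lemma dist_real_vec_axis:
  assumes "\<tau> \<in> {1, -1}"
  shows "dist (real_vec p) (real_vec (p + axis i \<tau>)) = 1"
proof -
  have "(real_of_int (p$k) - real_of_int ((p + axis i \<tau>)$k))\<^sup>2 = (if k = i then 1 else 0)" for k
    using assms by (auto simp: axis_component)
  then show ?thesis
    by (simp add: dist_vec_def L2_set_def real_vec_def dist_real_def)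
qed

text \<open>
  Every edge at \<open>p0\<close> has squares on both sides, in two directions other than its
  own. With only three neighbours, these must therefore lie in three different directions.
\<close>

lemma (in grid_surface) grid_surface_elementary_transformation:
  assumes "elementary_transformation L S S'"
  shows "grid_surface L B S'"
proof -
  obtain p0 p1 p2 p3 where p0: "p0 \<in> S" and dist3: "distinct [p1, p2, p3]"
    and nb: "{q \<in> S. dist (real_vec p0) (real_vec q) = 1} = {p1, p2, p3}"
    and hex: "p1 + p2 - p0 \<in> S" "p1 + p3 - p0 \<in> S" "p2 + p3 - p0 \<in> S"
    and S': "S' = (S - (\<lambda>l. p0 + l) ` L) \<union> (\<lambda>l. p1 + p2 + p3 - 2 *s p0 + l) ` L"
    using assms unfolding elementary_transformation_def by blast
  have "p1 \<in> {q \<in> S. dist (real_vec p0) (real_vec q) = 1}" "p2 \<in> {q \<in> S. dist (real_vec p0) (real_vec q) = 1}"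
    "p3 \<in> {q \<in> S. dist (real_vec p0) (real_vec q) = 1}"
    unfolding nb by simp_all
  then have nbS: "p1 \<in> S" "p2 \<in> S" "p3 \<in> S"
    and d: "dist (real_vec p0) (real_vec p1) = 1" "dist (real_vec p0) (real_vec p2) = 1"
      "dist (real_vec p0) (real_vec p3) = 1"
    by simp_all
  obtain i1 t1 where 1: "t1 \<in> {1, -1}" "p1 = p0 + axis i1 t1"
    by (rule dist_real_vec_eq_1[OF d(1)])
  obtain i2 t2 where 2: "t2 \<in> {1, -1}" "p2 = p0 + axis i2 t2"
    by (rule dist_real_vec_eq_1[OF d(2)])
  obtain i3 t3 where 3: "t3 \<in> {1, -1}" "p3 = p0 + axis i3 t3"
    by (rule dist_real_vec_eq_1[OF d(3)])
  have near: "(m, \<tau>) \<in> {(i1, t1), (i2, t2), (i3, t3)}" if "\<tau> \<in> {1, -1}" "p0 + axis m \<tau> \<in> S" for m \<tau>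
  proof -
    have "p0 + axis m \<tau> \<in> {p1, p2, p3}"
      unfolding nb[symmetric] using dist_real_vec_axis[OF that(1), of p0 m] that(2) by simp
    then show ?thesis
      using that(1) by (auto simp: 1 2 3 axis_eq_axis)
  qed
  have turn: "\<exists>x y. x \<noteq> y \<and> fst x \<noteq> i \<and> fst y \<noteq> i \<and> {x, y} \<subseteq> {(i1, t1), (i2, t2), (i3, t3)}"
    if it: "\<tau> \<in> {1, -1}" "p0 + axis i \<tau> \<in> S" for i \<tau>
  proof -
    obtain x where x: "col_det B i x \<noteq> 0" "p0 + axis x (sgn (col_det B i x)) \<in> S"
      using square_on_side[OF p0 it(2,1), of 1] by auto
    obtain y where y: "col_det B i y \<noteq> 0" "p0 + axis y (- sgn (col_det B i y)) \<in> S"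
      using square_on_side[OF p0 it(2,1), of "-1"] by auto
    have "(x, sgn (col_det B i x)) \<in> {(i1, t1), (i2, t2), (i3, t3)}"
      by (rule near) (use x in \<open>auto simp: sgn_if\<close>)
    moreover have "(y, - sgn (col_det B i y)) \<in> {(i1, t1), (i2, t2), (i3, t3)}"
      by (rule near) (use y in \<open>auto simp: sgn_if\<close>)
    moreover have "(x, sgn (col_det B i x)) \<noteq> (y, - sgn (col_det B i y))"
      using x by (auto simp: sgn_if)
    moreover have "x \<noteq> i" "y \<noteq> i" using x y by auto
    ultimately show ?thesis
      by (intro exI[of _ "(x, sgn (col_det B i x))"] exI[of _ "(y, - sgn (col_det B i y))"]) simp
  qed
  have ne: "i1 \<noteq> i2" "i1 \<noteq> i3" "i2 \<noteq> i3"
    using turn[OF 1(1) nbS(1)[unfolded 1(2)]] turn[OF 2(1) nbS(2)[unfolded 2(2)]] by auto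
  define \<epsilon> where "\<epsilon> x = (if x = i1 then t1 else if x = i2 then t2 else if x = i3 then t3 else 1)" for x
  have \<epsilon>: "\<epsilon> i1 = t1" "\<epsilon> i2 = t2" "\<epsilon> i3 = t3"
    using ne by (auto simp: \<epsilon>_def)
  let ?D = "{i1, i2, i3}"
  have c: "cube_corner p0 \<epsilon> {i1} = p1" "cube_corner p0 \<epsilon> {i2} = p2" "cube_corner p0 \<epsilon> {i3} = p3"
    "cube_corner p0 \<epsilon> {i1, i2} = p1 + p2 - p0" "cube_corner p0 \<epsilon> {i1, i3} = p1 + p3 - p0"
    "cube_corner p0 \<epsilon> {i2, i3} = p2 + p3 - p0" "cube_corner p0 \<epsilon> ?D = p1 + p2 + p3 - 2 *s p0"
    using ne 1(2) 2(2) 3(2) \<epsilon> by (auto simp: vec_eq_iff axis_component)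
  interpret hexagon_flip L B S p0 ?D \<epsilon>
  proof
    show "card ?D = 3" using ne by simp
    show "\<epsilon> i \<in> {1, -1}" for i using 1 2 3 by (auto simp: \<epsilon>_def)
    show "cube_corner p0 \<epsilon> X \<in> S" if "X \<subset> ?D" for X
    proof -
      have "X \<in> {{}, {i1}, {i2}, {i3}, {i1, i2}, {i1, i3}, {i2, i3}}"
        using that by blast
      then show ?thesis using c nbS hex p0 by auto
    qed
    show "m \<in> ?D \<and> \<tau> = \<epsilon> m" if "\<tau> \<in> {1, -1}" "p0 + axis m \<tau> \<in> S" for m \<tau>
      using near[OF that] \<epsilon> by auto
  qed
  have "S' = flipped"
    unfolding flipped_def S' c(7) ..
  then show ?thesis using grid_surface_flipped by simp
qed

section \<open>Surfaces of line arrangements\<close>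

context plane_lattice
begin

definition plane_point :: "real ^ 'n \<Rightarrow> real \<Rightarrow> real \<Rightarrow> real ^ 'n" where
  "plane_point lam x y = (\<chi> i. lam$i + (real_of_int (B$1$i) * x + real_of_int (B$2$i) * y))"

lemma plane_point_component [simp]:
  "plane_point lam x y $ i = lam$i + (real_of_int (B$1$i) * x + real_of_int (B$2$i) * y)"
  by (simp add: plane_point_def)

lemma affine_plane_eq: "affine_plane L lam = range (\<lambda>(x, y). plane_point lam x y)"
proof -
  let ?R = "range (\<lambda>(x, y). plane_point 0 x y)"
  have memR: "v \<in> ?R \<longleftrightarrow> (\<exists>x y. v = plane_point 0 x y)" for v
    by auto
  have "span (real_vec ` L) = ?R"
  proof
    have "subspace ?R"
      unfolding subspace_def
    proof (intro conjI ballI allI)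
      show "0 \<in> ?R"
        unfolding memR by (intro exI[of _ 0]) (simp add: vec_eq_iff)
    next
      fix u v assume "u \<in> ?R" "v \<in> ?R"
      then obtain x y x' y' where "u = plane_point 0 x y" "v = plane_point 0 x' y'"
        unfolding memR by blast
      then show "u + v \<in> ?R"
        unfolding memR by (intro exI[of _ "x + x'"] exI[of _ "y + y'"]) (simp add: vec_eq_iff algebra_simps)
    next
      fix c u assume "u \<in> ?R"
      then obtain x y where "u = plane_point 0 x y"
        unfolding memR by blast
      then show "c *\<^sub>R u \<in> ?R"
        unfolding memR by (intro exI[of _ "c * x"] exI[of _ "c * y"]) (simp add: vec_eq_iff algebra_simps)
    qed
    moreover have "real_vec ` L \<subseteq> ?R"
    proof
      fix v assume "v \<in> real_vec ` L"
      then obtain l where l: "l \<in> L" "v = real_vec l" by blast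
      then obtain x y where "\<forall>i. l$i = B$1$i * x + B$2$i * y"
        using mem_L by blast
      then show "v \<in> ?R"
        unfolding memR l(2)
        by (intro exI[of _ "real_of_int x"] exI[of _ "real_of_int y"]) (simp add: vec_eq_iff real_vec_def)
    qed
    ultimately show "span (real_vec ` L) \<subseteq> ?R"
      by (rule span_minimal[rotated])
  next
    show "?R \<subseteq> span (real_vec ` L)"
    proof
      fix v assume "v \<in> ?R"
      then obtain x y where v: "v = plane_point 0 x y"
        unfolding memR by blast
      have "row 1 B \<in> L"
        unfolding mem_L by (intro exI[of _ 1] exI[of _ 0]) (simp add: row_def)
      moreover have "row 2 B \<in> L"
        unfolding mem_L by (intro exI[of _ 0] exI[of _ 1]) (simp add: row_def)
      ultimately have "x *\<^sub>R real_vec (row 1 B) + y *\<^sub>R real_vec (row 2 B) \<in> span (real_vec ` L)"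
        by (intro span_add span_scale span_base imageI)
      moreover have "x *\<^sub>R real_vec (row 1 B) + y *\<^sub>R real_vec (row 2 B) = v"
        by (simp add: v vec_eq_iff real_vec_def row_def)
      ultimately show "v \<in> span (real_vec ` L)" by simp
    qed
  qed
  moreover have "lam + plane_point 0 x y = plane_point lam x y" for x y
    by (simp add: vec_eq_iff)
  ultimately show ?thesis
    by (auto simp: affine_plane_def image_image split_beta)
qed

lemma plane_point_mem: "plane_point lam x y \<in> affine_plane L lam"
  unfolding affine_plane_eq by force

lemma plane_point_move: "plane_point lam (x + t * u) (y + t * w) $ i =
    plane_point lam x y $ i + t * (real_of_int (B$1$i) * u + real_of_int (B$2$i) * w)"
  by (simp add: algebra_simps)

text \<open>
  By non-resonance no third line passes through a crossing, so a small step into any of the four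
  sectors leaves the other floors unchanged. The upper and right sectors are entered with step
  \<open>0\<close>, since floors are closed from below.
\<close>

lemma square_at_crossing:
  fixes k m :: int
  assumes nr: "non_resonant L lam" and det: "col_det B i j \<noteq> 0"
    and zi: "plane_point lam x y $ i = k" and zj: "plane_point lam x y $ j = m"
  defines "p \<equiv> \<chi> h. if h = i then k - 1 else if h = j then m - 1 else \<lfloor>plane_point lam x y $ h\<rfloor>"
  shows "unit_square p i j \<subseteq> initial_surface L lam"
    and "h \<noteq> i \<Longrightarrow> h \<noteq> j \<Longrightarrow> plane_point lam x y $ h \<notin> \<int>"
proof -
  have ij: "i \<noteq> j" using det by auto
  let ?z = "plane_point lam x y"
  show nonint: "?z $ h \<notin> \<int>" if "h \<noteq> i" "h \<noteq> j" for h
  proof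
    assume "?z $ h \<in> \<int>"
    then obtain n where "?z $ h = real_of_int n" by (auto elim: Ints_cases)
    then have "?z \<in> grid_line L lam i k" "?z \<in> grid_line L lam j m" "?z \<in> grid_line L lam h n"
      using zi zj plane_point_mem by (auto simp: grid_line_def)
    moreover have "distinct [(i, k), (j, m), (h, n)]" using that ij by auto
    ultimately show False using nr unfolding non_resonant_def by blast
  qed
  have corner: "p + axis i (1 + \<sigma>) + axis j (1 + \<tau>) \<in> initial_surface L lam"
    if st: "\<sigma> \<in> {0, -1}" "\<tau> \<in> {0, -1}" for \<sigma> \<tau> :: int
  proof -
    define d where "d = real_of_int (col_det B i j)"
    have d: "d \<noteq> 0" using det by (simp add: d_def)
    \<comment> \<open>The direction \<open>(u, w)\<close> in which the coordinates \<open>i\<close> and \<open>j\<close> change at rates \<open>\<sigma>\<close> and \<open>\<tau>\<close>.\<close>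
    define u where "u = (\<sigma> * B$2$j - \<tau> * B$2$i) / d"
    define w where "w = (\<tau> * B$1$i - \<sigma> * B$1$j) / d"
    define c where "c h = real_of_int (B$1$h) * u + real_of_int (B$2$h) * w" for h
    have ci: "c i = \<sigma>"
    proof -
      have "c i * d = \<sigma> * d"
        using d by (simp add: c_def u_def w_def field_simps) (simp add: d_def col_det_eq algebra_simps)
      then show ?thesis using d by simp
    qed
    have cj: "c j = \<tau>"
    proof -
      have "c j * d = \<tau> * d"
        using d by (simp add: c_def u_def w_def field_simps) (simp add: d_def col_det_eq algebra_simps)
      then show ?thesis using d by simp
    qed
    have ev: "\<forall>\<^sub>F t in at_right (0::real). \<forall>h\<in>UNIV - {i, j}. \<lfloor>?z $ h + t * c h\<rfloor> = \<lfloor>?z $ h\<rfloor>"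
    proof (rule eventually_ball_finite)
      show "\<forall>h\<in>UNIV - {i, j}. \<forall>\<^sub>F t in at_right 0. \<lfloor>?z $ h + t * c h\<rfloor> = \<lfloor>?z $ h\<rfloor>"
      proof
        fix h assume "h \<in> UNIV - {i, j}"
        then have "?z $ h \<notin> \<int>" using nonint by blast
        moreover have "((\<lambda>t. ?z $ h + t * c h) \<longlongrightarrow> ?z $ h + 0 * c h) (at_right 0)"
          by (intro tendsto_intros)
        ultimately show "\<forall>\<^sub>F t in at_right 0. \<lfloor>?z $ h + t * c h\<rfloor> = \<lfloor>?z $ h\<rfloor>"
          using eventually_floor_eq[of "\<lambda>t. ?z $ h + t * c h" "?z $ h"] by simp
      qed
    qed simp
    have "\<forall>\<^sub>F t in at_right (0::real). t < 1"
      by (rule eventually_at_rightI[of 0 1]) auto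
    moreover have "\<forall>\<^sub>F t in at_right (0::real). 0 < t"
      by (rule eventually_at_right_less)
    ultimately have "\<forall>\<^sub>F t in at_right (0::real). (\<forall>h\<in>UNIV - {i, j}. \<lfloor>?z $ h + t * c h\<rfloor> = \<lfloor>?z $ h\<rfloor>) \<and> t < 1 \<and> 0 < t"
      using ev by (intro eventually_conj)
    from eventually_happens'[OF trivial_limit_at_right_real this]
    obtain t where t0: "\<forall>h\<in>UNIV - {i, j}. \<lfloor>?z $ h + t * c h\<rfloor> = \<lfloor>?z $ h\<rfloor>" and t1: "t < 1" "0 < t"
      by blast
    have t: "\<lfloor>?z $ h + t * c h\<rfloor> = \<lfloor>?z $ h\<rfloor>" if "h \<noteq> i" "h \<noteq> j" for h
      using t0 that by blast
    let ?z' = "plane_point lam (x + t * u) (y + t * w)"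
    have z': "?z' $ h = ?z $ h + t * c h" for h
      unfolding plane_point_move c_def ..
    have fl: "\<lfloor>real_of_int n + t * real_of_int s\<rfloor> = n + s" if "s \<in> {0, -1}" for n s :: int
      using that t1 by (auto simp: floor_eq_iff)
    have "floor_vec ?z' $ h = (p + axis i (1 + \<sigma>) + axis j (1 + \<tau>)) $ h" for h
    proof -
      have "floor_vec ?z' $ h = \<lfloor>?z $ h + t * c h\<rfloor>"
        by (simp only: floor_vec_def vec_lambda_beta z')
      then show ?thesis
        using t[of h] fl[OF st(1), of k] fl[OF st(2), of m] zi zj ci cj ij
        by (cases "h = i"; cases "h = j") (auto simp only: p_def vec_lambda_beta vector_add_component axis_component, auto)
    qed
    then have "floor_vec ?z' = p + axis i (1 + \<sigma>) + axis j (1 + \<tau>)"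
      unfolding vec_eq_iff by blast
    then show ?thesis
      unfolding initial_surface_def using plane_point_mem[of lam "x + t * u" "y + t * w"]
      by (metis imageI)
  qed
  have axis_zero: "axis h (0::int) = 0" for h :: 'n
    by (simp add: vec_eq_iff axis_component)
  show "unit_square p i j \<subseteq> initial_surface L lam"
    using corner[of 0 0] corner[of 0 "-1"] corner[of "-1" 0] corner[of "-1" "-1"]
    by (auto simp: unit_square_def axis_zero)
qed

text \<open>
  Moving with constant velocity, the first wall is hit at the minimum of finitely many hitting
  times.
\<close>

lemma first_wall:
  assumes cell: "\<And>h. real_of_int (v$h) \<le> plane_point lam x y $ h \<and> plane_point lam x y $ h \<le> real_of_int (v$h) + 1"
    and moving: "real_of_int (B$1$g) * u + real_of_int (B$2$g) * w \<noteq> 0"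
  obtains t h where "real_of_int (B$1$h) * u + real_of_int (B$2$h) * w \<noteq> 0"
    "plane_point lam (x + t * u) (y + t * w) $ h \<in> {real_of_int (v$h), real_of_int (v$h) + 1}"
    "\<And>h. real_of_int (v$h) \<le> plane_point lam (x + t * u) (y + t * w) $ h \<and>
       plane_point lam (x + t * u) (y + t * w) $ h \<le> real_of_int (v$h) + 1"
proof -
  let ?z = "plane_point lam x y"
  define c where "c h = real_of_int (B$1$h) * u + real_of_int (B$2$h) * w" for h
  define \<tau> where "\<tau> h = ((if 0 < c h then v$h + 1 else v$h) - ?z $ h) / c h" for h
  define M where "M = {h. c h \<noteq> 0}"
  have M: "finite M" "M \<noteq> {}" using moving by (auto simp: M_def c_def)
  have "Min (\<tau> ` M) \<in> \<tau> ` M" using M by (intro Min_in) auto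
  then obtain h where h: "h \<in> M" "Min (\<tau> ` M) = \<tau> h" by auto
  have min: "\<tau> h \<le> \<tau> g" if "g \<in> M" for g
    using M that h by (metis Min_le finite_imageI imageI)
  have nonneg: "0 \<le> \<tau> g" for g
  proof -
    consider "c g = 0" | "0 < c g" | "c g < 0" by linarith
    then show ?thesis
      by cases (use cell[of g] in \<open>auto simp: \<tau>_def divide_nonneg_pos divide_nonpos_neg
        simp del: plane_point_component\<close>)
  qed
  have cc: "c h \<noteq> 0" using h by (simp add: M_def)
  have z': "plane_point lam (x + \<tau> h * u) (y + \<tau> h * w) $ g = ?z $ g + \<tau> h * c g" for g
    unfolding plane_point_move c_def ..
  have inside: "real_of_int (v$g) \<le> ?z $ g + \<tau> h * c g \<and> ?z $ g + \<tau> h * c g \<le> real_of_int (v$g) + 1" for g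
  proof -
    consider "c g = 0" | "0 < c g" | "c g < 0" by linarith
    then show ?thesis
    proof cases
      case 1 then show ?thesis using cell[of g] by simp
    next
      case 2
      then have "\<tau> h * c g \<le> \<tau> g * c g"
        using min[of g] by (intro mult_right_mono) (auto simp: M_def)
      also have "\<tau> g * c g = v$g + 1 - ?z $ g" using 2 by (simp add: \<tau>_def del: plane_point_component)
      finally show ?thesis using cell[of g] nonneg[of h] 2 by (auto intro: add_increasing2)
    next
      case 3
      then have "\<tau> g * c g \<le> \<tau> h * c g"
        using min[of g] by (intro mult_right_mono_neg) (auto simp: M_def)
      also have "\<tau> g * c g = v$g - ?z $ g" using 3 by (simp add: \<tau>_def del: plane_point_component)
      finally have "v$g - ?z $ g \<le> \<tau> h * c g" .
      moreover have "\<tau> h * c g \<le> 0" using nonneg[of h] 3 by (simp add: mult_nonneg_nonpos)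
      ultimately show ?thesis using cell[of g] by linarith
    qed
  qed
  have wall: "?z $ h + \<tau> h * c h \<in> {real_of_int (v$h), real_of_int (v$h) + 1}"
    using cc by (simp add: \<tau>_def del: plane_point_component)
  show thesis
    by (rule that[of h "\<tau> h"]) (use cc wall inside in \<open>unfold z' c_def, blast+\<close>)
qed

text \<open>
  The step from one point of the plane to another is itself a vector of the half plane required
  by the sign condition. A corner of a given chamber is reached by walking to a first wall and
  then along that wall to the next one.
\<close>

lemma initial_grid_surface:
  assumes nr: "non_resonant L lam"
  shows "grid_surface L B (initial_surface L lam)"
proof
  fix l v assume l: "l \<in> L" and "v \<in> initial_surface L lam"
  then obtain x y where v: "v = floor_vec (plane_point lam x y)"
    unfolding initial_surface_def affine_plane_eq by auto
  obtain x' y' where l': "\<And>i. l$i = B$1$i * x' + B$2$i * y'"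
    using l mem_L by blast
  have "l + v = floor_vec (plane_point lam (x + x') (y + y'))"
  proof -
    have "plane_point lam (x + x') (y + y') $ i = plane_point lam x y $ i + real_of_int (l$i)" for i
      by (simp add: l' algebra_simps)
    then show ?thesis
      by (simp add: v vec_eq_iff floor_vec_def del: plane_point_component)
  qed
  then show "l + v \<in> initial_surface L lam"
    unfolding initial_surface_def using plane_point_mem by blast
next
  fix p q assume "p \<in> initial_surface L lam" "q \<in> initial_surface L lam"
  then obtain x y x' y' where pq: "p = floor_vec (plane_point lam x y)" "q = floor_vec (plane_point lam x' y')"
    unfolding initial_surface_def affine_plane_eq by auto
  show "realizable B (q - p)"
  proof (rule realizable_halfplane[where x = "x' - x" and y = "y' - y"])
    fix i assume ne: "(q - p)$i \<noteq> 0"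
    have diff: "plane_point lam x' y' $ i - plane_point lam x y $ i = B$1$i * (x' - x) + B$2$i * (y' - y)"
      by (simp add: algebra_simps)
    have fl: "p$i = \<lfloor>plane_point lam x y $ i\<rfloor>" "q$i = \<lfloor>plane_point lam x' y' $ i\<rfloor>"
      by (simp_all add: pq floor_vec_def del: plane_point_component)
    have "p$i < q$i \<Longrightarrow> plane_point lam x y $ i < plane_point lam x' y' $ i"
      "q$i < p$i \<Longrightarrow> plane_point lam x' y' $ i < plane_point lam x y $ i"
      unfolding fl by linarith+
    then show "0 < real_of_int (sgn ((q - p)$i)) * (B$1$i * (x' - x) + B$2$i * (y' - y))"
      using ne unfolding diff[symmetric]
      by (auto simp: sgn_if mult_less_0_iff simp del: plane_point_component)
  qed
next
  fix i j and k m :: int assume det: "col_det B i j \<noteq> 0"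
  define d where "d = real_of_int (col_det B i j)"
  have d: "d \<noteq> 0" using det by (simp add: d_def)
  define a where "a = k + 1 - lam$i"
  define b where "b = m + 1 - lam$j"
  define x where "x = (a * B$2$j - b * B$2$i) / d"
  define y where "y = (b * B$1$i - a * B$1$j) / d"
  have "(B$1$i * x + B$2$i * y) * d = a * d" "(B$1$j * x + B$2$j * y) * d = b * d"
    using d by (simp_all add: x_def y_def field_simps) (simp_all add: d_def col_det_eq algebra_simps)
  then have "plane_point lam x y $ i = real_of_int (k + 1)" "plane_point lam x y $ j = real_of_int (m + 1)"
    using d by (auto simp: a_def b_def)
  note sq = square_at_crossing(1)[OF nr det this]
  have "i \<noteq> j" using det by auto
  then show "\<exists>p. p$i = k \<and> p$j = m \<and> unit_square p i j \<subseteq> initial_surface L lam"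
    using sq by (intro exI conjI) auto
next
  fix v assume "v \<in> initial_surface L lam"
  then obtain x y where v: "v = floor_vec (plane_point lam x y)"
    unfolding initial_surface_def affine_plane_eq by auto
  have cell: "real_of_int (v$h) \<le> plane_point lam x y $ h \<and> plane_point lam x y $ h \<le> real_of_int (v$h) + 1" for h
    unfolding v floor_vec_def vec_lambda_beta by linarith
  obtain g :: 'n where True by simp
  have "real_of_int (B$1$g) * B$1$g + real_of_int (B$2$g) * B$2$g \<noteq> 0"
    using column_norm_pos[of g] by (metis less_irrefl of_int_add of_int_eq_0_iff of_int_mult)
  from first_wall[OF cell this]
  obtain x1 y1 i where
    i: "plane_point lam x1 y1 $ i \<in> {real_of_int (v$i), real_of_int (v$i) + 1}" and
    cell1: "\<And>h. real_of_int (v$h) \<le> plane_point lam x1 y1 $ h \<and> plane_point lam x1 y1 $ h \<le> real_of_int (v$h) + 1"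
    by metis
  let ?u = "real_of_int (- B$2$i)" and ?w = "real_of_int (B$1$i)"
  have along: "real_of_int (B$1$h) * ?u + real_of_int (B$2$h) * ?w = col_det B i h" for h
    by (simp add: col_det_eq)
  obtain g' where "col_det B i g' \<noteq> 0" using ex_transversal by blast
  then have "real_of_int (B$1$g') * ?u + real_of_int (B$2$g') * ?w \<noteq> 0"
    unfolding along by simp
  from first_wall[OF cell1 this, unfolded along]
  obtain t j where det: "col_det B i j \<noteq> 0" and
    j: "plane_point lam (x1 + t * ?u) (y1 + t * ?w) $ j \<in> {real_of_int (v$j), real_of_int (v$j) + 1}" and
    cell2: "\<And>h. real_of_int (v$h) \<le> plane_point lam (x1 + t * ?u) (y1 + t * ?w) $ h \<and>
       plane_point lam (x1 + t * ?u) (y1 + t * ?w) $ h \<le> real_of_int (v$h) + 1"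
    by (metis of_int_eq_0_iff)
  let ?z = "plane_point lam (x1 + t * ?u) (y1 + t * ?w)"
  have "?z $ i = plane_point lam x1 y1 $ i"
    unfolding plane_point_move along by simp
  then have "?z $ i \<in> {real_of_int (v$i), real_of_int (v$i + 1)}"
    using i by (simp only: of_int_add of_int_1)
  then obtain k where k: "?z $ i = real_of_int k" "k \<in> {v$i, v$i + 1}"
    by blast
  have "?z $ j \<in> {real_of_int (v$j), real_of_int (v$j + 1)}"
    using j by (simp only: of_int_add of_int_1)
  then obtain m where m: "?z $ j = real_of_int m" "m \<in> {v$j, v$j + 1}"
    by blast
  note sq = square_at_crossing[OF nr det k(1) m(1)]
  let ?p = "\<chi> h. if h = i then k - 1 else if h = j then m - 1 else \<lfloor>?z $ h\<rfloor>"
  have ij: "i \<noteq> j" using det by auto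
  have other: "\<lfloor>?z $ h\<rfloor> = v$h" if "h \<noteq> i" "h \<noteq> j" for h
  proof -
    have "?z $ h \<noteq> real_of_int (v$h + 1)"
      using sq(2)[OF that] by (metis Ints_of_int)
    then show ?thesis
      using cell2[of h] unfolding floor_eq_iff by linarith
  qed
  have "v = ?p + axis i (1 + v$i - k) + axis j (1 + v$j - m)"
    using ij other by (simp add: vec_eq_iff axis_component del: plane_point_component)
  moreover have axis_zero: "axis h (0::int) = 0" for h :: 'n
    by (simp add: vec_eq_iff axis_component)
  ultimately have "v \<in> unit_square ?p i j"
    using k(2) m(2) by (auto simp: unit_square_def axis_zero)
  then show "\<exists>p i j. i \<noteq> j \<and> unit_square p i j \<subseteq> initial_surface L lam \<and> v \<in> unit_square p i j"
    using sq(1) ij by blast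
qed

end

lemma (in plane_lattice) grid_surface_of_is_surface:
  assumes "is_surface L S"
  shows "grid_surface L B S"
proof -
  obtain lam where nr: "non_resonant L lam"
    and steps: "rtranclp (elementary_transformation L) (initial_surface L lam) S"
    using assms unfolding is_surface_def by blast
  from steps show ?thesis
  proof (induction rule: rtranclp_induct)
    case base
    show ?case using nr by (rule initial_grid_surface)
  next
    case (step S S')
    then show ?case using grid_surface.grid_surface_elementary_transformation by blast
  qed
qed

lemma coord_sum_add: "coord_sum (p + q) = coord_sum p + coord_sum q"
  by (simp add: coord_sum_def sum.distrib)

lemma coord_sum_axis [simp]: "coord_sum (axis i c) = c"
  by (simp add: coord_sum_def axis_component)

lemma unit_square_commute: "unit_square p i j = unit_square p j i"
  by (auto simp: unit_square_def ac_simps)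

lemma unit_square_eq:
  assumes "unit_square p i j = unit_square q k l" "i \<noteq> j" "k \<noteq> l"
  shows "p = q" "{i, j} = {k, l}"
proof -
  show pq: "p = q"
    using unit_square_ge[of p q k l] unit_square_ge[of q p i j] unit_square_mem(1)[of p i j]
      unit_square_mem(1)[of q k l] assms by (auto simp: vec_eq_iff intro: antisym)
  have dir: "m \<in> {k, l}" if "p + axis m 1 \<in> unit_square p k l" for m k l :: 'a and p :: "int ^ 'a"
    using that by (auto simp: unit_square_def vec_eq_iff axis_component dest!: spec[of _ m] split: if_splits)
  show "{i, j} = {k, l}"
  proof -
    have eq: "unit_square p i j = unit_square p k l" using assms(1) pq by simp
    have "i \<in> {k, l}" "j \<in> {k, l}"
      using dir[of p i k l] dir[of p j k l] unit_square_mem(2)[of p i j] unit_square_mem(3)[of p j i]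
      unfolding eq by blast+
    then show ?thesis using assms(2,3) by blast
  qed
qed

section \<open>Tiles and arrows\<close>

text \<open>
  The Euclidean algorithm on the first coordinates brings a lattice of rank two to triangular
  form, which exhibits the cosets as a rectangle.
\<close>

lemma hermite_form:
  fixes a b c d :: int
  assumes "0 < a * d - b * c"
  obtains g h u where "0 < g" "0 < h" "g * h = a * d - b * c"
    "\<And>k m. (\<exists>x y. k = a * x + c * y \<and> m = b * x + d * y) \<longleftrightarrow> (\<exists>x y. k = g * x \<and> m = u * x + h * y)"
proof -
  define g where "g = gcd a c"
  have g: "0 < g" using assms by (auto simp: g_def)
  obtain a' c' where ac: "a = g * a'" "c = g * c'"
    unfolding g_def by (meson dvdE gcd_dvd1 gcd_dvd2)
  obtain s t where "s * a + t * c = g"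
    unfolding g_def using bezout_int by blast
  then have "g * (s * a' + t * c') = g * 1" using ac by (simp add: algebra_simps)
  then have st: "s * a' + t * c' = 1" using g by simp
  \<comment> \<open>In the basis given by the unimodular matrix with columns \<open>(s, t)\<close> and \<open>(- c', a')\<close>.\<close>
  define h where "h = a' * d - c' * b"
  define u where "u = s * b + t * d"
  have gh: "g * h = a * d - b * c" by (simp add: ac h_def algebra_simps)
  have "0 < h" using assms g gh by (metis zero_less_mult_pos)
  have fwd: "\<exists>x y. k = g * x \<and> m = u * x + h * y" if "k = a * x + c * y" "m = b * x + d * y" for k m x y
  proof (intro exI conjI)
    show "k = g * (a' * x + c' * y)" using that by (simp add: ac algebra_simps)
    have "u * (a' * x + c' * y) + h * (s * y - t * x) = (s * a' + t * c') * (b * x + d * y)"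
      by (simp add: u_def h_def algebra_simps)
    then show "m = u * (a' * x + c' * y) + h * (s * y - t * x)"
      using st that by simp
  qed
  have bwd: "\<exists>x y. k = a * x + c * y \<and> m = b * x + d * y" if "k = g * x" "m = u * x + h * y" for k m x y
  proof (intro exI conjI)
    have "a * (s * x - c' * y) + c * (t * x + a' * y) = g * (s * a' + t * c') * x"
      by (simp add: ac algebra_simps)
    then show "k = a * (s * x - c' * y) + c * (t * x + a' * y)"
      using st that by simp
    show "m = b * (s * x - c' * y) + d * (t * x + a' * y)"
      using that by (simp add: u_def h_def algebra_simps)
  qed
  show thesis
    by (rule that[OF g \<open>0 < h\<close> gh]) (use fwd bwd in blast)
qed

context grid_surface
begin

definition tile_of :: "int ^ 'n \<Rightarrow> 'n \<Rightarrow> 'n \<Rightarrow> (int ^ 'n) set set" where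
  "tile_of p i j = square_orbit L (unit_square p i j)"

lemma tile_of_eq: "tile_of p i j = {unit_square (l + p) i j | l. l \<in> L}"
  unfolding tile_of_def square_orbit_def unit_square_translate by blast

lemma tile_of_commute: "tile_of p i j = tile_of p j i"
  by (simp add: tile_of_def unit_square_commute)

lemma tile_of_translate: assumes "l \<in> L" shows "tile_of (l + p) i j = tile_of p i j"
proof -
  have "\<exists>l''. unit_square (l' + (l + p)) i j = unit_square (l'' + p) i j \<and> l'' \<in> L" if "l' \<in> L" for l'
    using L_add[OF that assms] by (intro exI[of _ "l' + l"]) (simp add: add.assoc)
  moreover have "\<exists>l''. unit_square (l' + p) i j = unit_square (l'' + (l + p)) i j \<and> l'' \<in> L" if "l' \<in> L" for l'
    using L_diff[OF that assms] by (intro exI[of _ "l' - l"]) simp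
  ultimately show ?thesis
    unfolding tile_of_eq by blast
qed

lemma tile_of_inject:
  assumes "tile_of p i j = tile_of q k m" "i \<noteq> j" "k \<noteq> m"
  shows "{i, j} = {k, m}" "\<exists>l\<in>L. p = l + q"
proof -
  have "unit_square p i j \<in> tile_of q k m"
    unfolding assms(1)[symmetric] unfolding tile_of_eq using L_zero by force
  then obtain l where l: "l \<in> L" "unit_square p i j = unit_square (l + q) k m"
    unfolding tile_of_eq by blast
  then show "{i, j} = {k, m}" "\<exists>l\<in>L. p = l + q"
    using unit_square_eq[OF l(2) assms(2,3)] by auto
qed

lemma tile_cases:
  assumes "e \<in> tiles L S"
  obtains p i j where "0 < col_det B i j" "unit_square p i j \<subseteq> S" "e = tile_of p i j"
proof -
  obtain p i j where p: "i \<noteq> j" "unit_square p i j \<subseteq> S" "e = tile_of p i j"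
    using assms unfolding tiles_def unit_squares_def tile_of_def by blast
  have "col_det B i j \<noteq> 0"
    using square_det_nonzero p by blast
  then show thesis
    using that[of i j p] that[of j i p] p col_det_swap[of B i j] unit_square_commute[of p i j]
      tile_of_commute[of p i j] by fastforce
qed

lemma tile_of_mem: "i \<noteq> j \<Longrightarrow> unit_square p i j \<subseteq> S \<Longrightarrow> tile_of p i j \<in> tiles L S"
  unfolding tiles_def unit_squares_def tile_of_def by blast

lemma tile_type_tile_of:
  assumes "0 < col_det B i j"
  shows "tile_type B (tile_of p i j) = (i, j)"
  unfolding tile_type_def
proof (rule the_equality, goal_cases)
  case 1
  then show ?case
    using assms L_zero unfolding tile_of_eq by auto
next
  case (2 x)
  then obtain k m q l where x: "x = (k, m)" "unit_square q k m = unit_square (l + p) i j" "0 < col_det B k m"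
    unfolding tile_of_eq by (cases x) auto
  have "i \<noteq> j" "k \<noteq> m" using assms x by auto
  then have "{k, m} = {i, j}" using unit_square_eq x(2) by metis
  then show ?case
    using x assms col_det_swap[of B i j] by (auto simp: doubleton_eq_iff)
qed

lemma tile_type_swap:
  assumes "col_det B i j \<noteq> 0"
  shows "{fst (tile_type B (tile_of p i j)), snd (tile_type B (tile_of p i j))} = {i, j}"
proof (cases "0 < col_det B i j")
  case True
  then show ?thesis by (simp add: tile_type_tile_of)
next
  case False
  then have "0 < col_det B j i" using assms col_det_swap[of B i j] by simp
  then show ?thesis
    unfolding tile_of_commute[of p i j] by (auto simp: tile_type_tile_of)
qed

text \<open>
  The coordinates \<open>i\<close> and \<open>j\<close> identify the squares of this type with
  \<open>\<int> \<times> \<int>\<close>, and translations by \<open>L\<close> become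
  translations by the lattice spanned by the rows of the minor of \<open>B\<close> with columns
  \<open>i\<close> and \<open>j\<close>.
\<close>

lemma card_tiles_of_type:
  assumes det: "0 < col_det B i j"
  shows "finite {e \<in> tiles L S. tile_type B e = (i, j)}"
    and "card {e \<in> tiles L S. tile_type B e = (i, j)} = nat (col_det B i j)"
proof -
  have ij: "i \<noteq> j" using det by auto
  have det': "0 < B$1$i * B$2$j - B$1$j * B$2$i"
    using det by (simp add: col_det_eq)
  obtain g h u where gh: "0 < g" "0 < h" "g * h = B$1$i * B$2$j - B$1$j * B$2$i"
    and lat: "\<And>k m. (\<exists>x y. k = B$1$i * x + B$2$i * y \<and> m = B$1$j * x + B$2$j * y) \<longleftrightarrow>
      (\<exists>x y. k = g * x \<and> m = u * x + h * y)"
    by (rule hermite_form[OF det']) (rule that)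
  have lat1: "\<exists>x y. l$i = g * x \<and> l$j = u * x + h * y" if "l \<in> L" for l
    using that lat[of "l$i" "l$j"] unfolding mem_L by blast
  have lat2: "\<exists>l\<in>L. l$i = g * x \<and> l$j = u * x + h * y" for x y
  proof -
    obtain x' y' where xy: "g * x = B$1$i * x' + B$2$i * y'" "u * x + h * y = B$1$j * x' + B$2$j * y'"
      using lat[of "g * x" "u * x + h * y"] by blast
    have "(\<chi> k. B$1$k * x' + B$2$k * y') \<in> L"
      unfolding mem_L by (intro exI[of _ x'] exI[of _ y']) simp
    then show ?thesis using xy by (intro bexI) auto
  qed
  have "\<exists>f. \<forall>k m. f (k, m) $ i = k \<and> f (k, m) $ j = m \<and> unit_square (f (k, m)) i j \<subseteq> S"
  proof -
    have "\<forall>x. \<exists>p. p$i = fst x \<and> p$j = snd x \<and> unit_square p i j \<subseteq> S"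
      using crossing[of i j] det by auto
    from choice[OF this] show ?thesis by auto
  qed
  then obtain f where f: "\<And>k m. f (k, m) $ i = k" "\<And>k m. f (k, m) $ j = m"
      "\<And>k m. unit_square (f (k, m)) i j \<subseteq> S"
    by blast
  let ?R = "{0..<g} \<times> {0..<h}"
  let ?T = "{e \<in> tiles L S. tile_type B e = (i, j)}"
  have "bij_betw (\<lambda>x. tile_of (f x) i j) ?R ?T"
    unfolding bij_betw_def
  proof
    show "inj_on (\<lambda>x. tile_of (f x) i j) ?R"
    proof (rule inj_onI)
      fix x y assume x: "x \<in> ?R" and y: "y \<in> ?R" and eq: "tile_of (f x) i j = tile_of (f y) i j"
      obtain k m k' m' where xy: "x = (k, m)" "y = (k', m')" by (cases x; cases y) auto
      obtain l where l: "l \<in> L" "f x = l + f y"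
        using tile_of_inject(2)[OF eq ij ij] by blast
      obtain s t where st: "l$i = g * s" "l$j = u * s + h * t" using lat1[OF l(1)] by blast
      have small: "z = 0" if "\<bar>w * z\<bar> < w" for w z :: int
      proof (rule ccontr)
        assume "z \<noteq> 0"
        then have "\<bar>w\<bar> * 1 \<le> \<bar>w\<bar> * \<bar>z\<bar>" by (intro mult_left_mono) auto
        then have "\<bar>w\<bar> \<le> \<bar>w * z\<bar>" by (simp add: abs_mult)
        then show False using that by linarith
      qed
      have "k = g * s + k'" "m = u * s + h * t + m'"
        using l(2) f(1,2) st unfolding xy by (metis vector_add_component)+
      then have "s = 0" "m = u * s + h * t + m'"
        using x y xy by (auto intro!: small[of g s])
      moreover have "t = 0"
        using x y xy calculation by (auto intro!: small[of h t])
      ultimately show "x = y"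
        using xy \<open>k = g * s + k'\<close> by simp
    qed
    show "(\<lambda>x. tile_of (f x) i j) ` ?R = ?T"
    proof
      show "(\<lambda>x. tile_of (f x) i j) ` ?R \<subseteq> ?T"
        using f(3) ij det tile_of_mem tile_type_tile_of by auto
    next
      show "?T \<subseteq> (\<lambda>x. tile_of (f x) i j) ` ?R"
      proof
        fix e assume "e \<in> ?T"
        then have e: "e \<in> tiles L S" "tile_type B e = (i, j)" by auto
        then obtain p k m where p: "0 < col_det B k m" "unit_square p k m \<subseteq> S" "e = tile_of p k m"
          using tile_cases by blast
        then have km: "k = i" "m = j" using e tile_type_tile_of by auto
        define x where "x = p$i div g"
        define y where "y = (p$j - u * x) div h"
        obtain l where l: "l \<in> L" "l$i = g * x" "l$j = u * x + h * y" using lat2 by blast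
        let ?q = "- l + p"
        have "?q$i = p$i mod g" "?q$j = (p$j - u * x) mod h"
          using l by (simp_all add: x_def y_def minus_mult_div_eq_mod[symmetric] algebra_simps)
        then have R: "(?q$i, ?q$j) \<in> ?R" using gh by simp
        have "unit_square ?q i j \<subseteq> S"
          unfolding unit_square_translate[symmetric] using p km translate[OF L_minus[OF l(1)]] by blast
        then have q: "?q = f (?q$i, ?q$j)"
          by (intro square_unique[OF ij]) (use f in auto)
        have "e = tile_of ?q i j"
          using p km tile_of_translate[OF L_minus[OF l(1)]] by simp
        also have "\<dots> = tile_of (f (?q$i, ?q$j)) i j"
          using q by (rule arg_cong)
        finally show "e \<in> (\<lambda>x. tile_of (f x) i j) ` ?R"
          using R by (rule image_eqI)
      qed
    qed
  qed
  then have "finite ?T" "card ?T = card ?R"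
    using bij_betw_finite bij_betw_same_card by (blast, fastforce)
  moreover have "card ?R = nat (col_det B i j)"
    unfolding col_det_eq gh(3)[symmetric] using gh(1,2)
    by (simp add: card_cartesian_product nat_mult_distrib)
  ultimately show "finite ?T" "card ?T = nat (col_det B i j)"
    by (simp_all only:)
qed

lemma finite_tiles: "finite (tiles L S)"
proof -
  have "tiles L S \<subseteq> (\<Union>(i, j) \<in> {(i, j). 0 < col_det B i j}. {e \<in> tiles L S. tile_type B e = (i, j)})"
  proof
    fix e assume e: "e \<in> tiles L S"
    then obtain p i j where "0 < col_det B i j" "e = tile_of p i j"
      using tile_cases by blast
    then show "e \<in> (\<Union>(i, j) \<in> {(i, j). 0 < col_det B i j}. {e \<in> tiles L S. tile_type B e = (i, j)})"
      using e tile_type_tile_of by auto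
  qed
  moreover have "finite {(i, j). 0 < col_det B i j}" by simp
  then have "finite (\<Union>(i, j) \<in> {(i, j). 0 < col_det B i j}. {e \<in> tiles L S. tile_type B e = (i, j)})"
    using card_tiles_of_type(1) by (auto intro!: finite_UN_I)
  ultimately show ?thesis by (rule finite_subset)
qed

end

section \<open>Squares at an extremal vertex\<close>

context grid_surface
begin

definition extremal :: "int ^ 'n \<Rightarrow> int \<Rightarrow> bool" where
  "extremal v s \<longleftrightarrow> v \<in> S \<and> s \<in> {1, -1} \<and> (\<forall>i \<tau>. \<tau> \<in> {1, -1} \<longrightarrow> v + axis i \<tau> \<in> S \<longrightarrow> \<tau> = s)"

text \<open>
  The two squares at the edge turn to opposite sides of it. As both continue in the direction
  \<open>s\<close> at \<open>v\<close>, the two determinants have opposite signs.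
\<close>

lemma link_two:
  assumes extremal: "extremal v s"
    and i: "v + axis i s \<in> S"
  obtains x y where "0 < col_det B i x" "col_det B i y < 0"
    "{x. x \<noteq> i \<and> v + axis x s \<in> S \<and> v + axis i s + axis x s \<in> S} = {x, y}"
proof -
  have v: "v \<in> S" and s: "s \<in> {1, -1}"
    and one_sided: "\<And>i \<tau>. \<tau> \<in> {1, -1} \<Longrightarrow> v + axis i \<tau> \<in> S \<Longrightarrow> \<tau> = s"
    using extremal by (auto simp: extremal_def)
  define W where "W = {x. x \<noteq> i \<and> v + axis x s \<in> S \<and> v + axis i s + axis x s \<in> S}"
  define b where "b = v + axis i (min 0 s)"
  have b_cases: "(b = v \<and> b + axis i 1 = v + axis i s) \<or> (b = v + axis i s \<and> b + axis i 1 = v)"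
    using s by (auto simp: b_def vec_eq_iff axis_component)
  have edges: "edge i b" "edge i (b + axis x s)" if "x \<in> W" for x
  proof -
    have *: "v + axis x s \<in> S" "v + axis i s + axis x s \<in> S" using that by (auto simp: W_def)
    have "b + axis x s + axis i 1 = b + axis i 1 + axis x s" by (simp add: ac_simps)
    then show "edge i b" "edge i (b + axis x s)"
      using b_cases * v i unfolding edge_def by metis+
  qed
  have det: "col_det B i x \<noteq> 0" if "x \<in> W" for x
  proof
    assume "col_det B i x = 0"
    moreover have "b $ i = (b + axis x s) $ i" using that by (auto simp: W_def axis_component)
    ultimately have "(b + axis x s) $ x = b $ x"
      using edge_parallel[OF edges[OF that]] by blast
    then show False using s by (auto simp: axis_component)
  qed
  have unique: "x = y" if "x \<in> W" "y \<in> W" "sgn (col_det B i x) = sgn (col_det B i y)" for x y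
  proof -
    define r where "r = s * sgn (col_det B i x)"
    have r: "r \<in> {1, -1}" "r * sgn (col_det B i x) = s" "r * sgn (col_det B i y) = s"
      using s det[OF that(1)] that(3) by (auto simp: r_def sgn_if split: if_splits)
    show ?thesis
      by (rule edge_successor_unique[where m = i and s = r and p = b])
         (use r edges(2)[OF that(1)] edges(2)[OF that(2)] det that in simp_all)
  qed
  have ex: "\<exists>x\<in>W. sgn (col_det B i x) = r * s" if r: "r \<in> {1, -1}" for r
  proof -
    obtain x where x: "col_det B i x \<noteq> 0" "v + axis x (r * sgn (col_det B i x)) \<in> S"
      "v + axis i s + axis x (r * sgn (col_det B i x)) \<in> S"
      using square_on_side[OF v i s r] by blast
    have eq: "r * sgn (col_det B i x) = s"
      by (rule one_sided[OF _ x(2)]) (use r x(1) in \<open>auto simp: sgn_if\<close>)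
    then have "sgn (col_det B i x) = r * s"
      using r by auto
    moreover have "x \<in> W"
      using x(1) x(2,3)[unfolded eq] by (auto simp: W_def)
    ultimately show ?thesis by blast
  qed
  obtain x where x: "x \<in> W" "sgn (col_det B i x) = 1"
    using ex[of s] s by auto
  obtain y where y: "y \<in> W" "sgn (col_det B i y) = -1"
    using ex[of "- s"] s by auto
  have "W = {x, y}"
  proof -
    have "z = x \<or> z = y" if "z \<in> W" for z
    proof -
      have "sgn (col_det B i z) = 1 \<or> sgn (col_det B i z) = - 1"
        using det[OF that] by (simp add: sgn_if)
      then show ?thesis
        using unique[OF that x(1)] unique[OF that y(1)] x(2) y(2) by metis
    qed
    then show ?thesis using x(1) y(1) by blast
  qed
  moreover have "0 < col_det B i x" "col_det B i y < 0"
    using x(2) y(2) by (simp_all add: sgn_if split: if_splits)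
  ultimately show thesis
    using that[of x y] unfolding W_def by blast
qed

text \<open>
  Joined by a square, the edge in direction \<open>i\<close> is followed by one that is turned
  by a positive angle less than a half turn. No direction at \<open>v\<close> lies in the closed
  sector between the two: the vertices \<open>v + axis k s\<close> and \<open>v + axis c s +
  axis c' s\<close> would violate the sign condition. If the directions reachable from
  \<open>i\<close> missed \<open>k\<close>, following them would never pass over \<open>b
  k\<close>, so they would turn forever inside one of the two half planes bounded by its line.
\<close>

lemma link_connected:
  assumes extremal: "extremal v s"
    and i: "v + axis i s \<in> S" and k: "v + axis k s \<in> S"
  shows "(i, k) \<in> {(x, y). x \<noteq> y \<and> v + axis x s \<in> S \<and> v + axis y s \<in> S \<and> v + axis x s + axis y s \<in> S}\<^sup>*"
    (is "_ \<in> ?R\<^sup>*")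
proof (rule ccontr)
  have v: "v \<in> S" and s: "s \<in> {1, -1}"
    and one_sided: "\<And>i \<tau>. \<tau> \<in> {1, -1} \<Longrightarrow> v + axis i \<tau> \<in> S \<Longrightarrow> \<tau> = s"
    using extremal by (auto simp: extremal_def)
  assume notin: "(i, k) \<notin> ?R\<^sup>*"
  define C where "C = {c. (i, c) \<in> ?R\<^sup>*}"
  have CS: "v + axis c s \<in> S" if "c \<in> C" for c
  proof -
    have "(i, c) \<in> ?R\<^sup>*" using that by (simp add: C_def)
    then show ?thesis by (cases rule: rtranclE) (use i in auto)
  qed
  have kC: "k \<notin> C" using notin by (simp add: C_def)
  have succ: "\<exists>c'\<in>C. 0 < col_det B c c' \<and> v + axis c s + axis c' s \<in> S" if cC: "c \<in> C" for c
  proof -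
    obtain x y where xy: "0 < col_det B c x" "{x. x \<noteq> c \<and> v + axis x s \<in> S \<and> v + axis c s + axis x s \<in> S} = {x, y}"
      by (rule link_two[OF extremal CS[OF cC]]) (rule that)
    then have x: "x \<noteq> c" "v + axis x s \<in> S" "v + axis c s + axis x s \<in> S" by blast+
    then have "(c, x) \<in> ?R" using CS[OF cC] by auto
    moreover have "(i, c) \<in> ?R\<^sup>*" using cC by (simp only: C_def mem_Collect_eq)
    ultimately have "(i, x) \<in> ?R\<^sup>*" by (rule rtrancl_into_rtrancl[rotated])
    then have "x \<in> C" by (simp only: C_def mem_Collect_eq)
    then show ?thesis using xy x by blast
  qed
  define f where "f c = col_det B c k" for c
  define g where "g c = B$1$c * B$1$k + B$2$c * B$2$k" for c
  have sector: False if c: "c \<in> C" "c' \<in> C" "0 < col_det B c c'" "v + axis c s + axis c' s \<in> S"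
    and f: "0 \<le> f c" "f c' \<le> 0" for c c'
  proof -
    have ne: "c \<noteq> c'" "c \<noteq> k" "c' \<noteq> k" using c kC by auto
    let ?d = "(v + axis c s + axis c' s) - (v + axis k s)"
    have real: "realizable B ?d" using c k by (intro realizable)
    have sg: "sgn (?d$c) = s" "sgn (?d$c') = s" "sgn (?d$k) = - s"
      using ne s by (auto simp: axis_component)
    have "col_det B c c' = 0"
    proof (rule realizableD(3)[OF real, of c c' k "- f c'" "f c" "col_det B c c'"])
      show "- f c' * (sgn (?d$c) * B$r$c) + f c * (sgn (?d$c') * B$r$c') +
          col_det B c c' * (sgn (?d$k) * B$r$k) = 0" for r
        unfolding sg using exhaust_2[of r] by (auto simp: f_def col_det_eq algebra_simps)
    qed (use sg s c f in \<open>auto simp del: vector_minus_component vector_add_component\<close>)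
    then show False using c by simp
  qed
  have spiral: False if A: "A \<subseteq> C" "A \<noteq> {}" and sg: "\<And>c. c \<in> A \<Longrightarrow> 0 < r * f c"
    and clo: "\<And>c c'. c \<in> A \<Longrightarrow> c' \<in> C \<Longrightarrow> 0 < col_det B c c' \<Longrightarrow> v + axis c s + axis c' s \<in> S \<Longrightarrow> c' \<in> A"
    for A and r :: int
  proof -
    \<comment> \<open>The cotangent of the angle from \<open>b c\<close> to \<open>b k\<close>; it increases with each turn inside a half plane.\<close>
    define h where "h c = real_of_int (g c) / real_of_int (f c)" for c
    have ascend: "\<exists>c'\<in>A. h c < h c'" if cA: "c \<in> A" for c
    proof -
      obtain c' where c': "c' \<in> C" "0 < col_det B c c'" "v + axis c s + axis c' s \<in> S"
        using succ cA A by blast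
      then have A': "c' \<in> A" using clo cA by blast
      have "0 < col_det B c c' * (B$1$k * B$1$k + B$2$k * B$2$k)"
        using c'(2) column_norm_pos[of k] by (rule mult_pos_pos)
      also have "\<dots> = f c * g c' - f c' * g c"
        by (simp add: f_def g_def col_det_eq algebra_simps)
      finally have lt: "f c' * g c < f c * g c'" by simp
      have "0 < (r * f c) * (r * f c')" using sg[OF cA] sg[OF A'] by simp
      then have "0 < (r * r) * (f c * f c')" by (simp add: ac_simps)
      then have pos: "0 < f c * f c'" by (simp add: zero_less_mult_iff)
      have "real_of_int (f c') * g c < real_of_int (f c) * g c'"
        using lt by (metis of_int_less_iff of_int_mult)
      moreover have "0 < real_of_int (f c) * real_of_int (f c')"
        using pos by (metis of_int_0_less_iff of_int_mult)
      moreover have "h c' - h c = (real_of_int (f c) * g c' - real_of_int (f c') * g c) / (real_of_int (f c) * real_of_int (f c'))"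
      proof -
        have "real_of_int (f c) \<noteq> 0" "real_of_int (f c') \<noteq> 0" using pos by auto
        then show ?thesis by (simp add: h_def field_simps)
      qed
      ultimately have "0 < h c' - h c" by simp
      then show ?thesis using A' by force
    qed
    have "finite (h ` A)" "h ` A \<noteq> {}" using A by auto
    then have "Max (h ` A) \<in> h ` A" by (rule Max_in)
    then obtain c where c: "c \<in> A" "Max (h ` A) = h c" by auto
    obtain c' where "c' \<in> A" "h c < h c'" using ascend[OF c(1)] by blast
    moreover have "h c' \<le> Max (h ` A)" using calculation(1) by simp
    ultimately show False using c(2) by simp
  qed
  show False
  proof (cases "\<exists>c\<in>C. 0 \<le> f c")
    case True
    have pos: "0 < f c'" if "c \<in> C" "0 \<le> f c" "c' \<in> C" "0 < col_det B c c'" "v + axis c s + axis c' s \<in> S" for c c'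
      using sector[of c c'] that by force
    \<comment> \<open>Once a direction is on the positive side, all later ones stay there.\<close>
    let ?A = "{c \<in> C. 0 < f c}"
    have "?A \<noteq> {}" using True succ pos by blast
    then show False
      by (rule spiral[of ?A 1, rotated]) (use pos in auto)
  next
    case False
    have "C \<noteq> {}" by (auto simp: C_def)
    then show False
      by (rule spiral[of C "- 1", rotated]) (use False in auto)
  qed
qed

end

section \<open>Tiles of a perfect surface\<close>

context plane_lattice
begin

lemma orbit_eq_iff: "orbit L v = orbit L w \<longleftrightarrow> (\<exists>l\<in>L. v = l + w)"
proof
  assume "orbit L v = orbit L w"
  moreover have "v \<in> orbit L v"
    unfolding orbit_def using L_zero by force
  ultimately show "\<exists>l\<in>L. v = l + w"
    unfolding orbit_def by blast
next
  assume "\<exists>l\<in>L. v = l + w"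
  then obtain l where l: "l \<in> L" "v = l + w" by blast
  have "l' + v \<in> orbit L w" if "l' \<in> L" for l'
    unfolding orbit_def l(2) using L_add[OF that l(1)] by (metis add.assoc imageI)
  moreover have "l' + w \<in> orbit L v" if "l' \<in> L" for l'
  proof -
    have "l' + w = (l' - l) + v" using l(2) by simp
    then show ?thesis unfolding orbit_def using L_diff[OF that l(1)] by blast
  qed
  ultimately show "orbit L v = orbit L w"
    unfolding orbit_def by blast
qed

end

locale perfect_grid_surface = grid_surface L B S for L :: "(int ^ 'n) set" and B S +
  assumes perpendicular: "l \<in> L \<Longrightarrow> coord_sum l = 0"
    and three_levels: "card (coord_sum ` S) = 3"
begin

text \<open>
  The corners of one square already take three consecutive values, which must then be all.
\<close>

lemma square_levels:
  assumes "i \<noteq> j" "unit_square p i j \<subseteq> S"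
  shows "coord_sum p = grey_level S - 1"
    and "coord_sum ` S = {grey_level S - 1, grey_level S, grey_level S + 1}"
proof -
  let ?s = "coord_sum p"
  have "p \<in> S" "p + axis i 1 \<in> S" "p + axis i 1 + axis j 1 \<in> S"
    using assms(2) unit_square_mem[of p i j] by blast+
  then have "coord_sum p \<in> coord_sum ` S" "coord_sum (p + axis i 1) \<in> coord_sum ` S"
    "coord_sum (p + axis i 1 + axis j 1) \<in> coord_sum ` S"
    by blast+
  then have "{?s, ?s + 1, ?s + 2} \<subseteq> coord_sum ` S"
    by (simp add: coord_sum_add algebra_simps)
  moreover have "card {?s, ?s + 1, ?s + 2} = 3" by simp
  moreover have "finite (coord_sum ` S)"
    using three_levels by (intro card_ge_0_finite) simp
  ultimately have eq: "{?s, ?s + 1, ?s + 2} = coord_sum ` S"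
    using three_levels by (intro card_subset_eq) simp_all
  then have g: "grey_level S = ?s + 1"
    unfolding grey_level_def by (simp add: eq[symmetric])
  then show "coord_sum p = grey_level S - 1" by simp
  show "coord_sum ` S = {grey_level S - 1, grey_level S, grey_level S + 1}"
    unfolding g eq[symmetric] by auto
qed

lemma ex_square: "\<exists>p j. i \<noteq> j \<and> unit_square p i j \<subseteq> S"
proof -
  obtain j where j: "col_det B i j \<noteq> 0" using ex_transversal by blast
  moreover from this have "i \<noteq> j" by auto
  ultimately show ?thesis using crossing by blast
qed

lemma level_cases:
  assumes "v \<in> S"
  shows "coord_sum v \<in> {grey_level S - 1, grey_level S, grey_level S + 1}"
  using square_levels(2) ex_square assms by (metis imageI)

text \<open>
  White and black vertices are treated together: \<open>s = 1\<close> stands for white, where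
  all edges go up, and \<open>s = - 1\<close> for black, where they all go down.
\<close>

definition tip :: "int \<Rightarrow> (int ^ 'n) set set \<Rightarrow> (int ^ 'n) set" where
  "tip s e = (if s = 1 then tile_white L S e else tile_black L S e)"

definition peaks :: "int \<Rightarrow> (int ^ 'n) set" where
  "peaks s = {v \<in> S. coord_sum v = grey_level S - s}"

definition star :: "int \<Rightarrow> int ^ 'n \<Rightarrow> 'n \<Rightarrow> 'n \<Rightarrow> (int ^ 'n) set set" where
  "star s v i j = tile_of (v + axis i (min 0 s) + axis j (min 0 s)) i j"

definition directions :: "(int ^ 'n) set set \<Rightarrow> 'n set" where
  "directions e = {fst (tile_type B e), snd (tile_type B e)}"

definition corner :: "int \<Rightarrow> int ^ 'n \<Rightarrow> 'n \<Rightarrow> 'n \<Rightarrow> bool" where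
  "corner s v i j \<longleftrightarrow> i \<noteq> j \<and> v + axis i s \<in> S \<and> v + axis j s \<in> S \<and> v + axis i s + axis j s \<in> S"

lemma corner_commute: "corner s v i j \<longleftrightarrow> corner s v j i"
  by (auto simp: corner_def ac_simps)

lemma star_commute: "star s v i j = star s v j i"
  by (simp add: star_def tile_of_commute[of _ i j] ac_simps)

lemma peaks_eq: "peaks 1 = white_vertices S" "peaks (- 1) = black_vertices S"
  by (simp_all add: peaks_def white_vertices_def black_vertices_def)

lemma peaks_extremal:
  assumes "v \<in> peaks s" "s \<in> {1, -1}"
  shows "extremal v s"
  unfolding extremal_def
proof (intro conjI allI impI)
  fix i \<tau> assume *: "\<tau> \<in> {1, - 1}" "v + axis i \<tau> \<in> S"
  have "coord_sum (v + axis i \<tau>) = grey_level S - s + \<tau>"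
    using assms(1) by (simp add: coord_sum_add peaks_def)
  then show "\<tau> = s"
    using level_cases[OF *(2)] *(1) assms(2) by auto
qed (use assms in \<open>auto simp: peaks_def\<close>)

lemma square_at_peak:
  assumes "s \<in> {1, -1}" "i \<noteq> j"
  shows "unit_square (v + axis i (min 0 s) + axis j (min 0 s)) i j =
    {v, v + axis i s, v + axis j s, v + axis i s + axis j s}"
proof -
  have "cube_corner v (\<lambda>_. s) {i} = v + axis i s" "cube_corner v (\<lambda>_. s) {j} = v + axis j s"
    "cube_corner v (\<lambda>_. s) {i, j} = v + axis i s + axis j s"
    using assms by (auto simp: vec_eq_iff axis_component)
  then show ?thesis
    using unit_square_cube_corner[of "\<lambda>_. s" i j "{}" v] assms by simp
qed

lemma tip_tile_of:
  assumes "i \<noteq> j" "unit_square p i j \<subseteq> S" "s \<in> {1, -1}"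
  shows "p + axis i (- min 0 s) + axis j (- min 0 s) \<in> peaks s"
    and "tip s (tile_of p i j) = orbit L (p + axis i (- min 0 s) + axis j (- min 0 s))"
proof -
  let ?v = "p + axis i (- min 0 s) + axis j (- min 0 s)"
  have zero: "axis k (0 :: int) = 0" for k :: 'n by (simp add: vec_eq_iff axis_component)
  have vQ: "?v \<in> unit_square p i j"
    using assms(3) by (auto simp: unit_square_def zero)
  then show peak: "?v \<in> peaks s"
    using assms square_levels(1)[OF assms(1,2)] by (auto simp: peaks_def coord_sum_add)
  have tip_the: "tip s (tile_of p i j) = (THE b. \<exists>Q\<in>tile_of p i j. \<exists>v\<in>Q. v \<in> peaks s \<and> b = orbit L v)"
    using assms(3) by (auto simp: tip_def tile_white_def tile_black_def peaks_eq)
  show "tip s (tile_of p i j) = orbit L ?v"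
    unfolding tip_the
  proof (rule the_equality)
    have "unit_square p i j \<in> tile_of p i j"
      unfolding tile_of_eq using L_zero by force
    then show "\<exists>Q\<in>tile_of p i j. \<exists>v\<in>Q. v \<in> peaks s \<and> orbit L ?v = orbit L v"
      using vQ peak by blast
  next
    fix b assume "\<exists>Q\<in>tile_of p i j. \<exists>v\<in>Q. v \<in> peaks s \<and> b = orbit L v"
    then obtain l v where l: "l \<in> L" "v \<in> unit_square (l + p) i j" "v \<in> peaks s" "b = orbit L v"
      unfolding tile_of_eq by blast
    have sums: "coord_sum v = grey_level S - s" "coord_sum p = grey_level S - 1"
      using l(3) square_levels(1)[OF assms(1,2)] by (auto simp: peaks_def)
    have "v = l + ?v"
      using l(2) sums assms(3) perpendicular[OF l(1)]
      by (auto simp: unit_square_def coord_sum_add zero algebra_simps)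
    then show "b = orbit L ?v"
      using l(1,4) orbit_eq_iff by blast
  qed
qed

lemma star_tile:
  assumes "corner s v i j" "v \<in> peaks s" "s \<in> {1, -1}"
  shows "star s v i j \<in> tiles L S" "tip s (star s v i j) = orbit L v"
    "directions (star s v i j) = {i, j}"
proof -
  let ?p = "v + axis i (min 0 s) + axis j (min 0 s)"
  have ij: "i \<noteq> j" using assms by (simp add: corner_def)
  have sq: "unit_square ?p i j \<subseteq> S"
    unfolding square_at_peak[OF assms(3) ij] using assms by (auto simp: corner_def peaks_def)
  show "star s v i j \<in> tiles L S"
    unfolding star_def using tile_of_mem ij sq by blast
  have peak: "?p + axis i (- min 0 s) + axis j (- min 0 s) = v"
    by (simp add: vec_eq_iff axis_component)
  show "tip s (star s v i j) = orbit L v"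
    unfolding star_def tip_tile_of(2)[OF ij sq assms(3)] peak ..
  show "directions (star s v i j) = {i, j}"
    unfolding star_def directions_def using tile_type_swap square_det_nonzero[OF ij sq] by blast
qed

lemma tip_star_cases:
  assumes e: "e \<in> tiles L S" and s: "s \<in> {1, -1}" and tip: "tip s e = orbit L v"
  obtains i j where "corner s v i j" "e = star s v i j"
proof -
  obtain p i j where p: "0 < col_det B i j" "unit_square p i j \<subseteq> S" "e = tile_of p i j"
    using tile_cases e by blast
  have ij: "i \<noteq> j" using p by auto
  let ?v = "p + axis i (- min 0 s) + axis j (- min 0 s)"
  have "orbit L v = orbit L ?v"
    using tip_tile_of(2)[OF ij p(2) s] tip p(3) by simp
  then obtain l where l: "l \<in> L" "v = l + ?v"
    using orbit_eq_iff by blast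
  have base: "v + axis i (min 0 s) + axis j (min 0 s) = l + p"
    unfolding l(2) by (simp add: vec_eq_iff axis_component)
  have "unit_square (l + p) i j \<subseteq> S"
    unfolding unit_square_translate[of l p, symmetric] using p(2) translate[OF l(1)] by blast
  then have "corner s v i j"
    using square_at_peak[OF s ij, of v] ij unfolding base corner_def by auto
  moreover have "e = star s v i j"
    unfolding star_def base p(3) using tile_of_translate[OF l(1)] by simp
  ultimately show thesis by (rule that)
qed

lemma tip_peak:
  assumes "e \<in> tiles L S" "s \<in> {1, -1}"
  obtains v where "v \<in> peaks s" "tip s e = orbit L v"
proof -
  obtain p i j where p: "0 < col_det B i j" "unit_square p i j \<subseteq> S" "e = tile_of p i j"
    using tile_cases assms by blast
  then have "i \<noteq> j" by auto
  then show thesis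
    using tip_tile_of[OF _ p(2) assms(2)] p(3) that by blast
qed

lemma card_tiles_at_side:
  assumes e: "e \<in> tiles L S" and s: "s \<in> {1, -1}" and i: "i \<in> directions e"
  shows "card {e' \<in> tiles L S. tip s e' = tip s e \<and> i \<in> directions e'} = 2"
proof -
  obtain v where v: "v \<in> peaks s" "tip s e = orbit L v"
    using tip_peak e s by blast
  obtain k m where km: "corner s v k m" "e = star s v k m"
    using tip_star_cases e s v by blast
  then have "i \<in> {k, m}" using i star_tile(3)[OF km(1) v(1) s] by simp
  then have iS: "v + axis i s \<in> S" using km(1) by (auto simp: corner_def)
  obtain x y where xy: "0 < col_det B i x" "col_det B i y < 0"
    and two: "{x. x \<noteq> i \<and> v + axis x s \<in> S \<and> v + axis i s + axis x s \<in> S} = {x, y}"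
    by (rule link_two[OF peaks_extremal[OF v(1) s] iS]) (rule that)
  have corner_iff: "corner s v i z \<longleftrightarrow> z \<in> {x, y}" for z
    unfolding two[symmetric] using iS by (auto simp: corner_def)
  have "{e' \<in> tiles L S. tip s e' = tip s e \<and> i \<in> directions e'} = {star s v i x, star s v i y}"
  proof
    show "{star s v i x, star s v i y} \<subseteq> {e' \<in> tiles L S. tip s e' = tip s e \<and> i \<in> directions e'}"
      using star_tile[of s v i] corner_iff v s by auto
  next
    show "{e' \<in> tiles L S. tip s e' = tip s e \<and> i \<in> directions e'} \<subseteq> {star s v i x, star s v i y}"
    proof
      fix e' assume "e' \<in> {e' \<in> tiles L S. tip s e' = tip s e \<and> i \<in> directions e'}"
      then have e': "e' \<in> tiles L S" "tip s e' = orbit L v" "i \<in> directions e'"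
        using v by auto
      then obtain a b where ab: "corner s v a b" "e' = star s v a b"
        using tip_star_cases s by blast
      then have "i \<in> {a, b}" using e'(3) star_tile(3)[OF ab(1) v(1) s] by simp
      then obtain z where "corner s v i z" "e' = star s v i z"
        using ab corner_commute star_commute by blast
      then show "e' \<in> {star s v i x, star s v i y}" using corner_iff by auto
    qed
  qed
  moreover have "star s v i x \<noteq> star s v i y"
  proof
    assume "star s v i x = star s v i y"
    then have "{i, x} = {i, y}"
      using star_tile(3)[of s v i] corner_iff v s by (metis insertCI)
    then show False using xy by (auto simp: doubleton_eq_iff)
  qed
  ultimately show ?thesis by simp
qed

lemma tiles_at_peak_connected:
  assumes e: "e \<in> tiles L S" "e' \<in> tiles L S" and s: "s \<in> {1, -1}" and eq: "tip s e = tip s e'"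
  shows "(e, e') \<in> {(x, y). x \<in> tiles L S \<and> y \<in> tiles L S \<and> tip s x = tip s y \<and>
    directions x \<inter> directions y \<noteq> {}}\<^sup>*" (is "_ \<in> ?R\<^sup>*")
proof -
  obtain v where v: "v \<in> peaks s" "tip s e = orbit L v"
    using tip_peak e s by blast
  obtain i j where ij: "corner s v i j" "e = star s v i j"
    using tip_star_cases e(1) s v by blast
  obtain k m where km: "corner s v k m" "e' = star s v k m"
    using tip_star_cases[OF e(2) s] v eq by metis
  have adj: "(star s v a b, star s v b c) \<in> ?R" if "corner s v a b" "corner s v b c" for a b c
    using star_tile[OF that(1) v(1) s] star_tile[OF that(2) v(1) s] by auto
  have "(i, k) \<in> {(x, y). x \<noteq> y \<and> v + axis x s \<in> S \<and> v + axis y s \<in> S \<and> v + axis x s + axis y s \<in> S}\<^sup>*"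
    by (rule link_connected[OF peaks_extremal[OF v(1) s]]) (use ij km in \<open>auto simp: corner_def\<close>)
  then have "\<forall>b. corner s v k b \<longrightarrow> (e, star s v k b) \<in> ?R\<^sup>*"
  proof (induction rule: rtrancl_induct)
    case base
    show ?case
    proof (intro allI impI)
      fix b assume b: "corner s v i b"
      have "(star s v j i, star s v i b) \<in> ?R"
        using adj b ij corner_commute by blast
      then show "(e, star s v i b) \<in> ?R\<^sup>*"
        unfolding ij(2) star_commute[of s v i j] by (rule r_into_rtrancl)
    qed
  next
    case (step y z)
    then have yz: "corner s v y z" by (auto simp: corner_def)
    then have "(e, star s v y z) \<in> ?R\<^sup>*" by (rule step.IH[rule_format])
    show ?case
    proof (intro allI impI)
      fix b assume "corner s v z b"
      with yz have "(star s v y z, star s v z b) \<in> ?R" by (rule adj)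
      with \<open>(e, star s v y z) \<in> ?R\<^sup>*\<close> show "(e, star s v z b) \<in> ?R\<^sup>*"
        by (rule rtrancl_into_rtrancl)
    qed
  qed
  then show ?thesis using km(1) unfolding km(2) by simp
qed

lemma tips:
  assumes s: "s \<in> {1, -1}"
  shows "tip s ` tiles L S = orbit L ` peaks s"
proof
  show "tip s ` tiles L S \<subseteq> orbit L ` peaks s"
    using tip_peak s by blast
next
  show "orbit L ` peaks s \<subseteq> tip s ` tiles L S"
  proof
    fix b assume "b \<in> orbit L ` peaks s"
    then obtain v where v: "v \<in> peaks s" "b = orbit L v" by blast
    then have "v \<in> S" by (simp add: peaks_def)
    then obtain p i j where p: "i \<noteq> j" "unit_square p i j \<subseteq> S" "v \<in> unit_square p i j"
      using vertex by blast
    let ?v = "p + axis i (- min 0 s) + axis j (- min 0 s)"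
    have zero: "axis k (0 :: int) = 0" for k :: 'n by (simp add: vec_eq_iff axis_component)
    have "v = ?v"
      using p(3) v(1) square_levels(1)[OF p(1,2)] s
      by (auto simp: unit_square_def peaks_def coord_sum_add zero)
    then show "b \<in> tip s ` tiles L S"
      using tip_tile_of(2)[OF p(1,2) s] tile_of_mem[OF p(1,2)] v(2) by (metis imageI)
  qed
qed

lemma orbits_of_colours_disjoint: "orbit L ` peaks (- 1) \<inter> orbit L ` peaks 1 = {}"
proof -
  have "orbit L v \<noteq> orbit L w" if "v \<in> peaks (- 1)" "w \<in> peaks 1" for v w
  proof
    assume "orbit L v = orbit L w"
    then obtain l where "l \<in> L" "v = l + w" using orbit_eq_iff by blast
    then have "coord_sum v = coord_sum w" using perpendicular by (simp add: coord_sum_add)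
    then show False using that by (simp add: peaks_def)
  qed
  then show ?thesis by blast
qed

lemma ex_arc_bijection:
  "\<exists>g. bij_betw g (tiles L S) {(i, j, k). int k < col_det B i j} \<and>
    (\<forall>e\<in>tiles L S. fst (g e) = fst (tile_type B e) \<and> fst (snd (g e)) = snd (tile_type B e))"
proof -
  let ?T = "\<lambda>t. {e \<in> tiles L S. tile_type B e = t}"
  have "\<exists>h. bij_betw h (?T t) {..<nat (col_det B (fst t) (snd t))}" if "0 < col_det B (fst t) (snd t)" for t
    using card_tiles_of_type[OF that] by (intro finite_same_card_bij) auto
  then have "\<forall>t. \<exists>h. 0 < col_det B (fst t) (snd t) \<longrightarrow>
      bij_betw h (?T t) {..<nat (col_det B (fst t) (snd t))}"
    by blast
  from choice[OF this] obtain h where h: "\<And>t. 0 < col_det B (fst t) (snd t) \<Longrightarrow>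
      bij_betw (h t) (?T t) {..<nat (col_det B (fst t) (snd t))}"
    by blast
  have pos: "0 < col_det B (fst (tile_type B e)) (snd (tile_type B e))" if "e \<in> tiles L S" for e
    using that by (auto elim!: tile_cases simp: tile_type_tile_of)
  define g where "g e = (fst (tile_type B e), snd (tile_type B e), h (tile_type B e) e)" for e
  have "bij_betw g (tiles L S) {(i, j, k). int k < col_det B i j}"
    unfolding bij_betw_def
  proof
    show "inj_on g (tiles L S)"
    proof (rule inj_onI)
      fix e e' assume e: "e \<in> tiles L S" "e' \<in> tiles L S" "g e = g e'"
      then have t: "tile_type B e = tile_type B e'"
        by (auto simp: g_def prod_eq_iff)
      have t': "h (tile_type B e) e = h (tile_type B e) e'"
        using e(3) t by (simp add: g_def)
      have "inj_on (h (tile_type B e)) (?T (tile_type B e))"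
        using h[OF pos[OF e(1)]] by (rule bij_betw_imp_inj_on)
      from inj_onD[OF this t'] show "e = e'"
        using e t by simp
    qed
    show "g ` tiles L S = {(i, j, k). int k < col_det B i j}"
    proof
      show "g ` tiles L S \<subseteq> {(i, j, k). int k < col_det B i j}"
      proof
        fix x assume "x \<in> g ` tiles L S"
        then obtain e where e: "e \<in> tiles L S" "x = g e" by blast
        then have "h (tile_type B e) e \<in> {..<nat (col_det B (fst (tile_type B e)) (snd (tile_type B e)))}"
          using bij_betwE[OF h[OF pos[OF e(1)]]] by blast
        then show "x \<in> {(i, j, k). int k < col_det B i j}"
          using e by (auto simp: g_def zless_nat_eq_int_zless)
      qed
    next
      show "{(i, j, k). int k < col_det B i j} \<subseteq> g ` tiles L S"
      proof
        fix x assume "x \<in> {(i, j, k). int k < col_det B i j}"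
        then obtain i j k where x: "x = (i, j, k)" "int k < col_det B i j" by auto
        then have "0 < col_det B (fst (i, j)) (snd (i, j))" by simp
        from h[OF this] have "h (i, j) ` ?T (i, j) = {..<nat (col_det B i j)}"
          by (simp add: bij_betw_def)
        moreover have "k \<in> {..<nat (col_det B i j)}"
          using x by (simp add: zless_nat_eq_int_zless)
        ultimately obtain e where "e \<in> ?T (i, j)" "k = h (i, j) e"
          by blast
        then have "x = g e" "e \<in> tiles L S"
          using x(1) by (simp_all add: g_def)
        then show "x \<in> g ` tiles L S" by blast
      qed
    qed
  qed
  then show ?thesis
    by (intro exI[of _ g]) (simp add: g_def)
qed

lemma directions_cover: "(\<Union>e\<in>tiles L S. directions e) = UNIV"
proof -
  have "\<exists>e\<in>tiles L S. i \<in> directions e" for i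
  proof -
    obtain p j where p: "i \<noteq> j" "unit_square p i j \<subseteq> S" using ex_square by blast
    then show ?thesis
      unfolding directions_def
      using tile_of_mem[OF p] tile_type_swap[OF square_det_nonzero[OF p], of p] by blast
  qed
  then show ?thesis by blast
qed

end

section \<open>Quotients and the standard square\<close>

lemma quotient_point_eqI:
  assumes "(x, y) \<in> r" "x \<in> topspace X" "y \<in> topspace X"
  shows "quotient_point X r x = quotient_point X r y"
proof -
  have "(x, y) \<in> generated_equiv (topspace X) r"
    using assms unfolding generated_equiv_def by auto
  then show ?thesis
    unfolding quotient_point_def using equiv_class_eq[OF equiv_generated_equiv] by metis
qed

lemma quotient_lift:
  assumes "\<And>x y. x \<in> topspace X \<Longrightarrow> y \<in> topspace X \<Longrightarrow> (x, y) \<in> r \<Longrightarrow> f x = f y"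
  shows "\<exists>g. \<forall>x\<in>topspace X. g (quotient_point X r x) = f x"
proof -
  have closed: "f x = f y" if "(x, y) \<in> (Restr (r \<union> r\<inverse>) (topspace X))\<^sup>*" for x y
    using that
  proof (induction rule: rtrancl_induct)
    case (step y z)
    then have "f y = f z" using assms[of y z] assms[of z y] by auto
    then show ?case using step by simp
  qed simp
  have "f (SOME z. z \<in> quotient_point X r x) = f x" if "x \<in> topspace X" for x
  proof -
    have "x \<in> quotient_point X r x"
      unfolding quotient_point_def using that equiv_class_self[OF equiv_generated_equiv] by metis
    then have "(SOME z. z \<in> quotient_point X r x) \<in> quotient_point X r x"
      by (rule someI)
    then show ?thesis
      using closed[of x "SOME z. z \<in> quotient_point X r x"]
      unfolding quotient_point_def generated_equiv_def by auto
  qed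
  then show ?thesis
    by (intro exI[of _ "\<lambda>C. f (SOME z. z \<in> C)"]) blast
qed

lemma corners_eq: "corners = {(0, 0), (0, 1), (1, 0), (1, 1)}"
  by (auto simp: corners_def)

lemma adjacent_iff:
  "adjacent c d \<longleftrightarrow> (c, d) \<in>
    {((0, 0), (1, 0)), ((0, 0), (0, 1)), ((1, 1), (1, 0)), ((1, 1), (0, 1)),
     ((1, 0), (0, 0)), ((0, 1), (0, 0)), ((1, 0), (1, 1)), ((0, 1), (1, 1))}" (is "_ \<longleftrightarrow> _ \<in> ?P")
proof -
  have unit: "dist c d = 1 \<longleftrightarrow> (c, d) \<in> ?P" if "c \<in> corners" "d \<in> corners"
    using that unfolding corners_eq
    by (elim insertE emptyE) (simp_all add: dist_Pair_Pair dist_real_def real_sqrt_eq_1_iff)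
  have mem: "c \<in> corners \<and> d \<in> corners" if "(c, d) \<in> ?P"
    using that by (elim insertE emptyE) (simp_all add: corners_eq)
  show ?thesis
  proof
    assume "adjacent c d"
    then have "c \<in> corners" "d \<in> corners" "dist c d = 1" by (simp_all only: adjacent_def)
    then show "(c, d) \<in> ?P" by (simp only: unit)
  next
    assume P: "(c, d) \<in> ?P"
    show "adjacent c d"
      using mem[OF P] P unit by (simp only: adjacent_def)
  qed
qed

lemma adjacent_sym: "adjacent c d \<longleftrightarrow> adjacent d c"
  by (auto simp: adjacent_def dist_commute)

lemma corners_subset: "corners \<subseteq> std_square"
  by (auto simp: corners_def std_square_def)

lemma convex_std_square: "convex std_square"
  unfolding std_square_def by (intro convex_Times convex_real_interval)

lemma segment_std_square: "adjacent c d \<Longrightarrow> closed_segment c d \<subseteq> std_square"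
  by (rule closed_segment_subset[OF _ _ convex_std_square]) (use corners_subset in \<open>auto simp: adjacent_def\<close>)

lemma side_point_std_square:
  assumes "adjacent c d" "0 \<le> t" "t \<le> 1"
  shows "(1 - t) *\<^sub>R c + t *\<^sub>R d \<in> std_square"
  using segment_std_square[OF assms(1)] assms(2,3) by (auto simp: closed_segment_def)

lemma boundary_point:
  assumes "(x, y) \<in> std_square" "x * (1 - x) * (y * (1 - y)) = 0"
  obtains c d t where "adjacent c d" "0 \<le> t" "t \<le> 1" "(x, y) = (1 - t) *\<^sub>R c + t *\<^sub>R d"
proof -
  have xy: "0 \<le> x" "x \<le> 1" "0 \<le> y" "y \<le> 1"
    using assms(1) by (auto simp: std_square_def)
  consider "x = 0" | "x = 1" | "y = 0" | "y = 1"
    using assms(2) by auto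
  then show thesis
  proof cases
    case 1
    show thesis by (rule that[of "(0, 0)" "(0, 1)" y]) (use 1 xy in \<open>auto simp: adjacent_iff\<close>)
  next
    case 2
    show thesis by (rule that[of "(1, 0)" "(1, 1)" y]) (use 2 xy in \<open>auto simp: adjacent_iff\<close>)
  next
    case 3
    show thesis by (rule that[of "(0, 0)" "(1, 0)" x]) (use 3 xy in \<open>auto simp: adjacent_iff\<close>)
  next
    case 4
    show thesis by (rule that[of "(0, 1)" "(1, 1)" x]) (use 4 xy in \<open>auto simp: adjacent_iff\<close>)
  qed
qed

section \<open>Gluing labelled squares\<close>

text \<open>
  The gluing depends only on how the squares are labelled. The last four conditions say that the
  sides are glued in pairs and that the squares at a black or white label are connected through
  common sides.
\<close>

locale labelled_squares =
  fixes E :: "'e set" and bl wh :: "'e \<Rightarrow> 'v" and rd rd' :: "'e \<Rightarrow> 'i"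
    and lab :: "'e \<Rightarrow> real \<times> real \<Rightarrow> ('v, 'i) label"
  assumes finite_E: "finite E"
    and lab_eq: "lab e c = (if c = (0, 0) then Black (bl e) else if c = (1, 1) then White (wh e)
      else if c = (1, 0) then Red (rd e) else Red (rd' e))"
    and red_distinct: "e \<in> E \<Longrightarrow> rd e \<noteq> rd' e"
    and black_two: "e \<in> E \<Longrightarrow> i \<in> {rd e, rd' e} \<Longrightarrow>
      card {e' \<in> E. bl e' = bl e \<and> i \<in> {rd e', rd' e'}} = 2"
    and white_two: "e \<in> E \<Longrightarrow> i \<in> {rd e, rd' e} \<Longrightarrow>
      card {e' \<in> E. wh e' = wh e \<and> i \<in> {rd e', rd' e'}} = 2"
    and black_connected: "e \<in> E \<Longrightarrow> e' \<in> E \<Longrightarrow> bl e = bl e' \<Longrightarrow>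
      (e, e') \<in> {(x, y). x \<in> E \<and> y \<in> E \<and> bl x = bl y \<and> {rd x, rd' x} \<inter> {rd y, rd' y} \<noteq> {}}\<^sup>*"
    and white_connected: "e \<in> E \<Longrightarrow> e' \<in> E \<Longrightarrow> wh e = wh e' \<Longrightarrow>
      (e, e') \<in> {(x, y). x \<in> E \<and> y \<in> E \<and> wh x = wh y \<and> {rd x, rd' x} \<inter> {rd y, rd' y} \<noteq> {}}\<^sup>*"
begin

definition glued :: "('e \<times> real \<times> real) set topology" where
  "glued = quotient_space (disjoint_squares E) (side_gluing E lab)"

definition glued_tile :: "'e \<Rightarrow> real \<times> real \<Rightarrow> ('e \<times> real \<times> real) set" where
  "glued_tile e x = quotient_point (disjoint_squares E) (side_gluing E lab) (e, x)"

definition red_set :: "'i \<Rightarrow> ('e \<times> real \<times> real) set set" where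
  "red_set i = {glued_tile e c | e c. e \<in> E \<and> c \<in> corners \<and> lab e c = Red i}"

definition surf :: "('e \<times> real \<times> real) set set topology" where
  "surf = quotient_space glued (\<Union>i. red_set i \<times> red_set i)"

definition tile :: "'e \<Rightarrow> real \<times> real \<Rightarrow> ('e \<times> real \<times> real) set set" where
  "tile e x = quotient_point glued (\<Union>i. red_set i \<times> red_set i) (glued_tile e x)"

lemma lab_simps [simp]:
  "lab e (0, 0) = Black (bl e)" "lab e (1, 1) = White (wh e)"
  "lab e (1, 0) = Red (rd e)" "lab e (0, 1) = Red (rd' e)"
  by (simp_all add: lab_eq)

lemma lab_inj: "e \<in> E \<Longrightarrow> c \<in> corners \<Longrightarrow> d \<in> corners \<Longrightarrow> lab e c = lab e d \<Longrightarrow> c = d"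
  using red_distinct[of e] by (auto simp: corners_def)

lemma topspace_squares: "topspace (disjoint_squares E) = E \<times> std_square"
  by (simp add: disjoint_squares_def)

text \<open>
  The weight of a label is the sum of the bilinear hat functions of the corners that carry it;
  the coordinate of a tile is a bump function that vanishes on its boundary. On a side only the
  weights of its two ends are nonzero, and they are the barycentric coordinates, so they agree
  across a glued side.
\<close>

definition coords :: "'e \<times> real \<times> real \<Rightarrow> ('v, 'i) label + 'e \<Rightarrow> real" where
  "coords = (\<lambda>(e, x, y). case_sum
     (\<lambda>l. (if lab e (0, 0) = l then (1 - x) * (1 - y) else 0) +
       (if lab e (1, 1) = l then x * y else 0) +
       (if lab e (1, 0) = l then x * (1 - y) else 0) +
       (if lab e (0, 1) = l then (1 - x) * y else 0))
     (\<lambda>e'. if e' = e then x * (1 - x) * (y * (1 - y)) else 0))"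

lemma coords_side:
  assumes "adjacent c d"
  shows "coords (e, (1 - t) *\<^sub>R c + t *\<^sub>R d) (Inl l) =
      (if lab e c = l then 1 - t else 0) + (if lab e d = l then t else 0)"
    and "coords (e, (1 - t) *\<^sub>R c + t *\<^sub>R d) (Inr e') = 0"
  using assms unfolding adjacent_iff coords_def by auto

lemma coords_corner:
  assumes "c \<in> corners"
  shows "coords (e, c) = case_sum (\<lambda>l. if lab e c = l then 1 else 0) (\<lambda>e'. 0)"
  using assms by (auto simp: corners_def coords_def fun_eq_iff split: sum.split)

lemma coords_inj:
  assumes "e \<in> E" "coords (e, p) = coords (e, q)"
  shows "p = q"
proof -
  obtain x y x' y' where pq: "p = (x, y)" "q = (x', y')" by (cases p; cases q) auto
  have "coords (e, p) (Inl (lab e c)) = coords (e, q) (Inl (lab e c))" for c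
    using assms(2) by simp
  from this[of "(1, 1)"] this[of "(1, 0)"] this[of "(0, 1)"]
  have "x * y = x' * y'" "x * (1 - y) = x' * (1 - y')" "(1 - x) * y = (1 - x') * y'"
    using red_distinct[OF assms(1)] by (simp_all add: coords_def pq)
  then have "x * y + x * (1 - y) = x' * y' + x' * (1 - y')" "x * y + (1 - x) * y = x' * y' + (1 - x') * y'"
    by (simp_all only:)
  then show ?thesis
    unfolding pq by (simp add: algebra_simps)
qed

text \<open>
  The corner rule for black and white labels is a consequence of the side gluing by
  connectedness, and for red labels it is the second identification.
\<close>

inductive same_point :: "'e \<times> real \<times> real \<Rightarrow> 'e \<times> real \<times> real \<Rightarrow> bool" where
  same: "same_point z z"
| side: "adjacent c d \<Longrightarrow> adjacent c' d' \<Longrightarrow> lab e c = lab e' c' \<Longrightarrow> lab e d = lab e' d' \<Longrightarrow>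
    0 \<le> t \<Longrightarrow> t \<le> 1 \<Longrightarrow>
    same_point (e, (1 - t) *\<^sub>R c + t *\<^sub>R d) (e', (1 - t) *\<^sub>R c' + t *\<^sub>R d')"
| corner: "c \<in> corners \<Longrightarrow> c' \<in> corners \<Longrightarrow> lab e c = lab e' c' \<Longrightarrow> same_point (e, c) (e', c')"

text \<open>
  On the boundary of a tile, the labels of positive weight determine the side or the corner, and
  the weights the position on it.
\<close>

lemma coords_eq_imp_same_point:
  assumes e: "e \<in> E" "e' \<in> E" and p: "p \<in> std_square" "p' \<in> std_square"
    and eq: "coords (e, p) = coords (e', p')"
  shows "same_point (e, p) (e', p')"
proof -
  obtain x y x' y' where pp: "p = (x, y)" "p' = (x', y')" by (cases p; cases p') auto
  let ?u = "x * (1 - x) * (y * (1 - y))" and ?u' = "x' * (1 - x') * (y' * (1 - y'))"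
  show ?thesis
  proof (cases "e = e'")
    case True
    then have "p = p'" using coords_inj e eq by blast
    then show ?thesis using True same_point.same by simp
  next
    case False
    have "coords (e, p) (Inr e) = coords (e', p') (Inr e)" "coords (e, p) (Inr e') = coords (e', p') (Inr e')"
      using eq by simp_all
    then have "?u = 0" "?u' = 0"
      using False by (simp_all add: coords_def pp)
    then obtain c d t c' d' t' where cd: "adjacent c d" "0 \<le> t" "t \<le> 1" "p = (1 - t) *\<^sub>R c + t *\<^sub>R d"
      and cd': "adjacent c' d'" "0 \<le> t'" "t' \<le> 1" "p' = (1 - t') *\<^sub>R c' + t' *\<^sub>R d'"
      using p pp boundary_point by metis
    have cor: "c \<in> corners" "d \<in> corners" "c' \<in> corners" "d' \<in> corners"
      using cd(1) cd'(1) by (auto simp: adjacent_def)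
    have ne: "c \<noteq> d" "c' \<noteq> d'"
      using cd(1) cd'(1) by (auto simp: adjacent_def)
    have labne: "lab e c \<noteq> lab e d" "lab e' c' \<noteq> lab e' d'"
      using lab_inj e cor ne by blast+
    have bal: "(if lab e c = l then 1 - t else 0) + (if lab e d = l then t else 0) =
        (if lab e' c' = l then 1 - t' else 0) + (if lab e' d' = l then t' else 0)" for l
      using eq coords_side(1)[OF cd(1), of e t l] coords_side(1)[OF cd'(1), of e' t' l] cd(4) cd'(4) by metis
    have bc: "1 - t = (if lab e' c' = lab e c then 1 - t' else 0) + (if lab e' d' = lab e c then t' else 0)"
      using bal[of "lab e c"] labne by auto
    have bd: "t = (if lab e' c' = lab e d then 1 - t' else 0) + (if lab e' d' = lab e d then t' else 0)"
      using bal[of "lab e d"] labne by auto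
    consider "t = 0" | "t = 1" | "0 < t" "t < 1" using cd by linarith
    then show ?thesis
    proof cases
      case 1
      then have "p = c" using cd by simp
      have "(lab e' c' = lab e c \<and> t' = 0) \<or> (lab e' d' = lab e c \<and> t' = 1)"
        using bc 1 cd' labne by (auto split: if_splits)
      then show ?thesis
        using same_point.corner[of c c' e e'] same_point.corner[of c d' e e'] cor cd'(4) \<open>p = c\<close> by auto
    next
      case 2
      then have "p = d" using cd by simp
      have "(lab e' c' = lab e d \<and> t' = 0) \<or> (lab e' d' = lab e d \<and> t' = 1)"
        using bd 2 cd' labne by (auto split: if_splits)
      then show ?thesis
        using same_point.corner[of d c' e e'] same_point.corner[of d d' e e'] cor cd'(4) \<open>p = d\<close> by auto
    next
      case 3
      have "lab e' c' = lab e c \<or> lab e' d' = lab e c" "lab e' c' = lab e d \<or> lab e' d' = lab e d"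
        using bc bd 3 by (auto split: if_splits)
      then consider "lab e' c' = lab e c" "lab e' d' = lab e d" | "lab e' d' = lab e c" "lab e' c' = lab e d"
        using labne by metis
      then show ?thesis
      proof cases
        case 1
        then have "t = t'" using bd labne by auto
        then show ?thesis
          using same_point.side[OF cd(1) cd'(1), of e e' t] 1 cd cd' by simp
      next
        case 2
        then have "t = 1 - t'" using bd labne by auto
        moreover have "adjacent d' c'" using cd'(1) adjacent_sym by blast
        ultimately show ?thesis
          using same_point.side[OF cd(1), of d' c' e e' t] 2 cd cd' by (simp add: add.commute)
      qed
    qed
  qed
qed

lemma glued_tile_side:
  assumes "e \<in> E" "e' \<in> E" "adjacent c d" "adjacent c' d'" "lab e c = lab e' c'" "lab e d = lab e' d'"
    "0 \<le> t" "t \<le> 1"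
  shows "glued_tile e ((1 - t) *\<^sub>R c + t *\<^sub>R d) = glued_tile e' ((1 - t) *\<^sub>R c' + t *\<^sub>R d')"
  unfolding glued_tile_def
proof (rule quotient_point_eqI)
  show "((e, (1 - t) *\<^sub>R c + t *\<^sub>R d), (e', (1 - t) *\<^sub>R c' + t *\<^sub>R d')) \<in> side_gluing E lab"
    unfolding side_gluing_def using assms by blast
qed (use assms side_point_std_square in \<open>auto simp: topspace_squares\<close>)

lemma glued_tile_corner:
  assumes "e \<in> E" "e' \<in> E" "adjacent c d" "adjacent c d'" "lab e c = lab e' c" "lab e d = lab e' d'"
  shows "glued_tile e c = glued_tile e' c"
  using glued_tile_side[of e e' c d c d' 0] assms by simp

text \<open>
  Squares with a common black and a common red label are glued along a side that contains their
  black corner.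
\<close>

lemma glued_tile_black:
  assumes "e \<in> E" "e' \<in> E" "bl e = bl e'"
  shows "glued_tile e (0, 0) = glued_tile e' (0, 0)"
  using black_connected[OF assms]
proof (induction rule: rtrancl_induct)
  case (step y z)
  then obtain i where i: "y \<in> E" "z \<in> E" "bl y = bl z" "i \<in> {rd y, rd' y}" "i \<in> {rd z, rd' z}"
    by auto
  define corner_of where "corner_of x = (if i = rd x then (1 :: real, 0 :: real) else (0, 1))" for x
  have "glued_tile y (0, 0) = glued_tile z (0, 0)"
    by (rule glued_tile_corner[where d = "corner_of y" and d' = "corner_of z"])
       (use i in \<open>auto simp: adjacent_iff corner_of_def\<close>)
  then show ?case using step by simp
qed simp

lemma glued_tile_white:
  assumes "e \<in> E" "e' \<in> E" "wh e = wh e'"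
  shows "glued_tile e (1, 1) = glued_tile e' (1, 1)"
  using white_connected[OF assms]
proof (induction rule: rtrancl_induct)
  case (step y z)
  then obtain i where i: "y \<in> E" "z \<in> E" "wh y = wh z" "i \<in> {rd y, rd' y}" "i \<in> {rd z, rd' z}"
    by auto
  define corner_of where "corner_of x = (if i = rd x then (1 :: real, 0 :: real) else (0, 1))" for x
  have "glued_tile y (1, 1) = glued_tile z (1, 1)"
    by (rule glued_tile_corner[where d = "corner_of y" and d' = "corner_of z"])
       (use i in \<open>auto simp: adjacent_iff corner_of_def\<close>)
  then show ?case using step by simp
qed simp

lemma glued_tile_mem: "e \<in> E \<Longrightarrow> x \<in> std_square \<Longrightarrow> glued_tile e x \<in> topspace glued"
  unfolding glued_def glued_tile_def topspace_quotient_space quotient_point_def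
  by (rule quotientI) (simp add: topspace_squares)

lemma same_point_imp_tile_eq:
  assumes "same_point (e, p) (e', p')" "e \<in> E" "e' \<in> E"
  shows "tile e p = tile e' p'"
  using assms(1)
proof cases
  case same
  then show ?thesis by simp
next
  case (side c d c' d' t)
  have "glued_tile e p = glued_tile e' p'"
    unfolding side(1,2) by (rule glued_tile_side[OF assms(2,3) side(3-8)])
  then show ?thesis by (simp add: tile_def)
next
  case corner
  then have c: "p \<in> corners" "p' \<in> corners" "lab e p = lab e' p'" by auto
  show ?thesis
  proof (cases "\<exists>i. lab e p = Red i")
    case True
    then obtain i where i: "lab e p = Red i" by blast
    moreover from this have "lab e' p' = Red i" using c(3) by simp
    ultimately have "glued_tile e p \<in> red_set i" "glued_tile e' p' \<in> red_set i"
      unfolding red_set_def using c(1,2) assms(2,3) by blast+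
    then show ?thesis
      unfolding tile_def using c assms corners_subset glued_tile_mem by (intro quotient_point_eqI) blast+
  next
    case False
    then have "(p = (0, 0) \<and> p' = (0, 0) \<and> bl e = bl e') \<or> (p = (1, 1) \<and> p' = (1, 1) \<and> wh e = wh e')"
      using c by (auto simp: corners_def)
    then have "glued_tile e p = glued_tile e' p'"
      using glued_tile_black[OF assms(2,3)] glued_tile_white[OF assms(2,3)] by blast
    then show ?thesis by (simp add: tile_def)
  qed
qed

lemma ex_coords_lift: "\<exists>h. \<forall>e\<in>E. \<forall>x\<in>std_square. h (tile e x) = coords (e, x)"
proof -
  have "\<exists>g. \<forall>z\<in>topspace (disjoint_squares E). g (quotient_point (disjoint_squares E) (side_gluing E lab) z) = coords z"
  proof (rule quotient_lift)
    fix z w assume "(z, w) \<in> side_gluing E lab"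
    then obtain e e' c d c' d' t where *: "adjacent c d" "adjacent c' d'" "lab e c = lab e' c'" "lab e d = lab e' d'"
      "z = (e, (1 - t) *\<^sub>R c + t *\<^sub>R d)" "w = (e', (1 - t) *\<^sub>R c' + t *\<^sub>R d')"
      unfolding side_gluing_def by blast
    show "coords z = coords w"
    proof
      fix k show "coords z k = coords w k"
        using * coords_side[OF *(1)] coords_side[OF *(2)] by (cases k) auto
    qed
  qed
  then obtain g where g: "\<And>e x. e \<in> E \<Longrightarrow> x \<in> std_square \<Longrightarrow> g (glued_tile e x) = coords (e, x)"
    unfolding glued_tile_def topspace_squares by blast
  have "\<exists>h. \<forall>z\<in>topspace glued. h (quotient_point glued (\<Union>i. red_set i \<times> red_set i) z) = g z"
  proof (rule quotient_lift)
    fix z w assume "(z, w) \<in> (\<Union>i. red_set i \<times> red_set i)"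
    then obtain i e c e' c' where "e \<in> E" "c \<in> corners" "lab e c = Red i" "z = glued_tile e c"
      "e' \<in> E" "c' \<in> corners" "lab e' c' = Red i" "w = glued_tile e' c'"
      unfolding red_set_def by blast
    then show "g z = g w"
      using g corners_subset coords_corner by (metis subsetD)
  qed
  then obtain h where h: "\<And>z. z \<in> topspace glued \<Longrightarrow>
      h (quotient_point glued (\<Union>i. red_set i \<times> red_set i) z) = g z"
    by blast
  show ?thesis
    using h g glued_tile_mem unfolding tile_def by (intro exI[of _ h]) simp
qed

lemma tile_eq_iff:
  assumes "e \<in> E" "e' \<in> E" "p \<in> std_square" "p' \<in> std_square"
  shows "tile e p = tile e' p' \<longleftrightarrow> coords (e, p) = coords (e', p')"
proof
  assume "tile e p = tile e' p'"
  then show "coords (e, p) = coords (e', p')"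
    using ex_coords_lift assms by metis
next
  assume "coords (e, p) = coords (e', p')"
  then show "tile e p = tile e' p'"
    using coords_eq_imp_same_point same_point_imp_tile_eq assms by blast
qed

end

lemma continuous_map_from_discrete_prod:
  assumes "\<And>e. e \<in> E \<Longrightarrow> continuous_map Y Z (\<lambda>y. f (e, y))"
  shows "continuous_map (prod_topology (discrete_topology E) Y) Z f"
  unfolding continuous_map
proof (intro conjI allI impI)
  show "f ` topspace (prod_topology (discrete_topology E) Y) \<subseteq> topspace Z"
    using assms by (force simp: continuous_map)
  fix U assume U: "openin Z U"
  have eq: "{x \<in> topspace (prod_topology (discrete_topology E) Y). f x \<in> U} =
      (\<Union>e\<in>E. {e} \<times> {y \<in> topspace Y. f (e, y) \<in> U})"
    by auto
  have "openin (prod_topology (discrete_topology E) Y) ({e} \<times> {y \<in> topspace Y. f (e, y) \<in> U})" if "e \<in> E" for e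
    using openin_continuous_map_preimage[OF assms[OF that] U] that by (simp add: openin_prod_Times_iff)
  then show "openin (prod_topology (discrete_topology E) Y) {x \<in> topspace (prod_topology (discrete_topology E) Y). f x \<in> U}"
    unfolding eq by blast
qed

lemma continuous_on_if_const:
  "continuous_on A f \<Longrightarrow> continuous_on A (\<lambda>x. if P then f x else (0 :: real))"
  by (cases P) simp_all

context labelled_squares
begin

lemma quotient_map_tile: "quotient_map (disjoint_squares E) surf (\<lambda>(e, x). tile e x)"
proof -
  have "quotient_map (disjoint_squares E) glued (quotient_point (disjoint_squares E) (side_gluing E lab))"
    unfolding glued_def by (rule quotient_map_quotient_point)
  then have "quotient_map (disjoint_squares E) surf
      (quotient_point glued (\<Union>i. red_set i \<times> red_set i) \<circ> quotient_point (disjoint_squares E) (side_gluing E lab))"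
    unfolding surf_def by (rule quotient_map_compose[OF _ quotient_map_quotient_point])
  moreover have "quotient_point glued (\<Union>i. red_set i \<times> red_set i) \<circ> quotient_point (disjoint_squares E) (side_gluing E lab) =
      (\<lambda>(e, x). tile e x)"
    by (auto simp: fun_eq_iff tile_def glued_tile_def)
  ultimately show ?thesis by simp
qed

lemma topspace_surf: "topspace surf = (\<Union>e\<in>E. tile e ` std_square)"
proof -
  have "topspace surf = (\<lambda>(e, x). tile e x) ` (E \<times> std_square)"
    using quotient_imp_surjective_map[OF quotient_map_tile] by (simp add: topspace_squares)
  then show ?thesis by auto
qed

lemma continuous_coords:
  "continuous_map (disjoint_squares E) (product_topology (\<lambda>_. euclideanreal) UNIV) coords"
  unfolding continuous_map_componentwise_UNIV
proof
  fix k
  show "continuous_map (disjoint_squares E) euclideanreal (\<lambda>z. coords z k)"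
    unfolding disjoint_squares_def
  proof (rule continuous_map_from_discrete_prod)
    fix e
    have "continuous_on std_square (\<lambda>p. coords (e, p) k)"
    proof (cases k)
      case (Inl l)
      show ?thesis
        unfolding Inl coords_def split_beta sum.case fst_conv snd_conv
        by (intro continuous_on_add continuous_on_if_const continuous_intros)
    next
      case (Inr e')
      show ?thesis
        unfolding Inr coords_def split_beta sum.case fst_conv snd_conv
        by (intro continuous_on_if_const continuous_intros)
    qed
    then show "continuous_map (top_of_set std_square) euclideanreal (\<lambda>p. coords (e, p) k)"
      by simp
  qed
qed

text \<open>
  The coordinates descend to a continuous injection into a product of lines.
\<close>

lemma Hausdorff_surf: "Hausdorff_space surf"
proof -
  obtain h where h: "\<And>e x. e \<in> E \<Longrightarrow> x \<in> std_square \<Longrightarrow> h (tile e x) = coords (e, x)"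
    using ex_coords_lift by blast
  let ?Y = "product_topology (\<lambda>_ :: ('v, 'i) label + 'e. euclideanreal) UNIV"
  have "continuous_map (disjoint_squares E) ?Y (h \<circ> (\<lambda>(e, x). tile e x))"
    by (rule continuous_map_eq[OF continuous_coords]) (use h in \<open>auto simp: topspace_squares\<close>)
  then have "continuous_map surf ?Y h"
    using continuous_compose_quotient_map_eq[OF quotient_map_tile] by blast
  moreover have "inj_on h (topspace surf)"
  proof (rule inj_onI)
    fix z w assume "z \<in> topspace surf" "w \<in> topspace surf" and eq: "h z = h w"
    then obtain e x e' x' where z: "z = tile e x" "e \<in> E" "x \<in> std_square"
      and w: "w = tile e' x'" "e' \<in> E" "x' \<in> std_square"
      unfolding topspace_surf by blast
    then show "z = w"
      using eq h tile_eq_iff[OF z(2) w(2) z(3) w(3)] by simp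
  qed
  moreover have "Hausdorff_space ?Y"
    unfolding Hausdorff_space_product_topology by simp
  ultimately show ?thesis
    using Hausdorff_space_injective_preimage by blast
qed

lemma embedding_tile:
  assumes "e \<in> E"
  shows "embedding_map (top_of_set std_square) surf (tile e)"
proof (rule continuous_imp_embedding_map)
  have "continuous_map (top_of_set std_square) (disjoint_squares E) (\<lambda>x. (e, x))"
    unfolding disjoint_squares_def using assms by (intro continuous_map_pairedI) simp_all
  then have "continuous_map (top_of_set std_square) surf ((\<lambda>(e, x). tile e x) \<circ> (\<lambda>x. (e, x)))"
    using quotient_imp_continuous_map[OF quotient_map_tile] by (rule continuous_map_compose)
  then show "continuous_map (top_of_set std_square) surf (tile e)"
    by (simp add: comp_def)
  have "compact std_square"
    unfolding std_square_def by (intro compact_Times compact_Icc)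
  then show "compact_space (top_of_set std_square)"
    by (simp add: compact_space_subtopology)
  show "inj_on (tile e) (topspace (top_of_set std_square))"
    using tile_eq_iff[OF assms assms] coords_inj[OF assms] by (auto intro!: inj_onI)
qed (rule Hausdorff_surf)

lemma tile_corner_eq_iff:
  assumes "e \<in> E" "e' \<in> E" "c \<in> corners" "c' \<in> corners"
  shows "tile e c = tile e' c' \<longleftrightarrow> lab e c = lab e' c'"
proof -
  have "tile e c = tile e' c' \<longleftrightarrow> coords (e, c) = coords (e', c')"
    using tile_eq_iff assms corners_subset by blast
  also have "\<dots> \<longleftrightarrow> lab e c = lab e' c'"
  proof
    assume "coords (e, c) = coords (e', c')"
    then have "coords (e, c) (Inl (lab e c)) = coords (e', c') (Inl (lab e c))" by simp
    then show "lab e c = lab e' c'"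
      using assms coords_corner by (auto split: if_splits)
  next
    assume "lab e c = lab e' c'"
    then show "coords (e, c) = coords (e', c')"
      using coords_corner assms by simp
  qed
  finally show ?thesis .
qed

lemma tile_image_segment:
  assumes "e \<in> E" "e' \<in> E" "adjacent c d" "adjacent c' d'" "lab e c = lab e' c'" "lab e d = lab e' d'"
  shows "tile e ` closed_segment c d = tile e' ` closed_segment c' d'"
proof -
  have eq: "tile e ((1 - t) *\<^sub>R c + t *\<^sub>R d) = tile e' ((1 - t) *\<^sub>R c' + t *\<^sub>R d')" if "0 \<le> t" "t \<le> 1" for t
    unfolding tile_def using glued_tile_side[OF assms that] by simp
  have img: "f ` closed_segment a b = (\<lambda>t. f ((1 - t) *\<^sub>R a + t *\<^sub>R b)) ` {0..1}"
    for f :: "real \<times> real \<Rightarrow> ('e \<times> real \<times> real) set set" and a b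
    by (simp add: closed_segment_image_interval image_image)
  show ?thesis
    unfolding img using eq by (intro image_cong) auto
qed

text \<open>
  At the midpoint of a side exactly the two labels of its ends have positive weight.
\<close>

lemma segment_eq_imp_labels:
  assumes e: "e \<in> E" "e' \<in> E" and adj: "adjacent c d" "adjacent c' d'"
    and eq: "tile e ` closed_segment c d = tile e' ` closed_segment c' d'"
  shows "{lab e c, lab e d} = {lab e' c', lab e' d'}"
proof -
  let ?m = "(1 - 1/2 :: real) *\<^sub>R c + (1/2 :: real) *\<^sub>R d"
  have "?m \<in> closed_segment c d"
    unfolding closed_segment_def by (intro CollectI exI[of _ "1/2"]) simp
  then have "tile e ?m \<in> tile e' ` closed_segment c' d'"
    unfolding eq[symmetric] by (rule imageI)
  then obtain t where t: "0 \<le> t" "t \<le> 1" "tile e ?m = tile e' ((1 - t) *\<^sub>R c' + t *\<^sub>R d')"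
    unfolding closed_segment_def by blast
  have "?m \<in> std_square" "(1 - t) *\<^sub>R c' + t *\<^sub>R d' \<in> std_square"
    by (rule side_point_std_square[OF adj(1)], simp, simp) (rule side_point_std_square[OF adj(2) t(1,2)])
  then have co: "coords (e, ?m) = coords (e', (1 - t) *\<^sub>R c' + t *\<^sub>R d')"
    using t(3) tile_eq_iff[OF e] by blast
  have cor: "c \<in> corners" "d \<in> corners" "c' \<in> corners" "d' \<in> corners" "c \<noteq> d" "c' \<noteq> d'"
    using adj by (auto simp: adjacent_def)
  then have labne: "lab e c \<noteq> lab e d" "lab e' c' \<noteq> lab e' d'"
    using lab_inj e by blast+
  have bal: "(if lab e c = l then 1/2 else 0) + (if lab e d = l then 1/2 else 0) =
      (if lab e' c' = l then 1 - t else 0) + (if lab e' d' = l then t else 0)" for l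
    using coords_side(1)[OF adj(1), of e "1/2" l] coords_side(1)[OF adj(2), of e' t l]
    unfolding co by simp
  have "lab e c \<in> {lab e' c', lab e' d'}" "lab e d \<in> {lab e' c', lab e' d'}"
    using bal[of "lab e c"] bal[of "lab e d"] labne by (auto split: if_splits)
  then show ?thesis using labne by auto
qed

lemma side_orientation:
  assumes "\<sigma> \<in> sides"
  obtains c d where "c \<in> {(0, 0), (1, 1)}" "d \<in> {(1, 0), (0, 1)}" "\<sigma> = closed_segment c d" "adjacent c d"
proof -
  obtain c d where cd: "\<sigma> = closed_segment c d" "adjacent c d"
    using assms unfolding sides_def by blast
  then have "(c \<in> {(0, 0), (1, 1)} \<and> d \<in> {(1, 0), (0, 1)}) \<or> (d \<in> {(0, 0), (1, 1)} \<and> c \<in> {(1, 0), (0, 1)})"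
    unfolding adjacent_iff by auto
  then show thesis
    using that[of c d] that[of d c] cd adjacent_sym closed_segment_commute by metis
qed

lemma adjacent_mixed: "c \<in> {(0, 0), (1, 1)} \<Longrightarrow> d \<in> {(1, 0), (0, 1)} \<Longrightarrow> adjacent c d"
  unfolding adjacent_iff by auto

lemma tiles_at_side:
  assumes e: "e \<in> E" and c: "c \<in> {(0, 0), (1, 1)}" and d: "d \<in> {(1, 0), (0, 1)}" and i: "lab e d = Red i"
  shows "{e' \<in> E. \<exists>\<sigma>'\<in>sides. tile e ` closed_segment c d = tile e' ` \<sigma>'} =
    {e' \<in> E. lab e' c = lab e c \<and> i \<in> {rd e', rd' e'}}"
proof (intro Collect_cong conj_cong refl iffI)
  fix e' assume e': "e' \<in> E" and "\<exists>\<sigma>'\<in>sides. tile e ` closed_segment c d = tile e' ` \<sigma>'"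
  then obtain c' d' where cd': "c' \<in> {(0, 0), (1, 1)}" "d' \<in> {(1, 0), (0, 1)}" "adjacent c' d'"
      "tile e ` closed_segment c d = tile e' ` closed_segment c' d'"
    using side_orientation by metis
  then have "{lab e c, Red i} = {lab e' c', lab e' d'}"
    using segment_eq_imp_labels[OF e e' adjacent_mixed[OF c d] cd'(3)] i by simp
  then show "lab e' c = lab e c \<and> i \<in> {rd e', rd' e'}"
    using c cd' by (auto simp: doubleton_eq_iff)
next
  fix e' assume e': "e' \<in> E" and *: "lab e' c = lab e c \<and> i \<in> {rd e', rd' e'}"
  define d' :: "real \<times> real" where "d' = (if i = rd e' then (1, 0) else (0, 1))"
  have d': "d' \<in> {(1, 0), (0, 1)}" "lab e' d' = Red i"
    using * by (auto simp: d'_def)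
  have "tile e ` closed_segment c d = tile e' ` closed_segment c d'"
    by (rule tile_image_segment[OF e e' adjacent_mixed[OF c d] adjacent_mixed[OF c d'(1)]]) (use * i d' in auto)
  moreover have "closed_segment c d' \<in> sides"
    unfolding sides_def using adjacent_mixed[OF c d'(1)] by blast
  ultimately show "\<exists>\<sigma>'\<in>sides. tile e ` closed_segment c d = tile e' ` \<sigma>'" by blast
qed

lemma card_tiles_at_side:
  assumes e: "e \<in> E" and "\<sigma> \<in> sides"
  shows "card {e' \<in> E. \<exists>\<sigma>'\<in>sides. tile e ` \<sigma> = tile e' ` \<sigma>'} = 2"
proof -
  obtain c d where cd: "c \<in> {(0, 0), (1, 1)}" "d \<in> {(1, 0), (0, 1)}" "\<sigma> = closed_segment c d" "adjacent c d"
    by (rule side_orientation[OF assms(2)])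
  obtain i where i: "lab e d = Red i" "i \<in> {rd e, rd' e}"
    using cd(2) by auto
  have "card {e' \<in> E. lab e' c = lab e c \<and> i \<in> {rd e', rd' e'}} = 2"
    using cd(1) black_two[OF e i(2)] white_two[OF e i(2)] by auto
  then show ?thesis
    unfolding cd(3) tiles_at_side[OF e cd(1,2) i(1)] .
qed

lemma side_subset: "\<sigma> \<in> sides \<Longrightarrow> \<sigma> \<subseteq> std_square"
  unfolding sides_def using segment_std_square by blast

text \<open>
  Two different tiles have no common point with a positive bump function, so common points come
  from a common side or a common corner.
\<close>

lemma tile_intersection:
  assumes e: "e \<in> E" "e' \<in> E" "e \<noteq> e'"
  shows "tile e ` std_square \<inter> tile e' ` std_square = \<Union>(faces (tile e) \<inter> faces (tile e'))"
proof
  have "\<Union>(faces (tile x)) \<subseteq> tile x ` std_square" for x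
    unfolding faces_def using corners_subset side_subset by blast
  then show "\<Union>(faces (tile e) \<inter> faces (tile e')) \<subseteq> tile e ` std_square \<inter> tile e' ` std_square"
    by blast
next
  show "tile e ` std_square \<inter> tile e' ` std_square \<subseteq> \<Union>(faces (tile e) \<inter> faces (tile e'))"
  proof
    fix z assume "z \<in> tile e ` std_square \<inter> tile e' ` std_square"
    then obtain p p' where p: "p \<in> std_square" "p' \<in> std_square" "z = tile e p" "z = tile e' p'"
      by blast
    then have "same_point (e, p) (e', p')"
      using coords_eq_imp_same_point e tile_eq_iff by blast
    then show "z \<in> \<Union>(faces (tile e) \<inter> faces (tile e'))"
    proof cases
      case same
      then show ?thesis using e by simp
    next
      case (side c d c' d' t)
      have "tile e ` closed_segment c d = tile e' ` closed_segment c' d'"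
        by (rule tile_image_segment[OF e(1,2) side(3-6)])
      moreover have "tile e ` closed_segment c d \<in> faces (tile e)" "tile e' ` closed_segment c' d' \<in> faces (tile e')"
        unfolding faces_def sides_def using side(3,4) by blast+
      moreover have "z \<in> tile e ` closed_segment c d"
        unfolding p(3) side(1) closed_segment_def using side(7,8) by blast
      ultimately show ?thesis by auto
    next
      case corner
      have "tile e ` {p} = tile e' ` {p'}" using p by simp
      moreover have "tile e ` {p} \<in> faces (tile e)" "tile e' ` {p'} \<in> faces (tile e')"
        unfolding faces_def using corner by blast+
      ultimately show ?thesis using p(3) by auto
    qed
  qed
qed

theorem square_tiling_surf: "square_tiling surf E tile"
  unfolding square_tiling_def
  by (intro conjI ballI impI Hausdorff_surf finite_E embedding_tile topspace_surf tile_intersection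
    card_tiles_at_side)

text \<open>
  The centre of a tile lies on both diagonals, and the bump function of the tile is positive
  there.
\<close>

lemma diagonal_inj:
  assumes "p \<in> std_square" "q \<in> std_square" "(1/2, 1/2) \<in> closed_segment p q"
  shows "inj_on (\<lambda>e. tile e ` closed_segment p q) E"
proof (rule inj_onI)
  fix e e' assume e: "e \<in> E" "e' \<in> E" and "tile e ` closed_segment p q = tile e' ` closed_segment p q"
  then obtain x where x: "x \<in> closed_segment p q" "tile e (1/2, 1/2) = tile e' x"
    using assms(3) by blast
  have "closed_segment p q \<subseteq> std_square"
    by (rule closed_segment_subset[OF assms(1,2) convex_std_square])
  then have "coords (e, (1/2, 1/2)) = coords (e', x)"
    using tile_eq_iff[OF e] x assms(3) by blast
  then have "coords (e, (1/2, 1/2)) (Inr e) = coords (e', x) (Inr e)" by simp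
  then show "e = e'"
    by (cases x) (auto simp: coords_def split: if_splits)
qed

lemma centre_mem:
  "(1/2, 1/2) \<in> closed_segment (0 :: real, 0 :: real) (1, 1)"
  "(1/2, 1/2) \<in> closed_segment (1 :: real, 0 :: real) (0, 1)"
  unfolding closed_segment_def by (auto intro!: exI[of _ "1/2"])

lemma inj_bw_diagonal: "inj_on (bw_diagonal tile) E"
  unfolding bw_diagonal_def[abs_def] using centre_mem by (intro diagonal_inj) (auto simp: std_square_def)

lemma inj_rr_diagonal: "inj_on (rr_diagonal tile) E"
  unfolding rr_diagonal_def[abs_def] using centre_mem by (intro diagonal_inj) (auto simp: std_square_def)

theorem bipartite_iso_bw_diagonal_graph:
  assumes disjoint: "bl ` E \<inter> wh ` E = {}"
  shows "bipartite_iso (bw_diagonal_graph E tile)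
    \<lparr> black_nodes = bl ` E, white_nodes = wh ` E, edges = E, black_end = bl, white_end = wh \<rparr>"
    (is "bipartite_iso ?G ?H")
proof -
  let ?g = "the_inv_into E (bw_diagonal tile)"
  have g: "?g (bw_diagonal tile e) = e" if "e \<in> E" for e
    using the_inv_into_f_f[OF inj_bw_diagonal that] .
  have black_eq: "tile e (0, 0) = tile e' (0, 0) \<longleftrightarrow> bl e = bl e'" if "e \<in> E" "e' \<in> E" for e e'
    using tile_corner_eq_iff[OF that, of "(0, 0)" "(0, 0)"] by (simp add: corners_eq)
  have white_eq: "tile e (1, 1) = tile e' (1, 1) \<longleftrightarrow> wh e = wh e'" if "e \<in> E" "e' \<in> E" for e e'
    using tile_corner_eq_iff[OF that, of "(1, 1)" "(1, 1)"] by (simp add: corners_eq)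
  have bw_ne: "tile e (0, 0) \<noteq> tile e' (1, 1)" if "e \<in> E" "e' \<in> E" for e e'
    using tile_corner_eq_iff[OF that, of "(0, 0)" "(1, 1)"] by (simp add: corners_eq)
  have "wf_bipartite ?G"
    unfolding wf_bipartite_def bw_diagonal_graph_def using bw_ne g by auto
  moreover have "wf_bipartite ?H"
    unfolding wf_bipartite_def using disjoint by simp
  moreover
  define f where "f z = (if z \<in> (\<lambda>e. tile e (0, 0)) ` E then bl (SOME e. e \<in> E \<and> tile e (0, 0) = z)
    else wh (SOME e. e \<in> E \<and> tile e (1, 1) = z))" for z
  have fb: "f (tile e (0, 0)) = bl e" if e: "e \<in> E" for e
  proof -
    define x where "x = (SOME x. x \<in> E \<and> tile x (0, 0) = tile e (0, 0))"
    have "x \<in> E \<and> tile x (0, 0) = tile e (0, 0)"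
      unfolding x_def by (rule someI[of _ e]) (use e in simp)
    moreover have "f (tile e (0, 0)) = bl x"
      using e by (auto simp: f_def x_def)
    ultimately show ?thesis using black_eq e by metis
  qed
  have fw: "f (tile e (1, 1)) = wh e" if e: "e \<in> E" for e
  proof -
    define x where "x = (SOME x. x \<in> E \<and> tile x (1, 1) = tile e (1, 1))"
    have "x \<in> E \<and> tile x (1, 1) = tile e (1, 1)"
      unfolding x_def by (rule someI[of _ e]) (use e in simp)
    moreover have "tile e (1, 1) \<notin> (\<lambda>e. tile e (0, 0)) ` E"
    proof
      assume "tile e (1, 1) \<in> (\<lambda>e. tile e (0, 0)) ` E"
      then obtain y where "y \<in> E" "tile e (1, 1) = tile y (0, 0)" by blast
      then show False using bw_ne[of y e] e by simp
    qed
    then have "f (tile e (1, 1)) = wh x"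
      by (simp add: f_def x_def)
    ultimately show ?thesis using white_eq e by metis
  qed
  have "bij_betw f (black_nodes ?G) (black_nodes ?H)"
    unfolding bij_betw_def bw_diagonal_graph_def
    using fb black_eq by (auto simp: inj_on_def image_image)
  moreover have "bij_betw f (white_nodes ?G) (white_nodes ?H)"
    unfolding bij_betw_def bw_diagonal_graph_def
    using fw white_eq by (auto simp: inj_on_def image_image)
  moreover have "bij_betw ?g (edges ?G) (edges ?H)"
    using bij_betw_the_inv_into[OF bij_betw_imageI[OF inj_bw_diagonal refl]]
    by (simp add: bw_diagonal_graph_def)
  moreover have "\<forall>D\<in>edges ?G. black_end ?H (?g D) = f (black_end ?G D) \<and> white_end ?H (?g D) = f (white_end ?G D)"
    using g fb fw by (auto simp: bw_diagonal_graph_def)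
  ultimately show ?thesis
    unfolding bipartite_iso_def by blast
qed

theorem digraph_iso_rr_diagonal_graph:
  fixes H :: "('i, 'a) pre_digraph"
  assumes verts: "verts H = (\<Union>e\<in>E. {rd e, rd' e})"
    and g: "bij_betw g E (arcs H)"
    and ends: "\<And>e. e \<in> E \<Longrightarrow> tail H (g e) = rd e" "\<And>e. e \<in> E \<Longrightarrow> head H (g e) = rd' e"
  shows "digraph_iso (rr_diagonal_graph E tile) H" (is "digraph_iso ?G H")
proof -
  let ?inv = "the_inv_into E (rr_diagonal tile)"
  have inv: "?inv (rr_diagonal tile e) = e" if "e \<in> E" for e
    using the_inv_into_f_f[OF inj_rr_diagonal that] .
  have red_eq: "tile e c = tile e' c' \<longleftrightarrow> lab e c = lab e' c'"
    if "e \<in> E" "e' \<in> E" "c \<in> {(1, 0), (0, 1)}" "c' \<in> {(1, 0), (0, 1)}" for e e' c c'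
    using tile_corner_eq_iff[OF that(1,2), of c c'] that(3,4) by (auto simp: corners_eq)
  define f where "f z = (SOME i. \<exists>e\<in>E. \<exists>c\<in>{(1, 0), (0, 1)}. z = tile e c \<and> lab e c = Red i)" for z
  have f: "f (tile e c) = i" if "e \<in> E" "c \<in> {(1, 0), (0, 1)}" "lab e c = Red i" for e c i
    unfolding f_def
  proof (rule some_equality)
    show "\<exists>e'\<in>E. \<exists>c'\<in>{(1, 0), (0, 1)}. tile e c = tile e' c' \<and> lab e' c' = Red i"
      using that by blast
    fix j assume "\<exists>e'\<in>E. \<exists>c'\<in>{(1, 0), (0, 1)}. tile e c = tile e' c' \<and> lab e' c' = Red j"
    then obtain e' c' where w: "e' \<in> E" "c' \<in> {(1, 0), (0, 1)}" "tile e c = tile e' c'" "lab e' c' = Red j"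
      by blast
    then have "lab e c = lab e' c'" using red_eq[OF that(1) w(1) that(2) w(2)] by simp
    then show "j = i" using w(4) that(3) by simp
  qed
  have ft: "f (tile e (1, 0)) = rd e" and fh: "f (tile e (0, 1)) = rd' e" if "e \<in> E" for e
    using f[OF that] by simp_all
  define iso where "iso = \<lparr> iso_verts = f, iso_arcs = g \<circ> ?inv, iso_head = head H, iso_tail = tail H \<rparr>"
  have red_node: "\<exists>e\<in>E. \<exists>c\<in>{(1, 0), (0, 1)}. z = tile e c" if "z \<in> verts ?G" for z
  proof -
    have "z \<in> (\<lambda>e. tile e (1, 0)) ` E \<union> (\<lambda>e. tile e (0, 1)) ` E"
      using that by (simp add: rr_diagonal_graph_def)
    then show ?thesis by blast
  qed
  have inj: "inj_on f (verts ?G)"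
  proof (rule inj_onI)
    fix z w assume zw: "z \<in> verts ?G" "w \<in> verts ?G" and eq: "f z = f w"
    obtain e c e' c' where z: "e \<in> E" "c \<in> {(1, 0), (0, 1)}" "z = tile e c"
      and w: "e' \<in> E" "c' \<in> {(1, 0), (0, 1)}" "w = tile e' c'"
      using red_node[OF zw(1)] red_node[OF zw(2)] by blast
    obtain i j where ij: "lab e c = Red i" "lab e' c' = Red j"
      using z(2) w(2) by auto
    then have "i = j" using f[OF z(1,2) ij(1)] f[OF w(1,2) ij(2)] eq z(3) w(3) by simp
    then show "z = w" using red_eq[OF z(1) w(1) z(2) w(2)] ij z(3) w(3) by simp
  qed
  have "pre_digraph.digraph_isomorphism ?G iso"
    unfolding pre_digraph.digraph_isomorphism_def
  proof (intro conjI ballI)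
    show "wf_digraph ?G"
      by (unfold_locales) (auto simp: rr_diagonal_graph_def inv)
    show "inj_on (iso_verts iso) (verts ?G)"
      using inj by (simp add: iso_def)
    show "inj_on (iso_arcs iso) (arcs ?G)"
      using bij_betw_imp_inj_on[OF g] by (auto simp: iso_def rr_diagonal_graph_def inj_on_def inv)
    fix D assume "D \<in> arcs ?G"
    then obtain e where e: "e \<in> E" "D = rr_diagonal tile e"
      by (auto simp: rr_diagonal_graph_def)
    show "iso_verts iso (tail ?G D) = iso_tail iso (iso_arcs iso D)"
      using e ft ends(1) by (simp add: iso_def rr_diagonal_graph_def inv)
    show "iso_verts iso (head ?G D) = iso_head iso (iso_arcs iso D)"
      using e fh ends(2) by (simp add: iso_def rr_diagonal_graph_def inv)
  qed
  moreover have "H = app_iso iso ?G"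
  proof -
    have "f ` verts ?G = verts H"
      unfolding verts rr_diagonal_graph_def using ft fh by (force simp: image_Un image_image)
    moreover have "(g \<circ> ?inv) ` arcs ?G = arcs H"
      using bij_betw_imp_surj_on[OF g] by (force simp: rr_diagonal_graph_def image_image inv)
    ultimately show ?thesis
      by (intro pre_digraph.equality) (simp_all add: iso_def)
  qed
  ultimately show ?thesis
    unfolding digraph_iso_def by blast
qed

end

section \<open>The untwisted surface\<close>

theorem mainTheorem4:
  fixes L :: "(int ^ 'n) set" and B :: "int ^ 'n ^ 2" and S :: "(int ^ 'n) set"
  assumes "is_Z_basis L B"
    and "\<forall>i. \<not> L \<subseteq> {l. l $ i = 0}"
    and "\<forall>l\<in>L. (\<Sum>i\<in>UNIV. l $ i) = 0"
    and "perfect_surface L S"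
  shows "square_tiling (M_space L B S) (tiles L S) (M_tile L B S) \<and>
    bipartite_iso (bw_diagonal_graph (tiles L S) (M_tile L B S)) (surface_graph L S) \<and>
    digraph_iso (rr_diagonal_graph (tiles L S) (M_tile L B S)) (pluecker_quiver B)"
proof -
  interpret plane_lattice L B
    using assms(1,2) by unfold_locales
  have "is_surface L S" and three: "card (coord_sum ` S) = 3"
    using assms(4) by (auto simp: perfect_surface_def)
  then interpret grid_surface L B S
    using grid_surface_of_is_surface by blast
  interpret perfect_grid_surface L B S
    using assms(3) three by unfold_locales (auto simp: coord_sum_def)
  have white: "tile_white L S = tip 1" and black: "tile_black L S = tip (- 1)"
    by (simp_all add: tip_def fun_eq_iff)
  let ?E = "tiles L S"
  let ?rd = "\<lambda>e. fst (tile_type B e)" and ?rd' = "\<lambda>e. snd (tile_type B e)"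
  interpret T: labelled_squares ?E "tile_black L S" "tile_white L S" ?rd ?rd' "corner_label L B S"
  proof
    show "finite ?E" by (rule finite_tiles)
    show "?rd e \<noteq> ?rd' e" if "e \<in> ?E" for e
      using that by (auto elim!: tile_cases simp: tile_type_tile_of)
    show "card {e' \<in> ?E. tile_black L S e' = tile_black L S e \<and> i \<in> {?rd e', ?rd' e'}} = 2"
      if "e \<in> ?E" "i \<in> {?rd e, ?rd' e}" for e i
      using card_tiles_at_side[of e "- 1" i] that by (simp add: black directions_def)
    show "card {e' \<in> ?E. tile_white L S e' = tile_white L S e \<and> i \<in> {?rd e', ?rd' e'}} = 2"
      if "e \<in> ?E" "i \<in> {?rd e, ?rd' e}" for e i
      using card_tiles_at_side[of e 1 i] that by (simp add: white directions_def)
    show "(e, e') \<in> {(x, y). x \<in> ?E \<and> y \<in> ?E \<and> tile_black L S x = tile_black L S y \<and>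
        {?rd x, ?rd' x} \<inter> {?rd y, ?rd' y} \<noteq> {}}\<^sup>*"
      if "e \<in> ?E" "e' \<in> ?E" "tile_black L S e = tile_black L S e'" for e e'
      using tiles_at_peak_connected[OF that(1,2), of "- 1"] that(3) by (simp add: black directions_def)
    show "(e, e') \<in> {(x, y). x \<in> ?E \<and> y \<in> ?E \<and> tile_white L S x = tile_white L S y \<and>
        {?rd x, ?rd' x} \<inter> {?rd y, ?rd' y} \<noteq> {}}\<^sup>*"
      if "e \<in> ?E" "e' \<in> ?E" "tile_white L S e = tile_white L S e'" for e e'
      using tiles_at_peak_connected[OF that(1,2), of 1] that(3) by (simp add: white directions_def)
  qed (simp add: corner_label_def)
  have glued: "T.glued = M_tilde L B S"
    by (simp add: T.glued_def M_tilde_def)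
  have glued_tile: "T.glued_tile = M_tilde_tile L B S"
    by (simp add: T.glued_tile_def M_tilde_tile_def fun_eq_iff)
  have red: "T.red_set = red_points L B S"
    by (simp add: T.red_set_def red_points_def glued_tile fun_eq_iff)
  have surf: "T.surf = M_space L B S"
    by (simp add: T.surf_def M_space_def glued red)
  have tile: "T.tile = M_tile L B S"
    by (simp add: T.tile_def M_tile_def glued red glued_tile fun_eq_iff)
  have black_tips: "tile_black L S ` ?E = orbit L ` black_vertices S"
    and white_tips: "tile_white L S ` ?E = orbit L ` white_vertices S"
    using tips[of "- 1"] tips[of 1] by (simp_all add: black white peaks_eq)
  have "square_tiling (M_space L B S) ?E (M_tile L B S)"
    using T.square_tiling_surf by (simp only: surf tile)
  moreover have "bipartite_iso (bw_diagonal_graph ?E (M_tile L B S)) (surface_graph L S)"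
  proof -
    have "tile_black L S ` ?E \<inter> tile_white L S ` ?E = {}"
      using orbits_of_colours_disjoint by (simp only: black_tips white_tips peaks_eq)
    from T.bipartite_iso_bw_diagonal_graph[OF this] show ?thesis
      by (simp only: tile black_tips white_tips surface_graph_def)
  qed
  moreover have "digraph_iso (rr_diagonal_graph ?E (M_tile L B S)) (pluecker_quiver B)"
  proof -
    obtain g where g: "bij_betw g ?E {(i, j, k). int k < col_det B i j}"
      and ends: "\<And>e. e \<in> ?E \<Longrightarrow> fst (g e) = ?rd e \<and> fst (snd (g e)) = ?rd' e"
      using ex_arc_bijection by blast
    have "digraph_iso (rr_diagonal_graph ?E T.tile) (pluecker_quiver B)"
    proof (rule T.digraph_iso_rr_diagonal_graph)
      show "verts (pluecker_quiver B) = (\<Union>e\<in>?E. {?rd e, ?rd' e})"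
        using directions_cover by (simp add: pluecker_quiver_def directions_def)
      show "bij_betw g ?E (arcs (pluecker_quiver B))"
        using g by (simp add: pluecker_quiver_def)
      show "tail (pluecker_quiver B) (g e) = ?rd e" "head (pluecker_quiver B) (g e) = ?rd' e" if "e \<in> ?E" for e
        using ends[OF that] by (auto simp: pluecker_quiver_def split: prod.split)
    qed
    then show ?thesis by (simp only: tile)
  qed
  ultimately show ?thesis by blast
qed

end
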